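(* For $\operatorname{Re}(\epsilon)<B^{p_+p_-}_\epsilon$ and $\epsilon\in\mathbb{S}(k,m)$, $k\in\mathbb{Z}$ and $m\in\{0,1,\dots,2p_+p_--1\}$, $$\operatorname{qdim}[\mathcal{I}^\epsilon_{r,s;n}]=\begin{cases}(-1)^{mn}\dfrac{\sin\left(\frac{\pi m}{p_+}r\right)\sin\left(\frac{\pi m}{p_-}s\right)}{\sin\left(\frac{\pi m}{p_+}\right)\sin\left(\frac{\pi m}{p_-}\right)} & \text{if } p_+,p_-\text{ do not divide }m,\\[4mm] s(-1)^{t(p_-n+1+s)}\dfrac{\sin\left(\frac{\pi tp_-}{p_+}r\right)}{\sin\left(\frac{\pi tp_-}{p_+}\right)} & \text{if only }p_-\text{ divides }m=tp_-,\\[4mm] r(-1)^{t(p_+n+1+r)}\dfrac{\sin\left(\frac{\pi tp_+}{p_-}s\right)}{\sin\left(\frac{\pi tp_+}{p_-}\right)} & \text{if only }p_+\text{ divides }m=tp_+,\\[4mm] (-1)^{n+m}\dfrac{\sin\left(\frac{\pi r}{p_+}\right)\sin\left(\frac{\pi s}{p_-}\right)}{\sin\left(\frac{\pi}{p_+}\right)\sin\left(\frac{\pi}{p_-}\right)} & \text{if }m=0,p_+p_-,\end{cases}$$ where $1\le r\le p_+$, $1\le s\le p_-$ and $n\in\mathbb{Z}$.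
   Context: Let $p_+,p_-\ge2$ be coprime integers, $\alpha_+=\sqrt{2p_-/p_+}$, $\alpha_-=-\sqrt{2p_+/p_-}$, $\alpha_0=\alpha_++\alpha_-$, $\alpha=\sqrt{2p_+p_-}$, $\alpha_{r,s;n}=\frac{1-r}{2}\alpha_++\frac{1-s}{2}\alpha_-+\frac n2\alpha$. Put $q=e^{2\pi i\tau}$ (with $q^x:=e^{2\pi i\tau x}$), $\eta$ the Dedekind eta function, $\theta_{a,b}(\tau)=\sum_{k\in\mathbb{Z}}q^{a(k+\frac{b}{2a})^2}$; $\delta_{n\ge0}$, $\delta_{n\text{ even}}$, $\delta_{n\text{ odd}}$ are indicator functions. The singlet vertex operator algebra $\mathcal{M}(p_+,p_-)$ is the intersection of the kernels of two commuting screening operators on the Heisenberg Fock module $\mathcal{F}_0$; its modules include the Fock modules $\mathcal{F}_\lambda$, irreducible submodules $\mathcal{I}_{r,s;n}$ of Fock modules, Virasoro minimal model modules $\mathcal{L}_{r,s}$, and the vacuum module $\mathcal{K}_{1,1;0}$. The regularised characters ($\epsilon\in\mathbb{C}$) are: Fock: $\mathrm{ch}[\mathcal{F}^\epsilon_\lambda](\tau)=e^{2\pi\epsilon(\lambda-\alpha_0/2)}q^{(\lambda-\alpha_0/2)^2/2}/\eta(\tau)$, with $\mathcal{F}^\epsilon_{r,s;n}:=\mathcal{F}^\epsilon_{\alpha_{r,s;n}}$. Minimal models (not regularised), $1\le r<p_+$, $1\le s<p_-$: $\mathrm{ch}[\mathcal{L}_{r,s}]=\bigl(\theta_{p_+p_-,rp_--sp_+}-\theta_{p_+p_-,rp_-+sp_+}\bigr)/\eta$.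 For $1\le r<p_+$, $1\le s<p_-$: $\mathrm{ch}[\mathcal{I}^\epsilon_{r,s;n}]=n\,\delta_{n\ge0}\bigl(\delta_{n\text{ even}}\mathrm{ch}[\mathcal{L}_{r,s}]-\delta_{n\text{ odd}}\mathrm{ch}[\mathcal{L}_{r,p_--s}]\bigr)+\sum_{k\ge0}(k+1)\bigl(\mathrm{ch}[\mathcal{F}^\epsilon_{p_+-r,s;n-2k-1}]+\mathrm{ch}[\mathcal{F}^\epsilon_{r,p_--s;n-2k-3}]-\mathrm{ch}[\mathcal{F}^\epsilon_{r,s;n-2k-2}]-\mathrm{ch}[\mathcal{F}^\epsilon_{p_+-r,p_--s;n-2k-2}]\bigr)$. Border cases: $\mathrm{ch}[\mathcal{I}^\epsilon_{r,p_-;n}]=\sum_{k\ge0}\bigl(\mathrm{ch}[\mathcal{F}^\epsilon_{p_+-r,p_-;n-2k-1}]-\mathrm{ch}[\mathcal{F}^\epsilon_{r,p_-;n-2k-2}]\bigr)$ for $1\le r<p_+$; $\mathrm{ch}[\mathcal{I}^\epsilon_{p_+,s;n}]=\sum_{k\ge0}\bigl(\mathrm{ch}[\mathcal{F}^\epsilon_{p_+,s;n-2k}]-\mathrm{ch}[\mathcal{F}^\epsilon_{p_+,p_--s;n-2k-1}]\bigr)$ for $1\le s<p_-$; $\mathrm{ch}[\mathcal{I}^\epsilon_{p_+,p_-;n}]=\mathrm{ch}[\mathcal{F}^\epsilon_{p_+,p_-;n}]$. Vacuum: $\mathrm{ch}[\mathcal{K}^\epsilon_{1,1;0}]=\mathrm{ch}[\mathcal{L}_{1,1}]+\mathrm{ch}[\mathcal{I}^\epsilon_{1,1;0}]$.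 Regularised quantum dimension: $\operatorname{qdim}[M^\epsilon]=\lim_{y\to0^+}\mathrm{ch}[M^\epsilon](iy)/\mathrm{ch}[\mathcal{K}^\epsilon_{1,1;0}](iy)$. $B_\epsilon^{p_+p_-}=-\min\{|\frac{m}{\sqrt{2p_+p_-}}-\operatorname{Im}(\epsilon)|:m\in\mathbb{Z}\setminus p_+p_-\mathbb{Z}\}$ and $\mathbb{S}(k,m)=\{\epsilon\in\mathbb{C}: k+\frac{2m-1}{4p_+p_-}<\frac{\operatorname{Im}(\epsilon)}{\sqrt{2p_+p_-}}<k+\frac{2m+1}{4p_+p_-}\}$.
   Formalization: For m=0,p_+p_- the line Im(ε)/√(2p_+p_-)=k+m/(2p_+p_-) is excluded (the limit fails to exist there), and for m=p_+p_- the sign (-1)^{n+m}, false e.g. for r=s=1, n=0, p_+p_- odd, is corrected to (-1)^{n+p_+p_-n+p_-(r+1)+p_+(s+1)}. *)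

theory Defs
  imports "HOL-Analysis.Analysis"
begin

definition alpha_plus :: "int \<Rightarrow> int \<Rightarrow> real" where
  "alpha_plus pp pm = sqrt (2 * of_int pm / of_int pp)"

definition alpha_minus :: "int \<Rightarrow> int \<Rightarrow> real" where
  "alpha_minus pp pm = - sqrt (2 * of_int pp / of_int pm)"

definition alpha_zero :: "int \<Rightarrow> int \<Rightarrow> real" where
  "alpha_zero pp pm = alpha_plus pp pm + alpha_minus pp pm"

definition alpha :: "int \<Rightarrow> int \<Rightarrow> real" where
  "alpha pp pm = sqrt (2 * of_int pp * of_int pm)"

definition weight :: "int \<Rightarrow> int \<Rightarrow> int \<Rightarrow> int \<Rightarrow> int \<Rightarrow> real" where
  "weight pp pm r s n =
     (1 - of_int r) / 2 * alpha_plus pp pm + (1 - of_int s) / 2 * alpha_minus pp pm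
       + of_int n / 2 * alpha pp pm"

definition qpow :: "complex \<Rightarrow> complex \<Rightarrow> complex" where
  "qpow \<tau> x = exp (2 * of_real pi * \<i> * \<tau> * x)"

definition dedekind_eta :: "complex \<Rightarrow> complex" where
  "dedekind_eta \<tau> = qpow \<tau> (1 / 24) * (\<Prod>k. 1 - qpow \<tau> (of_nat (Suc k)))"

definition theta :: "int \<Rightarrow> int \<Rightarrow> complex \<Rightarrow> complex" where
  "theta a b \<tau> =
     (\<Sum>\<^sub>\<infinity>k\<in>(UNIV :: int set). qpow \<tau> (of_int a * (of_int k + of_int b / (2 * of_int a))\<^sup>2))"

text \<open>
  The regularised characters are given by explicit formulas, as functions of \<open>\<tau>\<close> in the upper
  half plane; the parameter \<open>\<epsilon>\<close> is the regulator. A module enters only through its character.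
\<close>

definition ch_Fock :: "int \<Rightarrow> int \<Rightarrow> complex \<Rightarrow> complex \<Rightarrow> complex \<Rightarrow> complex" where
  "ch_Fock pp pm \<epsilon> l \<tau> =
     exp (2 * of_real pi * \<epsilon> * (l - of_real (alpha_zero pp pm) / 2))
       * qpow \<tau> ((l - of_real (alpha_zero pp pm) / 2)\<^sup>2 / 2) / dedekind_eta \<tau>"

definition ch_F :: "int \<Rightarrow> int \<Rightarrow> complex \<Rightarrow> int \<Rightarrow> int \<Rightarrow> int \<Rightarrow> complex \<Rightarrow> complex" where
  "ch_F pp pm \<epsilon> r s n = ch_Fock pp pm \<epsilon> (of_real (weight pp pm r s n))"

definition ch_L :: "int \<Rightarrow> int \<Rightarrow> int \<Rightarrow> int \<Rightarrow> complex \<Rightarrow> complex" where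
  "ch_L pp pm r s \<tau> =
     (theta (pp * pm) (r * pm - s * pp) \<tau> - theta (pp * pm) (r * pm + s * pp) \<tau>)
       / dedekind_eta \<tau>"

text \<open>
  Only \<open>1 \<le> r \<le> pp\<close> and \<open>1 \<le> s \<le> pm\<close> are meaningful, so the second branch is
  \<open>s = pm\<close>, the third \<open>r = pp\<close>, and the last \<open>r = pp\<close>, \<open>s = pm\<close>.
\<close>

definition ch_I :: "int \<Rightarrow> int \<Rightarrow> complex \<Rightarrow> int \<Rightarrow> int \<Rightarrow> int \<Rightarrow> complex \<Rightarrow> complex" where
  "ch_I pp pm \<epsilon> r s n \<tau> =
     (if r < pp \<and> s < pm then
        of_int n * of_bool (n \<ge> 0)
            * (of_bool (even n) * ch_L pp pm r s \<tau> - of_bool (odd n) * ch_L pp pm r (pm - s) \<tau>)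
        + (\<Sum>k. (of_nat k + 1) *
             (ch_F pp pm \<epsilon> (pp - r) s (n - 2 * int k - 1) \<tau>
              + ch_F pp pm \<epsilon> r (pm - s) (n - 2 * int k - 3) \<tau>
              - ch_F pp pm \<epsilon> r s (n - 2 * int k - 2) \<tau>
              - ch_F pp pm \<epsilon> (pp - r) (pm - s) (n - 2 * int k - 2) \<tau>))
      else if r < pp then
        (\<Sum>k. ch_F pp pm \<epsilon> (pp - r) pm (n - 2 * int k - 1) \<tau>
              - ch_F pp pm \<epsilon> r pm (n - 2 * int k - 2) \<tau>)
      else if s < pm then
        (\<Sum>k. ch_F pp pm \<epsilon> pp s (n - 2 * int k) \<tau>
              - ch_F pp pm \<epsilon> pp (pm - s) (n - 2 * int k - 1) \<tau>)
      else ch_F pp pm \<epsilon> pp pm n \<tau>)"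

definition ch_K :: "int \<Rightarrow> int \<Rightarrow> complex \<Rightarrow> complex \<Rightarrow> complex" where
  "ch_K pp pm \<epsilon> \<tau> = ch_L pp pm 1 1 \<tau> + ch_I pp pm \<epsilon> 1 1 0 \<tau>"

text \<open>
  \<open>has_qdim pp pm \<epsilon> ch v\<close>: the limit defining the regularised quantum dimension of a module with
  regularised character \<open>ch\<close> exists and equals \<open>v\<close>.
\<close>

definition has_qdim :: "int \<Rightarrow> int \<Rightarrow> complex \<Rightarrow> (complex \<Rightarrow> complex) \<Rightarrow> complex \<Rightarrow> bool" where
  "has_qdim pp pm \<epsilon> ch v \<longleftrightarrow>
     ((\<lambda>y::real. ch (\<i> * of_real y) / ch_K pp pm \<epsilon> (\<i> * of_real y)) \<longlongrightarrow> v) (at_right 0)"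

text \<open>The infimum is attained, since the numbers \<open>m / sqrt (2 * pp * pm)\<close> form a discrete set.\<close>

definition reg_bound :: "int \<Rightarrow> int \<Rightarrow> complex \<Rightarrow> real" where
  "reg_bound pp pm \<epsilon> =
     - Inf {\<bar>of_int m / sqrt (2 * of_int pp * of_int pm) - Im \<epsilon>\<bar> | m::int. \<not> pp * pm dvd m}"

definition strip :: "int \<Rightarrow> int \<Rightarrow> int \<Rightarrow> int \<Rightarrow> complex set" where
  "strip pp pm k m =
     {\<epsilon>. of_int k + (2 * of_int m - 1) / (4 * of_int pp * of_int pm)
            < Im \<epsilon> / sqrt (2 * of_int pp * of_int pm)
        \<and> Im \<epsilon> / sqrt (2 * of_int pp * of_int pm)
            < of_int k + (2 * of_int m + 1) / (4 * of_int pp * of_int pm)}"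

end

theory Submission
  imports Defs "HOL-Complex_Analysis.Cauchy_Integral_Formula" "HOL-Probability.Characteristic_Functions"
    "HOL-Real_Asymp.Real_Asymp"
begin

text \<open>
  Why the theorem holds. Put \<open>N = p\<^sub>+ * p\<^sub>-\<close>, \<open>a = sqrt (2 * N)\<close> and \<open>\<tau> = \<i> * y\<close>. Up to the factor
  \<open>1 / \<eta>\<close>, which cancels in every quotient of characters, the Fock character with label \<open>(r, s; n)\<close>
  is the Gaussian \<open>g x = exp (\<pi> a \<epsilon> x - \<pi> N y x\<^sup>2 / 2)\<close> at \<open>x = n - r / p\<^sub>+ + s / p\<^sub>-\<close>
  (\<open>ch_F_reg_gauss\<close>). With \<open>A = r / p\<^sub>+\<close> and \<open>B = s / p\<^sub>-\<close> the character of every irreducible module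
  becomes one and the same half-lattice sum

     \<open>\<Sum>k\<ge>1. k * (g (n+A+B-2k) - g (n+A-B-2k) - g (n-A+B-2k) + g (n-A-B-2k))\<close>

  up to minimal model characters. The border cases are included, because for \<open>A = 1\<close> or \<open>B = 1\<close> the
  weighted sum telescopes to the unweighted one (\<open>half_sum_edge\<close>, \<open>half_sum_corner\<close>).

  For \<open>Re \<epsilon> < 0\<close> the terms with \<open>k \<le> 0\<close> of the corresponding sum over all integers stay bounded as
  \<open>y\<close> tends to 0, and the minimal model part is \<open>O(1/y)\<close>. Both are negligible: Poisson summation
  (\<open>gauss_combination_poisson\<close>) rewrites the sum over all integers as a sum over modes \<open>j\<close> whose terms
  have size \<open>exp (\<pi> ((a Re \<epsilon>)\<^sup>2 - (j - a Im \<epsilon>)\<^sup>2) / (2 N y))\<close>, and the bound on \<open>Re \<epsilon>\<close> makes the largest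
  of them grow exponentially. So the quantum dimension is the quotient of the coefficients of the
  mode \<open>j\<close> closest to \<open>a Im \<epsilon>\<close> (\<open>has_qdim_of_dominant_mode\<close>), and the strip says that this is
  \<open>J = m + 2 N k\<close>.

  The coefficient of a mode has a part of order \<open>1/y\<close>, relative to the rest, which is proportional to
  \<open>(-1) ^ (j n) sin (\<pi> j A) sin (\<pi> j B)\<close>; this gives the generic case. If exactly one of \<open>p\<^sub>+\<close>, \<open>p\<^sub>-\<close>
  divides \<open>m\<close>, that part vanishes at \<open>J\<close> for all modules including the vacuum, and the next part,
  which carries the factor \<open>s\<close> or \<open>r\<close>, decides. If both divide \<open>m\<close>, the coefficient of \<open>J\<close> vanishes
  completely and the second closest mode takes over; it is \<open>J + 1\<close> or \<open>J - 1\<close> according to the side of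
  the centre of the strip on which \<open>\<epsilon>\<close> lies, and both give the same quotient.

  Poisson summation is obtained from Chernoff's proof of the pointwise convergence of Fourier series,
  which is particularly short for entire periodic functions (\<open>fourier_series_at_0\<close>).
\<close>

section \<open>Fourier series of entire periodic functions\<close>

definition fourier_coeff :: "(complex \<Rightarrow> complex) \<Rightarrow> int \<Rightarrow> complex" where
  "fourier_coeff f j =
     integral {0..1} (\<lambda>x. f (of_real x) * exp (- (2 * of_real pi * \<i> * of_int j * of_real x)))"

lemma fourier_kernel_at_1: "exp (- (2 * of_real pi * \<i> * of_int j)) = (1 :: complex)"
  using exp_integer_2pi[of "of_int (- j)"] by (simp add: ac_simps)

lemma fourier_integrable:
  fixes f :: "complex \<Rightarrow> complex"
  assumes "continuous_on UNIV f"
  shows "(\<lambda>x. f (of_real x) * exp (- (2 * of_real pi * \<i> * of_int j * of_real x))) integrable_on {a..b}"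
  by (intro integrable_continuous_interval continuous_intros continuous_on_compose2[OF assms]) auto

text \<open>
  Integration by parts: the boundary terms cancel by periodicity, so a coefficient is that of the
  derivative divided by \<open>2 \<pi> i j\<close>.
\<close>

lemma fourier_coeff_bound:
  assumes hol: "h holomorphic_on UNIV" and per: "h 1 = h 0"
  shows "\<exists>M. \<forall>j. j \<noteq> 0 \<longrightarrow> norm (fourier_coeff h j) \<le> M / \<bar>of_int j\<bar>"
proof -
  have cont: "continuous_on UNIV h" "continuous_on UNIV (deriv h)"
    using hol holomorphic_deriv[OF hol open_UNIV] holomorphic_on_imp_continuous_on by blast+
  define w :: "int \<Rightarrow> real \<Rightarrow> complex" where "w j x = exp (- (2 * of_real pi * \<i> * of_int j * of_real x))"
      for j x
  have "compact ((\<lambda>x::real. deriv h (of_real x)) ` {0..1})"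
    by (intro compact_continuous_image continuous_on_compose2[OF cont(2)] continuous_intros) auto
  then obtain M where M: "\<And>x. x \<in> {0..1::real} \<Longrightarrow> norm (deriv h (of_real x)) \<le> M"
    by (meson bounded_iff compact_imp_bounded imageI)
  have "norm (fourier_coeff h j) \<le> M / \<bar>of_int j\<bar>" if j: "j \<noteq> 0" for j
  proof -
    define c where "c = - (2 * of_real pi * \<i> * of_int j :: complex)"
    have c0: "c \<noteq> 0" using j by (simp add: c_def)
    have wc: "w j x = exp (c * of_real x)" for x by (simp add: w_def c_def)
    have "((\<lambda>x. deriv h (of_real x) * w j x + h (of_real x) * (c * w j x)) has_integral
           (h (of_real 1) * w j 1 - h (of_real 0) * w j 0)) {0..1}"
    proof (rule fundamental_theorem_of_calculus)
      fix x :: real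
      have "(h has_field_derivative deriv h (of_real x)) (at (of_real x))"
        using hol holomorphic_derivI by blast
      then have "((\<lambda>z. h z * exp (c * z)) has_field_derivative
           deriv h (of_real x) * exp (c * of_real x) + h (of_real x) * (c * exp (c * of_real x)))
               (at (of_real x))"
        by (auto intro!: derivative_eq_intros)
      from has_vector_derivative_real_field[OF this]
      show "((\<lambda>x. h (of_real x) * w j x) has_vector_derivative
          deriv h (of_real x) * w j x + h (of_real x) * (c * w j x)) (at x within {0..1})"
        unfolding wc by simp
    qed simp
    moreover have "h (of_real 1) * w j 1 - h (of_real 0) * w j 0 = 0"
      using per by (simp add: w_def fourier_kernel_at_1)
    ultimately have 1: "((\<lambda>x. deriv h (of_real x) * w j x + c * (h (of_real x) * w j x)) has_integral 0)
        {0..1}"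
      by (simp add: algebra_simps)
    have 2: "((\<lambda>x. c * (h (of_real x) * w j x)) has_integral (c * fourier_coeff h j)) {0..1}"
      unfolding fourier_coeff_def w_def
      by (intro has_integral_mult_right integrable_integral fourier_integrable cont)
    from has_integral_diff[OF 1 2]
    have 3: "((\<lambda>x. deriv h (of_real x) * w j x) has_integral (- (c * fourier_coeff h j))) (cbox 0 1)"
      by simp
    have nw: "norm (w j x) = 1" for x by (simp add: w_def)
    have "norm (- (c * fourier_coeff h j)) \<le> M * measure lborel (cbox 0 (1::real))"
    proof (rule has_integral_bound[OF _ 3])
      show "0 \<le> M" using order_trans[OF norm_ge_zero M[of 0]] by simp
      show "norm (deriv h (of_real x) * w j x) \<le> M" if "x \<in> cbox 0 1" for x
        using M[of x] nw that by (simp add: norm_mult)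
    qed
    then have "norm c * norm (fourier_coeff h j) \<le> M" by (simp add: norm_mult)
    moreover have "\<bar>of_int j\<bar> \<le> norm c" 
      using pi_gt3 by (simp add: c_def norm_mult mult_le_cancel_right1)
    ultimately have "\<bar>of_int j\<bar> * norm (fourier_coeff h j) \<le> M"
      by (meson mult_right_mono norm_ge_zero order_trans)
    then show ?thesis using j by (simp add: field_simps)
  qed
  then show ?thesis by blast
qed

lemma periodic_int_shift:
  fixes f :: "complex \<Rightarrow> complex"
  assumes per: "\<And>z. f (z + 1) = f z"
  shows "f (z - of_int n) = f z"
proof -
  have nat: "f (z + of_nat m) = f z" for z m
  proof (induction m)
    case (Suc m) then show ?case using per[of "z + of_nat m"] by (simp add: algebra_simps)
  qed simp
  show ?thesis
  proof (cases n rule: int_cases2)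
    case (nonneg m) then show ?thesis using nat[of "z - of_nat m" m] by simp
  next
    case (nonpos m) then show ?thesis using nat[of z m] by simp
  qed
qed

text \<open>
  The divisor has simple zeros, exactly at the integers, and \<open>f\<close> vanishes there by periodicity; so the
  singularities of the quotient are removable.
\<close>

lemma entire_periodic_quotient:
  assumes hol: "f holomorphic_on UNIV" and per: "\<And>z. f (z + 1) = f z" and f0: "f 0 = 0"
  obtains h where "h holomorphic_on UNIV" "\<And>z. h (z + 1) = h z"
    "\<And>z. f z = (exp (2 * of_real pi * \<i> * z) - 1) * h z"
proof -
  define E where "E z = exp (2 * of_real pi * \<i> * z) - 1" for z :: complex
  have E0: "E z = 0 \<longleftrightarrow> z \<in> \<int>" for z
  proof -
    have "E z = 0 \<longleftrightarrow> exp (2 * of_real pi * \<i> * z) = exp 0" by (simp add: E_def)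
    also have "\<dots> \<longleftrightarrow> (\<exists>n::int. 2 * of_real pi * \<i> * z = of_int (2 * n) * (of_real pi * \<i>))"
      unfolding exp_eq by simp
    also have "\<dots> \<longleftrightarrow> (\<exists>n::int. z = of_int n)" by (intro ex_cong1) (auto simp: field_simps)
    also have "\<dots> \<longleftrightarrow> z \<in> \<int>" by (auto elim: Ints_cases)
    finally show ?thesis .
  qed
  have Eper: "E (z + 1) = E z" for z
    by (simp add: E_def distrib_left exp_add)
  have Ehol: "E holomorphic_on S" for S unfolding E_def by (intro holomorphic_intros)
  have dE: "deriv E 0 = 2 * of_real pi * \<i>"
    unfolding E_def by (rule DERIV_imp_deriv) (auto intro!: derivative_eq_intros)
  define h where "h z = (if z \<in> \<int> then deriv f 0 / deriv E 0 else f z / E z)" for z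
  define qf where "qf = (\<lambda>z. if z = 0 then deriv f 0 else (f z - f 0) / (z - 0))"
  define qe where "qe = (\<lambda>z. if z = 0 then deriv E 0 else (E z - E 0) / (z - 0))"
  have qhol: "qf holomorphic_on ball 0 1" "qe holomorphic_on ball 0 1"
    unfolding qf_def qe_def
    by (auto intro!: pole_lemma_open holomorphic_on_subset[OF hol] Ehol)
  have int_ball: "z = 0" if "z \<in> \<int>" "z \<in> ball 0 1" for z :: complex
    using that by (elim Ints_cases) (auto simp: )
  have E00: "E 0 = 0" by (simp add: E_def)
  have qe0: "qe z \<noteq> 0" if "z \<in> ball 0 1" for z
    using int_ball[of z] that E0[of z] by (auto simp: qe_def dE E00)
  have heq: "h z = qf z / qe z" if "z \<in> ball 0 1" for z
    using int_ball[of z] that by (auto simp: h_def qf_def qe_def f0 E00)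
  have "(\<lambda>z. qf z / qe z) holomorphic_on ball 0 1"
    using qhol qe0 by (intro holomorphic_intros) auto
  then have h_near0: "h holomorphic_on ball 0 1"
    by (rule holomorphic_transform) (simp add: heq)
  have Ints_p1: "z + 1 \<in> \<int> \<longleftrightarrow> z \<in> \<int>" for z :: complex
    by (metis Ints_1 Ints_add Ints_diff add_diff_cancel_right')
  have hper: "h (z + 1) = h z" for z by (simp add: h_def Ints_p1 per Eper)
  have hperi: "h (z - of_int n) = h z" for z n
    by (rule periodic_int_shift) (rule hper)
  have "h field_differentiable at z" for z
  proof (cases "z \<in> \<int>")
    case True
    then obtain n where n: "z = of_int n" by (elim Ints_cases)
    have "h field_differentiable at 0"
      using h_near0 by (simp add: holomorphic_on_imp_differentiable_at)
    then have "(h \<circ> (\<lambda>w. w - of_int n)) field_differentiable at z"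
      by (intro field_differentiable_compose) (auto simp: n intro!: derivative_intros)
    also have "h \<circ> (\<lambda>w. w - of_int n) = h" by (auto simp: hperi)
    finally show ?thesis .
  next
    case False
    have op: "open (UNIV - \<int> :: complex set)" by (simp add: closed_Ints open_Diff)
    have "(\<lambda>z. f z / E z) holomorphic_on (UNIV - \<int>)"
      using hol Ehol E0 by (auto intro!: holomorphic_intros intro: holomorphic_on_subset)
    then have "h holomorphic_on (UNIV - \<int>)"
      by (rule holomorphic_transform) (simp add: h_def)
    then show ?thesis using op False holomorphic_on_imp_differentiable_at by blast
  qed
  then have hhol: "h holomorphic_on UNIV"
    by (simp add: field_differentiable_at_within holomorphic_on_def)
  have fint: "f z = 0" if "z \<in> \<int>" for z
  proof -
    from that obtain n where "z = of_int n" by (elim Ints_cases)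
    then show ?thesis using periodic_int_shift[of f z n] per f0 by simp
  qed
  have "f z = (exp (2 * of_real pi * \<i> * z) - 1) * h z" for z
    using fint[of z] E0[of z] unfolding E_def[symmetric] by (auto simp: h_def)
  then show ?thesis using hhol hper that by blast
qed

lemma sum_int_telescope:
  fixes a :: "int \<Rightarrow> 'a :: ab_group_add"
  shows "(\<Sum>j\<in>{- int n..int n}. a (j - 1) - a j) = a (- int n - 1) - a (int n)"
proof (induction n)
  case (Suc n)
  have "{- int (Suc n)..int (Suc n)} = insert (- int n - 1) (insert (int n + 1) {- int n..int n})"
    by auto
  then show ?case using Suc by (simp add: algebra_simps)
qed simp

text \<open>
  Chernoff's argument. Multiplication by \<open>exp (2 \<pi> i z)\<close> shifts Fourier coefficients, so after writing
  \<open>f - f 0 = (exp (2 \<pi> i z) - 1) * h\<close> the partial sums of the coefficients of \<open>f - f 0\<close> telescope to two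
  coefficients of \<open>h\<close>, which tend to 0.
\<close>

theorem fourier_series_at_0:
  assumes hol: "f holomorphic_on UNIV" and per: "\<And>z. f (z + 1) = f z"
  shows "(\<lambda>n. \<Sum>j\<in>{- int n..int n}. fourier_coeff f j) \<longlonglongrightarrow> f 0"
proof -
  have "(\<lambda>z. f z - f 0) holomorphic_on UNIV" using hol by (intro holomorphic_intros)
  then obtain h where h: "h holomorphic_on UNIV" "\<And>z. h (z + 1) = h z"
    "\<And>z. f z - f 0 = (exp (2 * of_real pi * \<i> * z) - 1) * h z"
    using entire_periodic_quotient[of "\<lambda>z. f z - f 0"] per
        by (metis (no_types, lifting) cancel_comm_monoid_add_class.diff_cancel)
  have cont: "continuous_on UNIV f" "continuous_on UNIV h"
    using hol h(1) holomorphic_on_imp_continuous_on by blast+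
  define w :: "int \<Rightarrow> real \<Rightarrow> complex" where "w j x = exp (- (2 * of_real pi * \<i> * of_int j * of_real x))"
      for j x
  have const: "((\<lambda>x. f 0 * w j x) has_integral (if j = 0 then f 0 else 0)) {0..1}" for j
  proof (cases "j = 0")
    case True
    then show ?thesis using has_integral_const_real[of "f 0" 0 1] by (simp add: w_def)
  next
    case False
    define c where "c = - (2 * of_real pi * \<i> * of_int j :: complex)"
    have c0: "c \<noteq> 0" using False by (simp add: c_def)
    have "((\<lambda>x. f 0 * exp (c * of_real x)) has_integral
            (f 0 * exp (c * of_real 1) / c - f 0 * exp (c * of_real 0) / c)) {0..1}"
    proof (rule fundamental_theorem_of_calculus)
      fix x :: real
      have "((\<lambda>z. f 0 * exp (c * z) / c) has_field_derivative f 0 * exp (c * of_real x)) (at (of_real x))"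
        using c0 by (auto intro!: derivative_eq_intros)
      from has_vector_derivative_real_field[OF this]
      show "((\<lambda>x. f 0 * exp (c * of_real x) / c) has_vector_derivative f 0 * exp (c * of_real x))
          (at x within {0..1})"
        by simp
    qed simp
    moreover have "exp c = 1" by (simp add: c_def fourier_kernel_at_1)
    ultimately show ?thesis using False by (simp add: w_def c_def)
  qed
  have fc: "fourier_coeff f j = (if j = 0 then f 0 else 0) + (fourier_coeff h (j - 1)
      - fourier_coeff h j)" for j
  proof -
    have hI: "((\<lambda>x. h (of_real x) * w j x) has_integral fourier_coeff h j) {0..1}" for j
      unfolding fourier_coeff_def w_def by (intro integrable_integral fourier_integrable cont)
    have "((\<lambda>x. f 0 * w j x + (h (of_real x) * w (j - 1) x - h (of_real x) * w j x)) has_integral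
        ((if j = 0 then f 0 else 0) + (fourier_coeff h (j - 1) - fourier_coeff h j))) {0..1}"
      by (intro has_integral_add has_integral_diff const hI)
    moreover have "f 0 * w j x + (h (of_real x) * w (j - 1) x - h (of_real x) * w j x)
        = f (of_real x) * w j x" for x
    proof -
      have "w (j - 1) x = exp (2 * of_real pi * \<i> * of_real x) * w j x"
        by (simp add: w_def exp_add [symmetric] algebra_simps)
      then show ?thesis using h(3)[of "of_real x"] by algebra
    qed
    ultimately have "((\<lambda>x. f (of_real x) * w j x) has_integral
        ((if j = 0 then f 0 else 0) + (fourier_coeff h (j - 1) - fourier_coeff h j))) {0..1}" by simp
    then show ?thesis unfolding fourier_coeff_def w_def by (rule integral_unique)
  qed
  obtain M where M: "\<And>j. j \<noteq> 0 \<Longrightarrow> norm (fourier_coeff h j) \<le> M / \<bar>of_int j\<bar>"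
    using fourier_coeff_bound[OF h(1)] h(2)[of 0] by auto
  have "(\<Sum>j\<in>{- int n..int n}. fourier_coeff f j) = f 0 + (fourier_coeff h (- int n - 1)
      - fourier_coeff h (int n))" for n
    unfolding fc by (simp add: sum.distrib sum_int_telescope sum.delta)
  moreover have "(\<lambda>n. fourier_coeff h (- int n - 1)) \<longlonglongrightarrow> 0"
  proof (rule Lim_null_comparison)
    show "eventually (\<lambda>n. norm (fourier_coeff h (- int n - 1)) \<le> M / (real n + 1)) sequentially"
      using M[of "- int n - 1" for n] by (intro always_eventually) (auto simp: abs_if add.commute)
    show "(\<lambda>n. M / (real n + 1)) \<longlonglongrightarrow> 0" by real_asymp
  qed
  moreover have "(\<lambda>n. fourier_coeff h (int n)) \<longlonglongrightarrow> 0"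
  proof (rule Lim_null_comparison)
    show "eventually (\<lambda>n. norm (fourier_coeff h (int n)) \<le> M / real n) sequentially"
      using eventually_gt_at_top[of 0] by eventually_elim (use M[of "int n" for n] in auto)
    show "(\<lambda>n. M / real n) \<longlonglongrightarrow> 0" by real_asymp
  qed
  ultimately have "(\<lambda>n. \<Sum>j\<in>{- int n..int n}. fourier_coeff f j) \<longlonglongrightarrow> f 0 + (0 - 0)"
    by (simp only:) (intro tendsto_intros)
  then show ?thesis by simp
qed

section \<open>Poisson summation\<close>

lemma summable_on_int_from_nat:
  fixes f :: "int \<Rightarrow> real"
  assumes "summable (\<lambda>n. f (int n))" "summable (\<lambda>n. f (- int (Suc n)))" "\<And>k. f k \<ge> 0"
  shows "f summable_on UNIV"
proof -
  have b1: "bij_betw int UNIV {0..}" by (auto simp: bij_betw_def inj_on_def image_iff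
      intro: zero_le_imp_eq_int)
  have b2: "bij_betw (\<lambda>n. - int (Suc n)) UNIV {..<0}"
  proof (rule bij_betw_byWitness[where f' = "\<lambda>k. nat (- k - 1)"]) qed auto
  have "f summable_on {0..}"
    using summable_on_reindex_bij_betw[OF b1, of f] assms by (simp add: summable_on_UNIV_nonneg_real_iff)
  moreover have "f summable_on {..<0}"
    using summable_on_reindex_bij_betw[OF b2, of f] assms by (simp add: summable_on_UNIV_nonneg_real_iff)
  ultimately have "f summable_on ({0..} \<union> {..<0})" by (intro summable_on_Un_disjoint) auto
  also have "{0..} \<union> {..<0} = (UNIV :: int set)" by auto
  finally show ?thesis .
qed

lemma inverse_square_summable_on_int: "(\<lambda>k::int. 1 / (1 + (real_of_int k)\<^sup>2)) summable_on UNIV"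
proof (rule summable_on_int_from_nat)
  have s: "summable (\<lambda>n. inverse (real (Suc n) ^ 2))"
    using inverse_power_summable[of 2, where ?'a = real] by (subst summable_Suc_iff) simp
  show "summable (\<lambda>n. 1 / (1 + (real_of_int (- int (Suc n)))\<^sup>2))"
    by (rule summable_comparison_test'[OF s, of 0])
       (simp add: inverse_eq_divide, rule frac_le, auto simp: power2_eq_square algebra_simps add_pos_nonneg)
  have s: "summable (\<lambda>n. inverse (real n ^ 2))"
    using inverse_power_summable[of 2, where ?'a = real] by simp
  show "summable (\<lambda>n. 1 / (1 + (real_of_int (int n))\<^sup>2))"
    by (rule summable_comparison_test'[OF s, of 1])
       (simp add: inverse_eq_divide, rule frac_le, auto)
qed auto

lemma filterlim_symmetric_int_intervals:
  "filterlim (\<lambda>n. {- int n..int n}) (finite_subsets_at_top UNIV) sequentially"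
  unfolding filterlim_finite_subsets_at_top
proof (intro allI impI)
  fix X :: "int set" assume X: "finite X \<and> X \<subseteq> UNIV"
  then obtain b where b: "\<And>k. k \<in> X \<Longrightarrow> \<bar>k\<bar> \<le> b"
    by (metis finite_imageI Max_ge image_eqI)
  show "\<forall>\<^sub>F n in sequentially. finite {- int n..int n} \<and> X \<subseteq> {- int n..int n} \<and> {- int n..int n} \<subseteq> UNIV"
    using eventually_ge_at_top[of "nat b"]
  proof eventually_elim
    case (elim n)
    then have "k \<in> {- int n..int n}" if "k \<in> X" for k using b[OF that] by auto
    then show ?case by auto
  qed
qed

lemma has_sum_int_imp_symmetric_limit:
  assumes "(f has_sum S) (UNIV :: int set)"
  shows "(\<lambda>n. \<Sum>k\<in>{- int n..int n}. f k) \<longlonglongrightarrow> S"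
  using filterlim_compose[OF assms[unfolded has_sum_def] filterlim_symmetric_int_intervals] .

lemma integral_unit_intervals:
  fixes f :: "real \<Rightarrow> 'a :: banach"
  assumes "\<And>a b. f integrable_on {a..b}"
  shows "(\<Sum>k\<in>{- int n..int n}. integral {of_int k..of_int k + 1} f) = integral {- real n..real n + 1} f"
proof (induction n)
  case (Suc n)
  have eq: "{- int (Suc n)..int (Suc n)} = insert (- 1 - int n) (insert (int n + 1) {- int n..int n})"
    by auto
  have "integral {- real (Suc n)..real (Suc n) + 1} f =
      integral {- real (Suc n)..- real n} f + integral {- real n..real (Suc n) + 1} f"
    by (rule Henstock_Kurzweil_Integration.integral_combine[symmetric]) (use assms in auto)
  also have "integral {- real n..real (Suc n) + 1} f =
      integral {- real n..real n + 1} f + integral {real n + 1..real (Suc n) + 1} f"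
    by (rule Henstock_Kurzweil_Integration.integral_combine[symmetric]) (use assms in auto)
  finally have "integral {- real (Suc n)..real (Suc n) + 1} f = integral {- real (Suc n)..- real n} f +
     (integral {- real n..real n + 1} f + integral {real n + 1..real (Suc n) + 1} f)" .
  then show ?case
    unfolding eq using Suc by (simp add: add.commute add.left_commute)
qed simp

text \<open>
  The periodisation of \<open>G\<close> is entire by the decay assumption, and its value at 0 is the limit of its
  symmetric Fourier sums. Its coefficients are integrals over \<open>[0, 1]\<close> of a sum of translates, hence
  limits of integrals of \<open>G\<close> over growing intervals; the coefficients \<open>c j\<close> are taken in this form.
\<close>

theorem poisson_summation_entire:
  fixes G :: "complex \<Rightarrow> complex"
  assumes hol: "G holomorphic_on UNIV"
    and decay: "\<And>R. \<exists>B. \<forall>z. \<bar>Im z\<bar> \<le> R \<longrightarrow> norm (G z) * (1 + (Re z)\<^sup>2) \<le> B"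
    and coeff: "\<And>j. (\<lambda>n. integral {- real n..real n + 1}
        (\<lambda>x. G (of_real x) * exp (- (2 * of_real pi * \<i> * of_int j * of_real x)))) \<longlonglongrightarrow> c j"
  shows "(\<lambda>n. \<Sum>j\<in>{- int n..int n}. c j) \<longlonglongrightarrow> (\<Sum>\<^sub>\<infinity>k::int. G (of_int k))"
proof -
  define f where "f z = (\<Sum>\<^sub>\<infinity>k::int. G (z + of_int k))" for z
  \<comment> \<open>On a disc the translates are dominated uniformly, since \<open>1 + k\<^sup>2 \<le> (2 + 2 R\<^sup>2) (1 + (x + k)\<^sup>2)\<close> for \<open>\<bar>x\<bar> \<le> R\<close>.\<close>
  have bound: "\<exists>C. \<forall>z k. norm z \<le> R \<longrightarrow> norm (G (z + of_int k)) \<le> C * (1 / (1 + (real_of_int k)\<^sup>2))" for R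
  proof -
    obtain B where B: "\<And>z. \<bar>Im z\<bar> \<le> R \<Longrightarrow> norm (G z) * (1 + (Re z)\<^sup>2) \<le> B" using decay by blast
    have "norm (G (z + of_int k)) \<le> (B * (2 + 2 * R\<^sup>2)) * (1 / (1 + (real_of_int k)\<^sup>2))" if z: "norm z
        \<le> R" for z k
    proof -
      have im: "\<bar>Im (z + of_int k)\<bar> \<le> R" using z abs_Im_le_cmod[of z] by simp
      define x where "x = Re z"
      have x: "x\<^sup>2 \<le> R\<^sup>2" using power_mono[of "\<bar>Re z\<bar>" R 2] z abs_Re_le_cmod[of z] by (simp add: x_def)
      have "1 + (real_of_int k)\<^sup>2 \<le> 1 + 2 * (x + of_int k)\<^sup>2 + 2 * x\<^sup>2"
        using zero_le_power2[of "2 * x + of_int k"] by (simp add: power2_eq_square algebra_simps)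
      also have "\<dots> \<le> (2 + 2 * R\<^sup>2) * (1 + (x + of_int k)\<^sup>2)"
        using x mult_nonneg_nonneg[OF zero_le_power2[of R] zero_le_power2[of "x + of_int k"]]
        unfolding distrib_left distrib_right by linarith
      finally have le: "1 + (real_of_int k)\<^sup>2 \<le> (1 + (x + of_int k)\<^sup>2) * (2 + 2 * R\<^sup>2)"
          by (simp add: mult.commute)
      have "norm (G (z + of_int k)) * (1 + (real_of_int k)\<^sup>2) \<le> norm (G (z + of_int k))
          * ((1 + (x + of_int k)\<^sup>2) * (2 + 2 * R\<^sup>2))"
        using le by (intro mult_left_mono) auto
      also have "\<dots> = (norm (G (z + of_int k)) * (1 + (Re (z + of_int k))\<^sup>2)) * (2 + 2 * R\<^sup>2)"
          by (simp add: x_def)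
      also have "\<dots> \<le> B * (2 + 2 * R\<^sup>2)" using B[OF im] by (intro mult_right_mono) auto
      finally have "norm (G (z + of_int k)) * (1 + (real_of_int k)\<^sup>2) \<le> B * (2 + 2 * R\<^sup>2)" .
      moreover have "1 + (real_of_int k)\<^sup>2 > 0" by (simp add: add_pos_nonneg)
      ultimately show ?thesis by (simp add: pos_le_divide_eq)
    qed
    then show ?thesis by blast
  qed
  have ulim: "uniform_limit (cball 0 R) (\<lambda>n z. \<Sum>k\<in>{- int n..int n}. G (z + of_int k)) f sequentially" for R
  proof -
    obtain C where C: "\<And>z k. norm z \<le> R \<Longrightarrow> norm (G (z + of_int k)) \<le> C * (1 / (1 + (real_of_int k)\<^sup>2))"
      using bound by blast
    have "uniform_limit (cball 0 R) (\<lambda>X z. \<Sum>k\<in>X. G (z + of_int k)) f (finite_subsets_at_top UNIV)"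
      unfolding f_def
      by (rule Weierstrass_m_test_general[where M = "\<lambda>k. C * (1 / (1 + (real_of_int k)\<^sup>2))"])
         (auto intro!: C summable_on_cmult_right inverse_square_summable_on_int simp del:
             times_divide_eq_right)
    then show ?thesis by (rule filterlim_compose[OF _ filterlim_symmetric_int_intervals])
  qed
  have hol': "(\<lambda>z. \<Sum>k\<in>{- int n..int n}. G (z + of_int k)) holomorphic_on UNIV" for n
  proof (intro holomorphic_on_sum)
    fix k
    have "(G \<circ> (\<lambda>z. z + of_int k)) holomorphic_on UNIV"
      by (intro holomorphic_on_compose holomorphic_intros holomorphic_on_subset[OF hol]) auto
    then show "(\<lambda>z. G (z + of_int k)) holomorphic_on UNIV" by (simp add: o_def)
  qed
  have fhol: "f holomorphic_on UNIV"
  proof (rule holomorphic_uniform_sequence[OF open_UNIV hol'])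
    fix z :: complex
    have "uniform_limit (cball z 1) (\<lambda>n z. \<Sum>k\<in>{- int n..int n}. G (z + of_int k)) f sequentially"
    proof (rule uniform_limit_on_subset[OF ulim[of "norm z + 1"]], rule subsetI)
      fix x assume "x \<in> cball z 1"
      then show "x \<in> cball 0 (norm z + 1)"
        using norm_triangle_sub[of x z] by (simp add: dist_norm norm_minus_commute)
    qed
    then show "\<exists>d>0. cball z d \<subseteq> UNIV \<and> uniform_limit (cball z d) (\<lambda>n z. \<Sum>k\<in>{-
        int n..int n}. G (z + of_int k)) f sequentially"
      by (intro exI[of _ 1]) auto
  qed
  have fper: "f (z + 1) = f z" for z
  proof -
    have "bij_betw (\<lambda>k::int. k + 1) UNIV UNIV" by (rule bij_betw_byWitness[where f' = "\<lambda>k. k - 1"]) auto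
    from infsum_reindex_bij_betw[OF this, of "\<lambda>k. G (z + of_int k)"]
    show ?thesis by (simp add: f_def algebra_simps)
  qed
  have contG: "continuous_on UNIV G" using hol holomorphic_on_imp_continuous_on by blast
  define w :: "int \<Rightarrow> real \<Rightarrow> complex" where "w j x = exp (- (2 * of_real pi * \<i> * of_int j * of_real x))"
      for j x
  have fc: "fourier_coeff f j = c j" for j
  proof -
    have u1: "uniform_limit {0..1} (\<lambda>n x. \<Sum>k\<in>{- int n..int n}. G (of_real x + of_int k))
        (\<lambda>x::real. f (of_real x)) sequentially"
      by (rule uniform_limit_compose'[OF ulim[of 1]]) auto
    have u2: "uniform_limit {0..1} (\<lambda>n x. w j x * (\<Sum>k\<in>{- int n..int n}. G (of_real x + of_int k)))
        (\<lambda>x::real. w j x * f (of_real x)) sequentially"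
    proof (rule uniform_limitI)
      fix e :: real assume "e > 0"
      from uniform_limitD[OF u1 this]
      show "\<forall>\<^sub>F n in sequentially. \<forall>x\<in>{0..1}. dist (w j x * (\<Sum>k\<in>{-
          int n..int n}. G (of_real x + of_int k))) (w j x * f (of_real x)) < e"
      proof eventually_elim
        case (elim n)
        have "dist (w j x * a) (w j x * b) = dist a b" for a b x
          by (simp add: dist_norm w_def norm_mult flip: right_diff_distrib)
        then show ?case using elim by simp
      qed
    qed
    have cw: "continuous_on S (w j)" for S unfolding w_def by (intro continuous_intros)
    have cG: "continuous_on S (\<lambda>x::real. G (of_real x + of_int k))" for S k
      by (intro continuous_on_compose2[OF contG] continuous_intros) auto
    have cs: "continuous_on {0..1} (\<lambda>x. w j x * (\<Sum>k\<in>{- int n..int n}. G (of_real x + of_int k)))" for n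
      by (intro continuous_intros cw cG)
    obtain I J where I: "\<And>n. ((\<lambda>x. w j x * (\<Sum>k\<in>{- int n..int n}. G (of_real x + of_int k))) has_integral
        I n) {0..1}"
      and J: "((\<lambda>x. w j x * f (of_real x)) has_integral J) {0..1}" and lim: "I \<longlonglongrightarrow> J"
      using uniform_limit_integral[OF u2 cs] by auto
    have J': "J = fourier_coeff f j"
      using integral_unique[OF J] by (simp add: fourier_coeff_def w_def mult.commute)
    have "I n = integral {- real n..real n + 1} (\<lambda>x. G (of_real x) * w j x)" for n
    proof -
      have int: "(\<lambda>x. G (of_real x) * w j x) integrable_on {a..b}" for a b
        unfolding w_def by (rule fourier_integrable[OF contG])
      have "((\<lambda>x. w j x * G (of_real x + of_int k)) has_integral integral {of_int k..of_int k
          + 1} (\<lambda>x. G (of_real x) * w j x)) {0..1}" for k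
      proof -
        have "((\<lambda>x. G (of_real x) * w j x) has_integral integral {of_int k..of_int k
            + 1} (\<lambda>x. G (of_real x) * w j x)) (cbox (of_int k) (of_int k + 1))"
          using integrable_integral[OF int] by simp
        from has_integral_affinity[OF this, of 1 "of_int k"]
        have *: "((\<lambda>x. G (of_real (x + of_int k)) * w j (x + of_int k)) has_integral
           integral {of_int k..of_int k + 1} (\<lambda>x. G (of_real x) * w j x)) {0..1}"
          by (simp add: image_affinity_atLeastAtMost_diff)
        have "w j (x + of_int k) = w j x" for x
        proof -
          have "w j (x + of_int k) = w j x * exp (- (2 * of_real pi * \<i> * of_int (j * k)))"
            by (simp add: w_def exp_add [symmetric] algebra_simps)
          then show ?thesis by (simp only: fourier_kernel_at_1 mult_1_right)
        qed
        then show ?thesis using * by (simp add: mult.commute)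
      qed
      then have "((\<lambda>x. \<Sum>k\<in>{- int n..int n}. w j x * G (of_real x + of_int k)) has_integral
         (\<Sum>k\<in>{- int n..int n}. integral {of_int k..of_int k + 1} (\<lambda>x. G (of_real x) * w j x))) {0..1}"
        by (intro has_integral_sum) auto
      then have "((\<lambda>x. w j x * (\<Sum>k\<in>{- int n..int n}. G (of_real x + of_int k))) has_integral
         integral {- real n..real n + 1} (\<lambda>x. G (of_real x) * w j x)) {0..1}"
        by (simp add: sum_distrib_left integral_unit_intervals[OF int])
      then show ?thesis using I has_integral_unique by blast
    qed
    then have "I = (\<lambda>n. integral {- real n..real n + 1} (\<lambda>x. G (of_real x) * w j x))" by blast
    then have "(\<lambda>n. integral {- real n..real n + 1} (\<lambda>x. G (of_real x) * w j x)) \<longlonglongrightarrow> fourier_coeff f j"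
      using lim unfolding J' by simp
    then show ?thesis using coeff[of j] LIMSEQ_unique unfolding w_def by blast
  qed
  have "f 0 = (\<Sum>\<^sub>\<infinity>k::int. G (of_int k))" by (simp add: f_def)
  then show ?thesis using fourier_series_at_0[OF fhol fper] by (simp add: fc)
qed

section \<open>Complex Gaussian integrals\<close>

definition cgauss :: "real \<Rightarrow> complex \<Rightarrow> complex \<Rightarrow> complex" where
  "cgauss \<alpha> \<beta> z = exp (- of_real \<alpha> * z\<^sup>2 + \<beta> * z)"

lemma norm_cgauss_real: "norm (cgauss \<alpha> \<beta> (of_real x)) = exp (- \<alpha> * x\<^sup>2 + Re \<beta> * x)"
  by (simp add: cgauss_def flip: of_real_power)

text \<open>
  The weight is what is needed to dominate \<open>k * exp (...)\<close> by a multiple of \<open>1 / (1 + k\<^sup>2)\<close>.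
\<close>

lemma cubic_times_gauss_bounded:
  assumes "\<alpha> > 0"
  shows "\<exists>B. \<forall>x::real. (1 + \<bar>x\<bar>) * (1 + x\<^sup>2) * exp (- \<alpha> * x\<^sup>2 + b * x) \<le> B"
proof -
  define g where "g x = (1 + \<bar>x\<bar>) * (1 + x\<^sup>2) * exp (- \<alpha> * x\<^sup>2 + b * x)" for x :: real
  have "((\<lambda>x. (1 + x) * (1 + x\<^sup>2) * exp (- \<alpha> * x\<^sup>2 + b * x)) \<longlongrightarrow> 0) at_top"
    using assms by real_asymp
  then have "eventually (\<lambda>x. (1 + x) * (1 + x\<^sup>2) * exp (- \<alpha> * x\<^sup>2 + b * x) < 1) at_top"
    by (rule order_tendstoD) simp
  then obtain N1 where N1: "\<And>x. x \<ge> N1 \<Longrightarrow> (1 + x) * (1 + x\<^sup>2) * exp (- \<alpha> * x\<^sup>2 + b * x) < 1"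
    by (auto simp: eventually_at_top_linorder)
  have "((\<lambda>x. (1 + x) * (1 + x\<^sup>2) * exp (- \<alpha> * x\<^sup>2 + (- b) * x)) \<longlongrightarrow> 0) at_top"
    using assms by real_asymp
  then have "eventually (\<lambda>x. (1 + x) * (1 + x\<^sup>2) * exp (- \<alpha> * x\<^sup>2 + (- b) * x) < 1) at_top"
    by (rule order_tendstoD) simp
  then obtain N2 where N2: "\<And>x. x \<ge> N2 \<Longrightarrow> (1 + x) * (1 + x\<^sup>2) * exp (- \<alpha> * x\<^sup>2 + (- b) * x) < 1"
    by (auto simp: eventually_at_top_linorder)
  define N where "N = max 0 (max N1 N2)"
  have "compact (g ` {- N..N})"
    unfolding g_def by (intro compact_continuous_image continuous_intros) auto
  then obtain B where B: "\<And>x. x \<in> {- N..N} \<Longrightarrow> norm (g x) \<le> B"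
    by (meson bounded_iff compact_imp_bounded imageI)
  have "g x \<le> max 1 B" for x
  proof -
    consider "x \<ge> N" | "x \<le> - N" | "x \<in> {- N..N}" by fastforce
    then show ?thesis
    proof cases
      case 1 then show ?thesis using N1[of x] by (simp add: g_def N_def abs_if)
    next
      case 2
      then have "N2 \<le> - x" "x \<le> 0" by (auto simp: N_def)
      then show ?thesis using N2[of "- x"] by (simp add: g_def)
    next
      case 3 then show ?thesis using B[OF 3] by simp
    qed
  qed
  then show ?thesis unfolding g_def by blast
qed

text \<open>
  A real affine substitution completes the square for \<open>Re \<beta>\<close> only. What is left over is the
  characteristic function of the standard normal distribution at a real point proportional to \<open>Im \<beta>\<close>,
  so no contour has to be moved.
\<close>

lemma gauss_integral_complex:
  assumes a: "\<alpha> > 0"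
  shows "has_bochner_integral lborel (\<lambda>x. cgauss \<alpha> \<beta> (of_real x))
           (of_real (sqrt (pi / \<alpha>)) * exp (\<beta>\<^sup>2 / (4 * of_real \<alpha>)))"
proof -
  interpret real_distribution std_normal_distribution by (rule real_dist_normal_dist)
  have std: "has_bochner_integral lborel (\<lambda>x. std_normal_density x *\<^sub>R iexp (t * x))
      (of_real (exp (- (t^2) / 2)))" for t
  proof -
    have "integrable std_normal_distribution (\<lambda>x. iexp (t * x))" 
      by (rule integrable_iexp) auto
    then have "integrable lborel (\<lambda>x. std_normal_density x *\<^sub>R iexp (t * x))"
      by (subst (asm) integrable_density) auto
    moreover have "(CLINT x|std_normal_distribution. iexp (t * x))
        = (LINT x|lborel. std_normal_density x *\<^sub>R iexp (t * x))"
      by (rule integral_density) auto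
    ultimately show ?thesis
      using fun_cong[OF char_std_normal_distribution, of t]
          by (auto simp: has_bochner_integral_iff char_def)
  qed
  \<comment> \<open>The substitution \<open>x \<mapsto> t0 + c * x\<close> moves the peak of the modulus to 0 and scales it to variance 1.\<close>
  define c where "c = 1 / sqrt (2 * \<alpha>)"
  define t0 where "t0 = Re \<beta> / (2 * \<alpha>)"
  define K where "K = of_real (sqrt (2 * pi)) * exp (\<beta> * of_real t0 - of_real (\<alpha> * t0\<^sup>2))"
  have c: "c > 0" using a by (simp add: c_def)
  have ac: "\<alpha> * c\<^sup>2 = 1 / 2" using a by (simp add: c_def power_divide)
  have eq: "cgauss \<alpha> \<beta> (of_real (t0 + c * x)) = K * (std_normal_density x *\<^sub>R iexp ((Im \<beta> * c) * x))" for x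
  proof -
    have at0: "2 * \<alpha> * t0 = Re \<beta>" using a by (simp add: t0_def)
    have "\<alpha> * (t0 + c * x)\<^sup>2 = \<alpha> * t0\<^sup>2 + (2 * \<alpha> * t0) * c * x + (\<alpha> * c\<^sup>2) * x\<^sup>2"
      by (simp add: power2_eq_square algebra_simps)
    then have "\<alpha> * (t0 + c * x)\<^sup>2 = \<alpha> * t0\<^sup>2 + Re \<beta> * c * x + x\<^sup>2 / 2"
      unfolding at0 ac by simp
    then have "- of_real \<alpha> * (of_real (t0 + c * x))\<^sup>2 + \<beta> * of_real (t0 + c * x) =
       (\<beta> * of_real t0 - of_real (\<alpha> * t0\<^sup>2)) + of_real (- x\<^sup>2 / 2) + \<i> * of_real (Im \<beta> * c * x)"
      by (auto simp: complex_eq_iff algebra_simps simp flip: of_real_power of_real_mult)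
    then have "cgauss \<alpha> \<beta> (of_real (t0 + c * x)) =
       exp (\<beta> * of_real t0 - of_real (\<alpha> * t0\<^sup>2)) * of_real (exp (- x\<^sup>2 / 2))
           * exp (\<i> * of_real (Im \<beta> * c * x))"
      by (simp only: cgauss_def exp_add exp_of_real)
    then show ?thesis
      by (simp add: K_def std_normal_density_def scaleR_conv_of_real)
  qed
  have "has_bochner_integral lborel (\<lambda>x. cgauss \<alpha> \<beta> (of_real (t0 + c * x)))
     (K * of_real (exp (- ((Im \<beta> * c)^2) / 2)))"
    unfolding eq by (intro has_bochner_integral_mult_right std)
  moreover have "K * of_real (exp (- ((Im \<beta> * c)^2) / 2)) =
     (of_real (sqrt (pi / \<alpha>)) * exp (\<beta>\<^sup>2 / (4 * of_real \<alpha>))) /\<^sub>R \<bar>c\<bar>"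
  proof -
    have s: "sqrt (2 * pi) = sqrt (pi / \<alpha>) / c" using a
        by (simp add: c_def real_sqrt_mult real_sqrt_divide field_simps)
    have "(Im \<beta> * c)\<^sup>2 / 2 = (Im \<beta>)\<^sup>2 / (4 * \<alpha>)" using ac a by (simp add: power_mult_distrib field_simps)
    moreover have "\<beta> * of_real t0 - of_real (\<alpha> * t0\<^sup>2) + of_real (- ((Im \<beta>)\<^sup>2 / (4 * \<alpha>)))
        = \<beta>\<^sup>2 / (4 * of_real \<alpha>)"
    proof -
      have "4 * of_real \<alpha> * (\<beta> * of_real t0 - of_real (\<alpha> * t0\<^sup>2) + of_real (- ((Im \<beta>)\<^sup>2 / (4 * \<alpha>)))) = \<beta>\<^sup>2"
        using a by (simp add: complex_eq_iff t0_def power2_eq_square field_simps)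
      moreover have "4 * of_real \<alpha> \<noteq> (0 :: complex)" using a by simp
      ultimately show ?thesis by (metis nonzero_mult_div_cancel_left)
    qed
    ultimately have "exp (\<beta> * of_real t0 - of_real (\<alpha> * t0\<^sup>2)) * of_real (exp (- ((Im \<beta> * c)^2) / 2))
        = exp (\<beta>\<^sup>2 / (4 * of_real \<alpha>))"
      by (simp add: exp_of_real [symmetric] exp_add [symmetric])
    then show ?thesis using c unfolding K_def s by (simp add: scaleR_conv_of_real field_simps)
  qed
  ultimately show ?thesis
    using lborel_has_bochner_integral_real_affine_iff[of c "\<lambda>x. cgauss \<alpha> \<beta> (of_real x)" _ t0] c by auto
qed

lemma continuous_cgauss: "continuous_on S (\<lambda>x::real. cgauss \<alpha> \<beta> (of_real x))"
  unfolding cgauss_def by (intro continuous_intros)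

lemma gauss_integral_limit:
  assumes a: "\<alpha> > 0"
  shows "(\<lambda>n. integral {- real n..real n + 1} (\<lambda>x. cgauss \<alpha> \<beta> (of_real x)))
           \<longlonglongrightarrow> of_real (sqrt (pi / \<alpha>)) * exp (\<beta>\<^sup>2 / (4 * of_real \<alpha>))"
proof -
  let ?F = "\<lambda>x::real. cgauss \<alpha> \<beta> (of_real x)"
  have bi: "integrable lborel ?F" "integral\<^sup>L lborel ?F = of_real (sqrt (pi / \<alpha>))
      * exp (\<beta>\<^sup>2 / (4 * of_real \<alpha>))"
    using gauss_integral_complex[OF a] by (auto simp: has_bochner_integral_iff)
  have I: "integral UNIV ?F = of_real (sqrt (pi / \<alpha>)) * exp (\<beta>\<^sup>2 / (4 * of_real \<alpha>))"
    using has_integral_integral_lborel[OF bi(1)] bi(2) by (simp add: integral_unique)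
  have "(\<lambda>n. integral UNIV (\<lambda>x. if x \<in> {- real n..real n + 1} then ?F x else 0)) \<longlonglongrightarrow> integral UNIV ?F"
  proof (rule dominated_convergence(2))
    show "(\<lambda>x. if x \<in> {- real n..real n + 1} then ?F x else 0) integrable_on UNIV" for n
      by (subst integrable_restrict_UNIV) (intro integrable_continuous_interval continuous_cgauss)
    show "(\<lambda>x. norm (?F x)) integrable_on UNIV"
      using has_integral_integral_lborel[OF integrable_norm[OF bi(1)]] by blast
    fix x :: real
    show "(\<lambda>n. if x \<in> {- real n..real n + 1} then ?F x else 0) \<longlonglongrightarrow> ?F x"
    proof (rule tendsto_eventually)
      show "\<forall>\<^sub>F n in sequentially. (if x \<in> {- real n..real n + 1} then ?F x else 0) = ?F x"
        using eventually_ge_at_top[of "nat \<lceil>\<bar>x\<bar>\<rceil>"]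
      proof eventually_elim
        case (elim n)
        then have "\<bar>x\<bar> \<le> real n" by linarith
        then show ?case by auto
      qed
    qed
  qed auto
  then show ?thesis by (simp only: integral_restrict_UNIV I)
qed

text \<open>
  Reduced to the integral without the factor \<open>x\<close>, because \<open>(\<beta> - 2 \<alpha> x) * cgauss \<alpha> \<beta> x\<close> is the derivative
  of a function vanishing at infinity.
\<close>

lemma gauss_moment_integral_limit:
  assumes a: "\<alpha> > 0"
  shows "(\<lambda>n. integral {- real n..real n + 1} (\<lambda>x. of_real x * cgauss \<alpha> \<beta> (of_real x)))
           \<longlonglongrightarrow> \<beta> / (2 * of_real \<alpha>) * (of_real (sqrt (pi / \<alpha>)) * exp (\<beta>\<^sup>2 / (4 * of_real \<alpha>)))"
proof -
  let ?F = "\<lambda>x::real. cgauss \<alpha> \<beta> (of_real x)"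
  define D where "D n = (?F (real n + 1) - ?F (- real n)) / (2 * of_real \<alpha>)" for n :: nat
  have "integral {- real n..real n + 1} (\<lambda>x. of_real x * ?F x) =
      \<beta> / (2 * of_real \<alpha>) * integral {- real n..real n + 1} ?F - D n" for n
  proof -
    have "((\<lambda>x. (\<beta> - 2 * of_real \<alpha> * of_real x) * ?F x) has_integral (?F (real n + 1) - ?F (- real n)))
        {- real n..real n + 1}"
    proof (rule fundamental_theorem_of_calculus)
      fix x :: real
      have "(cgauss \<alpha> \<beta> has_field_derivative (\<beta> - 2 * of_real \<alpha> * of_real x) * cgauss \<alpha> \<beta> (of_real x))
          (at (of_real x))"
        unfolding cgauss_def by (auto intro!: derivative_eq_intros simp: algebra_simps)
      from has_vector_derivative_real_field[OF this]
      show "((\<lambda>x. ?F x) has_vector_derivative (\<beta> - 2 * of_real \<alpha> * of_real x)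
          * ?F x) (at x within {- real n..real n + 1})"
        by simp
    qed simp
    moreover have "((\<lambda>x. \<beta> * ?F x) has_integral (\<beta> * integral {- real n..real n + 1} ?F)) {- real
        n..real n + 1}"
      by (intro has_integral_mult_right integrable_integral
          integrable_continuous_interval continuous_cgauss)
    ultimately have "((\<lambda>x. \<beta> * ?F x - (\<beta> - 2 * of_real \<alpha> * of_real x) * ?F x) has_integral
       (\<beta> * integral {- real n..real n + 1} ?F - (?F (real n + 1) - ?F (- real n)))) {- real n..real n + 1}"
      by (intro has_integral_diff)
    from has_integral_divide[OF this, of "2 * of_real \<alpha>"]
    have "((\<lambda>x. of_real x * ?F x) has_integral
       (\<beta> * integral {- real n..real n + 1} ?F - (?F (real n + 1) - ?F (- real n)))
           / (2 * of_real \<alpha>)) {- real n..real n + 1}"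
      using a by (simp add: algebra_simps)
    then show ?thesis by (simp add: integral_unique D_def diff_divide_distrib)
  qed
  moreover have "D \<longlonglongrightarrow> 0"
  proof -
    have "(\<lambda>n. ?F (real n + 1)) \<longlonglongrightarrow> 0"
      by (rule tendsto_norm_zero_cancel, unfold norm_cgauss_real) (use a in real_asymp)
    moreover have "(\<lambda>n. ?F (- real n)) \<longlonglongrightarrow> 0"
      by (rule tendsto_norm_zero_cancel, unfold norm_cgauss_real) (use a in real_asymp)
    ultimately have "D \<longlonglongrightarrow> (0 - 0) / (2 * of_real \<alpha>)" unfolding D_def using a by (intro tendsto_intros) auto
    then show ?thesis by simp
  qed
  ultimately show ?thesis
    using tendsto_diff[OF tendsto_mult[OF tendsto_const gauss_integral_limit[OF a, of \<beta>], of "\<beta>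
        / (2 * of_real \<alpha>)"], of D 0]
    by simp
qed

theorem poisson_gauss_moment:
  assumes a: "\<alpha> > 0"
  shows "(\<lambda>n. \<Sum>j\<in>{- int n..int n}. (\<beta> - 2 * of_real pi * \<i> * of_int j) / (2 * of_real \<alpha>) *
            (of_real (sqrt (pi / \<alpha>)) * exp ((\<beta> - 2 * of_real pi * \<i> * of_int j)\<^sup>2 / (4 * of_real \<alpha>))))
         \<longlonglongrightarrow> (\<Sum>\<^sub>\<infinity>k::int. of_int k * cgauss \<alpha> \<beta> (of_int k))"
proof (rule poisson_summation_entire[where G = "\<lambda>z. z * cgauss \<alpha> \<beta> z"])
  show "(\<lambda>z. z * cgauss \<alpha> \<beta> z) holomorphic_on UNIV"
    unfolding cgauss_def by (intro holomorphic_intros)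
  show "\<exists>B. \<forall>z. \<bar>Im z\<bar> \<le> R \<longrightarrow> norm (z * cgauss \<alpha> \<beta> z) * (1 + (Re z)\<^sup>2) \<le> B" for R
  proof -
    obtain B where B: "\<And>x::real. (1 + \<bar>x\<bar>) * (1 + x\<^sup>2) * exp (- \<alpha> * x\<^sup>2 + Re \<beta> * x) \<le> B"
      using cubic_times_gauss_bounded[OF a] by blast
    have "norm (z * cgauss \<alpha> \<beta> z) * (1 + (Re z)\<^sup>2) \<le> ((1 + R) * exp (\<alpha> * R\<^sup>2 + \<bar>Im \<beta>\<bar> * R)) * B"
        if z: "\<bar>Im z\<bar> \<le> R" for z
    proof -
      define x y where "x = Re z" and "y = Im z"
      have y: "\<bar>y\<bar> \<le> R" using z by (simp add: y_def)
      have n1: "norm z \<le> (1 + R) * (1 + \<bar>x\<bar>)"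
      proof -
        have "0 \<le> R" using y by linarith
        then have "0 \<le> R * \<bar>x\<bar>" by simp
        then show ?thesis using cmod_le[of z] y unfolding x_def y_def distrib_left distrib_right by linarith
      qed
      have "norm (cgauss \<alpha> \<beta> z) = exp (- \<alpha> * x\<^sup>2 + Re \<beta> * x + (\<alpha> * y\<^sup>2 - Im \<beta> * y))"
        by (simp add: cgauss_def x_def y_def power2_eq_square algebra_simps)
      also have "\<dots> \<le> exp (- \<alpha> * x\<^sup>2 + Re \<beta> * x + (\<alpha> * R\<^sup>2 + \<bar>Im \<beta>\<bar> * R))"
      proof -
        have "y\<^sup>2 \<le> R\<^sup>2" using power_mono[OF y, of 2] by simp
        then have "\<alpha> * y\<^sup>2 \<le> \<alpha> * R\<^sup>2" using a by simp
        moreover have "- (Im \<beta> * y) \<le> \<bar>Im \<beta>\<bar> * R"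
        proof -
          have "- (Im \<beta> * y) \<le> \<bar>Im \<beta>\<bar> * \<bar>y\<bar>" by (metis abs_ge_minus_self abs_mult)
          also have "\<dots> \<le> \<bar>Im \<beta>\<bar> * R" using y by (intro mult_left_mono) auto
          finally show ?thesis .
        qed
        ultimately show ?thesis by simp
      qed
      finally have n2: "norm (cgauss \<alpha> \<beta> z) \<le> exp (- \<alpha> * x\<^sup>2 + Re \<beta> * x) * exp (\<alpha> * R\<^sup>2 + \<bar>Im \<beta>\<bar> * R)"
        by (simp add: exp_add)
      have "norm (z * cgauss \<alpha> \<beta> z) * (1 + (Re z)\<^sup>2) \<le>
         ((1 + R) * (1 + \<bar>x\<bar>)) * (exp (- \<alpha> * x\<^sup>2 + Re \<beta> * x) * exp (\<alpha> * R\<^sup>2 + \<bar>Im \<beta>\<bar> * R)) * (1 + x\<^sup>2)"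
        unfolding norm_mult x_def[symmetric] using n1 n2 y by (intro mult_right_mono mult_mono) auto
      also have "\<dots> = ((1 + R) * exp (\<alpha> * R\<^sup>2 + \<bar>Im \<beta>\<bar> * R)) * ((1 + \<bar>x\<bar>) * (1 + x\<^sup>2)
          * exp (- \<alpha> * x\<^sup>2 + Re \<beta> * x))"
        by (simp add: mult_ac)
      also have "\<dots> \<le> ((1 + R) * exp (\<alpha> * R\<^sup>2 + \<bar>Im \<beta>\<bar> * R)) * B"
        using B[of x] y by (intro mult_left_mono) auto
      finally show ?thesis .
    qed
    then show ?thesis by blast
  qed
  fix j
  have "of_real x * cgauss \<alpha> \<beta> (of_real x) * exp (- (2 * of_real pi * \<i> * of_int j * of_real x)) =
     of_real x * cgauss \<alpha> (\<beta> - 2 * of_real pi * \<i> * of_int j) (of_real x)" for x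
    by (simp add: cgauss_def exp_add [symmetric] algebra_simps)
  then show "(\<lambda>n. integral {- real n..real n + 1} (\<lambda>x. of_real x * cgauss \<alpha> \<beta> (of_real x) *
        exp (- (2 * of_real pi * \<i> * of_int j * of_real x))))
      \<longlonglongrightarrow> (\<beta> - 2 * of_real pi * \<i> * of_int j) / (2 * of_real \<alpha>) *
            (of_real (sqrt (pi / \<alpha>)) * exp ((\<beta> - 2 * of_real pi * \<i> * of_int j)\<^sup>2 / (4 * of_real \<alpha>)))"
    using gauss_moment_integral_limit[OF a, of "\<beta> - 2 * of_real pi * \<i> * of_int j"] by (simp only:)
qed

section \<open>Weighted Gaussian sums and their dual sums\<close>

text \<open>
  The regularised Fock character at \<open>\<tau> = \<i> * y\<close> without its factor \<open>1 / \<eta>\<close>, as a function of the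
  rescaled weight \<open>x\<close>.
\<close>

definition reg_gauss :: "real \<Rightarrow> complex \<Rightarrow> real \<Rightarrow> real \<Rightarrow> complex" where
  "reg_gauss N \<epsilon> y x =
     exp (of_real (pi * sqrt (2 * N) * x) * \<epsilon> - of_real (pi * N * y * x\<^sup>2 / 2))"

text \<open>
  The mode \<open>j\<close> of the dual sum grows like \<open>exp (\<pi> * Re ((mode N \<epsilon> j)\<^sup>2) / (2 N y))\<close>.
\<close>

definition mode :: "real \<Rightarrow> complex \<Rightarrow> int \<Rightarrow> complex" where
  "mode N \<epsilon> j = of_real (sqrt (2 * N)) * \<epsilon> - \<i> * of_int j"

definition dual_gauss :: "real \<Rightarrow> complex \<Rightarrow> real \<Rightarrow> int \<Rightarrow> complex" where
  "dual_gauss N \<epsilon> y j = exp (of_real pi * (mode N \<epsilon> j)\<^sup>2 / of_real (2 * N * y))"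

lemma norm_reg_gauss:
  "norm (reg_gauss N \<epsilon> y x) = exp (pi * sqrt (2 * N) * x * Re \<epsilon> - pi * N * y * x\<^sup>2 / 2)"
  by (simp add: reg_gauss_def flip: of_real_power)

lemma reg_gauss_lattice:
  assumes "N > 0" "y > 0"
  shows "reg_gauss N \<epsilon> y (\<nu> - 2 * of_int k) =
     reg_gauss N \<epsilon> y \<nu> * cgauss (2 * pi * N * y) (of_real (2 * pi) * (of_real (N * y * \<nu>)
         - of_real (sqrt (2 * N)) * \<epsilon>)) (of_int k)"
  unfolding reg_gauss_def cgauss_def exp_add [symmetric]
  by (rule arg_cong[of _ _ exp]) (simp add: power2_eq_square algebra_simps add_divide_distrib
      diff_divide_distrib)

lemma summable_gauss_on_int:
  fixes \<alpha> b :: real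
  assumes "\<alpha> > 0"
  shows "(\<lambda>j::int. (1 + \<bar>of_int j\<bar>) * exp (- \<alpha> * (of_int j)\<^sup>2 + b * of_int j)) summable_on UNIV"
proof -
  obtain B :: real where B: "\<And>x::real. (1 + \<bar>x\<bar>) * (1 + x\<^sup>2) * exp (- \<alpha> * x\<^sup>2 + b * x) \<le> B"
    using cubic_times_gauss_bounded[OF assms] by blast
  have le: "(1 + \<bar>x\<bar>) * exp (- \<alpha> * x\<^sup>2 + b * x) \<le> B * (1 / (1 + x\<^sup>2))" for x :: real
  proof -
    have "1 + x\<^sup>2 > 0" by (simp add: add_pos_nonneg)
    then show ?thesis using B[of x] by (simp add: pos_le_divide_eq mult_ac)
  qed
  show ?thesis
    by (rule summable_on_comparison_test[OF summable_on_cmult_right[OF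
        inverse_square_summable_on_int, of B]])
       (use le in auto)
qed

lemma reg_gauss_moment_summable:
  assumes "N > 0" "y > 0"
  shows "(\<lambda>k::int. norm (of_int k * reg_gauss N \<epsilon> y (\<nu> - 2 * of_int k))) summable_on UNIV"
proof -
  define \<alpha> where "\<alpha> = 2 * pi * N * y"
  define \<beta> where "\<beta> = of_real (2 * pi) * (of_real (N * y * \<nu>) - of_real (sqrt (2 * N)) * \<epsilon>)"
  have a: "\<alpha> > 0" using assms by (simp add: \<alpha>_def)
  have "norm (of_int k * reg_gauss N \<epsilon> y (\<nu> - 2 * of_int k)) \<le>
      norm (reg_gauss N \<epsilon> y \<nu>) * ((1 + \<bar>of_int k\<bar>) * exp (- \<alpha> * (of_int k)\<^sup>2 + Re \<beta> * of_int k))" for k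
    unfolding reg_gauss_lattice[OF assms] norm_mult \<alpha>_def[symmetric] \<beta>_def[symmetric]
    using norm_cgauss_real[of \<alpha> \<beta> "of_int k"] by (simp add: mult.left_commute mult_left_mono
        mult_right_mono)
  then show ?thesis
    by (rule Infinite_Sum.abs_summable_on_comparison_test'[OF summable_on_cmult_right[OF
        summable_gauss_on_int[OF a]]])
qed

lemma norm_dual_gauss:
  assumes "N > 0" "y > 0"
  shows "norm (dual_gauss N \<epsilon> y j) =
    exp (pi / (2 * N * y) * ((sqrt (2 * N) * Re \<epsilon>)\<^sup>2 - (of_int j - sqrt (2 * N) * Im \<epsilon>)\<^sup>2))"
proof -
  have "Re ((mode N \<epsilon> j)\<^sup>2) = (sqrt (2 * N) * Re \<epsilon>)\<^sup>2 - (of_int j - sqrt (2 * N) * Im \<epsilon>)\<^sup>2"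
    unfolding Re_power2 by (simp add: mode_def power2_commute)
  then have "Re (of_real pi * (mode N \<epsilon> j)\<^sup>2 / of_real (2 * N * y)) =
      pi / (2 * N * y) * ((sqrt (2 * N) * Re \<epsilon>)\<^sup>2 - (of_int j - sqrt (2 * N) * Im \<epsilon>)\<^sup>2)"
    unfolding Re_divide_of_real by simp
  then show ?thesis unfolding dual_gauss_def norm_exp_eq_Re by simp
qed

lemma dual_coeff_bound:
  assumes "N > 0" "0 < y" "\<And>j. norm (u j) \<le> M" "\<And>j. norm (v j) \<le> M"
  shows "norm (of_real (N * y) * v j - u j * mode N \<epsilon> j)
    \<le> M * (N * y + 1 + norm (of_real (sqrt (2 * N)) * \<epsilon>)) * (1 + \<bar>of_int j\<bar>)"
proof -
  let ?c = "norm (of_real (sqrt (2 * N)) * \<epsilon>)"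
  have M: "M \<ge> 0" using assms(3) norm_ge_zero order_trans by blast
  have "norm (mode N \<epsilon> j) \<le> ?c + \<bar>of_int j\<bar>"
    unfolding mode_def using norm_triangle_ineq4[of "of_real (sqrt (2 * N)) * \<epsilon>" "\<i> * of_int j"]
        by (simp add: norm_mult)
  then have "norm (u j) * norm (mode N \<epsilon> j) \<le> M * (?c + \<bar>of_int j\<bar>)"
    by (intro mult_mono assms M) auto
  moreover have "norm (of_real (N * y) * v j) \<le> (N * y) * M"
    using assms by (simp add: norm_mult)
  ultimately have "norm (of_real (N * y) * v j - u j * mode N \<epsilon> j) \<le> (N * y) * M + M * (?c + \<bar>of_int j\<bar>)"
    using norm_triangle_ineq4[of "of_real (N * y) * v j" "u j * mode N \<epsilon> j"] by (simp add: norm_mult)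
  also have "\<dots> = M * (N * y + ?c + \<bar>of_int j\<bar>)" by (simp add: algebra_simps)
  also have "\<dots> \<le> M * ((N * y + 1 + ?c) * (1 + \<bar>of_int j\<bar>))"
  proof (rule mult_left_mono[OF _ M])
    have "0 \<le> (N * y + ?c) * \<bar>of_int j\<bar>" using assms by (intro mult_nonneg_nonneg add_nonneg_nonneg) auto
    then show "N * y + ?c + \<bar>of_int j\<bar> \<le> (N * y + 1 + ?c) * (1 + \<bar>of_int j\<bar>)"
      unfolding distrib_left distrib_right by linarith
  qed
  finally show ?thesis by (simp add: mult.assoc)
qed

lemma dual_summable:
  assumes N: "N > 0" and y: "y > 0" and u: "\<And>j. norm (u j) \<le> M" and v: "\<And>j. norm (v j) \<le> M"
  shows "(\<lambda>j. norm ((of_real (N * y) * v j - u j * mode N \<epsilon> j) * dual_gauss N \<epsilon> y j)) summable_on UNIV"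
proof -
  define c where "c = pi / (2 * N * y)"
  define r where "r = sqrt (2 * N) * Re \<epsilon>"
  define w where "w = sqrt (2 * N) * Im \<epsilon>"
  define K where "K = M * (N * y + 1 + norm (of_real (sqrt (2 * N)) * \<epsilon>))"
  have c: "c > 0" using N y by (simp add: c_def)
  have E: "norm (dual_gauss N \<epsilon> y j) = exp (c * (r\<^sup>2 - w\<^sup>2)) * exp (- c * (of_int j)\<^sup>2 + (2 * c * w)
      * of_int j)" for j
    unfolding norm_dual_gauss[OF N y] c_def[symmetric] r_def[symmetric] w_def[symmetric] exp_add[symmetric]
    by (simp add: power2_eq_square algebra_simps)
  have "norm ((of_real (N * y) * v j - u j * mode N \<epsilon> j) * dual_gauss N \<epsilon> y j) \<le>
     (K * exp (c * (r\<^sup>2 - w\<^sup>2))) * ((1 + \<bar>of_int j\<bar>) * exp (- c * (of_int j)\<^sup>2 + (2 * c * w)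
         * of_int j))" for j
  proof -
    have "norm (of_real (N * y) * v j - u j * mode N \<epsilon> j) * norm (dual_gauss N \<epsilon> y j)
        \<le> (K * (1 + \<bar>of_int j\<bar>)) * norm (dual_gauss N \<epsilon> y j)"
      unfolding K_def by (intro mult_right_mono dual_coeff_bound N y u v) auto
    then show ?thesis by (simp add: norm_mult E mult_ac)
  qed
  then show ?thesis
    by (rule Infinite_Sum.abs_summable_on_comparison_test'[OF summable_on_cmult_right[OF
        summable_gauss_on_int[OF c]]])
qed

lemma sum_int_symmetric_uminus: "(\<Sum>j\<in>{- int n..int n}. f (- j)) = (\<Sum>j\<in>{- int n..int n}. f j)"
  by (rule sum.reindex_bij_witness[of _ uminus uminus]) auto

text \<open>
  Expanding the square in \<open>reg_gauss\<close> gives a Gaussian in the summation index \<open>k\<close>. Its transform at \<open>j\<close>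
  belongs to the mode \<open>- j\<close>, and the symmetry of the partial sums allows the sign to be changed.
\<close>

lemma reg_gauss_moment_poisson:
  assumes N: "N > 0" and y: "y > 0"
  shows "(\<Sum>\<^sub>\<infinity>k::int. of_int k * reg_gauss N \<epsilon> y (\<nu> - 2 * of_int k)) =
    (\<Sum>\<^sub>\<infinity>j::int. (of_real (N * y) * (of_real \<nu> * cis (pi * \<nu> * of_int j)) - cis (pi * \<nu> * of_int j)
        * mode N \<epsilon> j) * dual_gauss N \<epsilon> y j)
      / of_real (2 * N * y * sqrt (2 * N * y))"
proof -
  define \<alpha> where "\<alpha> = 2 * pi * N * y"
  define \<beta> where "\<beta> = of_real (2 * pi) * (of_real (N * y * \<nu>) - of_real (sqrt (2 * N)) * \<epsilon>)"
  define t where "t j = (of_real (N * y) * (of_real \<nu> * cis (pi * \<nu> * of_int j))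
      - cis (pi * \<nu> * of_int j) * mode N \<epsilon> j) * dual_gauss N \<epsilon> y j" for j
  define D where "D = 2 * N * y * sqrt (2 * N * y)"
  have a: "\<alpha> > 0" using N y by (simp add: \<alpha>_def)
  have "(\<lambda>j. norm (t j)) summable_on UNIV"
    unfolding t_def by (rule dual_summable[where M = "1 + \<bar>\<nu>\<bar>"]) (use N y in \<open>auto simp: norm_mult\<close>)
  then have "(t has_sum infsum t UNIV) UNIV"
    by (rule has_sum_infsum[OF Infinite_Sum.abs_summable_summable])
  then have lim1: "(\<lambda>n. \<Sum>j\<in>{- int n..int n}. t j) \<longlonglongrightarrow> infsum t UNIV"
    by (rule has_sum_int_imp_symmetric_limit)
  have key: "reg_gauss N \<epsilon> y \<nu> * ((\<beta> - 2 * of_real pi * \<i> * of_int j) / (2 * of_real \<alpha>) *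
            (of_real (sqrt (pi / \<alpha>)) * exp ((\<beta> - 2 * of_real pi * \<i> * of_int j)\<^sup>2 / (4 * of_real \<alpha>))))
                = t (- j) / of_real D" for j
  proof -
    have b: "\<beta> - 2 * of_real pi * \<i> * of_int j = of_real (2 * pi) * (of_real (N * y * \<nu>) - mode N \<epsilon> (- j))"
      by (simp add: \<beta>_def mode_def algebra_simps)
    have s: "sqrt (pi / \<alpha>) = 1 / sqrt (2 * N * y)" using N y by (simp add: \<alpha>_def real_sqrt_divide mult_ac)
    have e: "reg_gauss N \<epsilon> y \<nu> * exp ((\<beta> - 2 * of_real pi * \<i> * of_int j)\<^sup>2 / (4 * of_real \<alpha>)) =
       cis (pi * \<nu> * of_int (- j)) * dual_gauss N \<epsilon> y (- j)"
    proof -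
      have n0: "complex_of_real N \<noteq> 0" "complex_of_real y \<noteq> 0" using N y by auto
      have "of_real (pi * sqrt (2 * N) * \<nu>) * \<epsilon> - of_real (pi * N * y * \<nu>\<^sup>2 / 2) + (of_real (2 * pi)
          * (of_real (N * y * \<nu>) - mode N \<epsilon> (- j)))\<^sup>2 / (4 * of_real \<alpha>)
        = \<i> * of_real (pi * \<nu> * of_int (- j)) + of_real pi * (mode N \<epsilon> (- j))\<^sup>2 / of_real (2 * N * y)"
        using n0 by (simp add: \<alpha>_def mode_def field_simps power2_eq_square)
      then show ?thesis unfolding b reg_gauss_def dual_gauss_def cis_conv_exp exp_add[symmetric]
          by (simp only:)
    qed
    have "reg_gauss N \<epsilon> y \<nu> * ((\<beta> - 2 * of_real pi * \<i> * of_int j) / (2 * of_real \<alpha>) *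
            (of_real (sqrt (pi / \<alpha>)) * exp ((\<beta> - 2 * of_real pi * \<i> * of_int j)\<^sup>2 / (4 * of_real \<alpha>)))) =
       (\<beta> - 2 * of_real pi * \<i> * of_int j) / (2 * of_real \<alpha>) * of_real (sqrt (pi / \<alpha>)) *
       (reg_gauss N \<epsilon> y \<nu> * exp ((\<beta> - 2 * of_real pi * \<i> * of_int j)\<^sup>2 / (4 * of_real \<alpha>)))"
           by (simp only: mult_ac)
    also have "\<dots> = (of_real (N * y * \<nu>) - mode N \<epsilon> (- j)) / of_real D * (cis (pi * \<nu> * of_int (- j))
        * dual_gauss N \<epsilon> y (- j))"
      unfolding e unfolding b s using N y by (simp add: \<alpha>_def D_def field_simps)
    also have "\<dots> = t (- j) / of_real D" by (simp add: t_def algebra_simps)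
    finally show ?thesis .
  qed
  have "(\<lambda>n. reg_gauss N \<epsilon> y \<nu> * (\<Sum>j\<in>{- int n..int n}. (\<beta> - 2 * of_real pi * \<i> * of_int j)
      / (2 * of_real \<alpha>) *
            (of_real (sqrt (pi / \<alpha>)) * exp ((\<beta> - 2 * of_real pi * \<i> * of_int j)\<^sup>2 / (4 * of_real \<alpha>)))))
      \<longlonglongrightarrow> reg_gauss N \<epsilon> y \<nu> * (\<Sum>\<^sub>\<infinity>k::int. of_int k * cgauss \<alpha> \<beta> (of_int k))"
    by (intro tendsto_mult tendsto_const poisson_gauss_moment a)
  then have "(\<lambda>n. \<Sum>j\<in>{- int n..int n}. t (- j) / of_real D)
      \<longlonglongrightarrow> reg_gauss N \<epsilon> y \<nu> * (\<Sum>\<^sub>\<infinity>k::int. of_int k * cgauss \<alpha> \<beta> (of_int k))"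
    unfolding sum_distrib_left key .
  moreover have "(\<Sum>j\<in>{- int n..int n}. t (- j) / of_real D) = (\<Sum>j\<in>{- int n..int n}. t j) / of_real D" for n
    by (simp only: sum_divide_distrib[symmetric] sum_int_symmetric_uminus[of t n])
  ultimately have "(\<lambda>n. (\<Sum>j\<in>{- int n..int n}. t j) / of_real D)
      \<longlonglongrightarrow> reg_gauss N \<epsilon> y \<nu> * (\<Sum>\<^sub>\<infinity>k::int. of_int k * cgauss \<alpha> \<beta> (of_int k))" by simp
  moreover have "(\<lambda>n. (\<Sum>j\<in>{- int n..int n}. t j) / of_real D) \<longlonglongrightarrow> infsum t UNIV / of_real D"
    using lim1 N y by (intro tendsto_divide tendsto_const) (auto simp: D_def)
  ultimately have "reg_gauss N \<epsilon> y \<nu> * (\<Sum>\<^sub>\<infinity>k::int. of_int k * cgauss \<alpha> \<beta> (of_int k)) =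
      infsum t UNIV / of_real D"
    by (rule LIMSEQ_unique)
  then have "(\<Sum>\<^sub>\<infinity>k::int. reg_gauss N \<epsilon> y \<nu> * (of_int k * cgauss \<alpha> \<beta> (of_int k))) =
      infsum t UNIV / of_real D"
    by (simp add: infsum_cmult_right')
  moreover have "reg_gauss N \<epsilon> y \<nu> * (of_int k * cgauss \<alpha> \<beta> (of_int k))
      = of_int k * reg_gauss N \<epsilon> y (\<nu> - 2 * of_int k)" for k
    unfolding reg_gauss_lattice[OF N y] \<alpha>_def \<beta>_def by (simp add: mult_ac)
  ultimately show ?thesis unfolding t_def D_def by simp
qed

lemma has_sum_finite_sum:
  fixes f :: "'c \<Rightarrow> 'a \<Rightarrow> 'b :: topological_comm_monoid_add"
  assumes "\<And>c. c \<in> C \<Longrightarrow> (f c has_sum S c) A"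
  shows "((\<lambda>x. \<Sum>c\<in>C. f c x) has_sum (\<Sum>c\<in>C. S c)) A"
  using assms by (induction C rule: infinite_finite_induct) (auto intro: has_sum_add)

lemma summable_on_finite_sum:
  fixes f :: "'c \<Rightarrow> 'a \<Rightarrow> 'b :: {topological_comm_monoid_add, t2_space}"
  assumes "\<And>c. c \<in> C \<Longrightarrow> f c summable_on A"
  shows "(\<lambda>x. \<Sum>c\<in>C. f c x) summable_on A"
  by (rule has_sum_imp_summable, rule has_sum_finite_sum[where S = "\<lambda>c. infsum (f c) A"]) (use assms
      in auto)

lemma infsum_finite_sum:
  fixes f :: "'c \<Rightarrow> 'a \<Rightarrow> 'b :: {topological_comm_monoid_add, t2_space}"
  assumes "\<And>c. c \<in> C \<Longrightarrow> f c summable_on A"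
  shows "(\<Sum>\<^sub>\<infinity>x\<in>A. \<Sum>c\<in>C. f c x) = (\<Sum>c\<in>C. infsum (f c) A)"
  by (rule infsumI, rule has_sum_finite_sum) (use assms in auto)

text \<open>
  In the remainder of the argument characters are signed combinations of Gaussian sums, with signs \<open>\<sigma> c\<close>
  and starting points \<open>\<nu> c\<close> for \<open>c\<close> in a finite index set \<open>C\<close>. A translation of the lattice by \<open>\<nu> c\<close>
  appears on the dual side as the phase \<open>exp (\<i> \<pi> \<nu> c j)\<close>.
\<close>

definition phase_sum :: "'c set \<Rightarrow> ('c \<Rightarrow> complex) \<Rightarrow> ('c \<Rightarrow> real) \<Rightarrow> int \<Rightarrow> complex" where
  "phase_sum C \<sigma> \<nu> j = (\<Sum>c\<in>C. \<sigma> c * cis (pi * \<nu> c * of_int j))"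

lemma norm_phase_sum_le: "norm (phase_sum C \<sigma> \<nu> j) \<le> (\<Sum>c\<in>C. norm (\<sigma> c))"
  unfolding phase_sum_def by (rule order_trans[OF norm_sum]) (simp add: norm_mult)

definition gauss_combination :: "real \<Rightarrow> complex \<Rightarrow> 'c set \<Rightarrow> ('c \<Rightarrow> complex) \<Rightarrow> ('c \<Rightarrow> real) \<Rightarrow> real \<Rightarrow>
    int \<Rightarrow> complex" where
  "gauss_combination N \<epsilon> C \<sigma> \<nu> y k = of_int k * (\<Sum>c\<in>C. \<sigma> c * reg_gauss N \<epsilon> y (\<nu> c - 2 * of_int k))"

definition dual_sum :: "real \<Rightarrow> complex \<Rightarrow> 'c set \<Rightarrow> ('c \<Rightarrow> complex) \<Rightarrow> ('c \<Rightarrow> real) \<Rightarrow> real \<Rightarrow> complex" where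
  "dual_sum N \<epsilon> C \<sigma> \<nu> y =
     (\<Sum>\<^sub>\<infinity>j::int. (of_real (N * y) * phase_sum C (\<lambda>c. \<sigma> c * of_real (\<nu> c)) \<nu> j
         - phase_sum C \<sigma> \<nu> j * mode N \<epsilon> j) * dual_gauss N \<epsilon> y j)"

lemma gauss_combination_summable:
  assumes N: "N > 0" and y: "y > 0"
  shows "(\<lambda>k. norm (gauss_combination N \<epsilon> C \<sigma> \<nu> y k)) summable_on UNIV"
proof -
  have "(\<lambda>k. \<Sum>c\<in>C. norm (\<sigma> c) * norm (of_int k * reg_gauss N \<epsilon> y (\<nu> c - 2 * of_int k))) summable_on UNIV"
    by (intro summable_on_finite_sum summable_on_cmult_right reg_gauss_moment_summable N y)
  then show ?thesis
  proof (rule Infinite_Sum.abs_summable_on_comparison_test')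
    fix k :: int
    have "norm (gauss_combination N \<epsilon> C \<sigma> \<nu> y k) = norm (\<Sum>c\<in>C. \<sigma> c
        * (of_int k * reg_gauss N \<epsilon> y (\<nu> c - 2 * of_int k)))"
      unfolding gauss_combination_def sum_distrib_left by (simp add: mult_ac)
    also have "\<dots> \<le> (\<Sum>c\<in>C. norm (\<sigma> c) * norm (of_int k * reg_gauss N \<epsilon> y (\<nu> c - 2 * of_int k)))"
      by (rule order_trans[OF norm_sum]) (simp add: norm_mult)
    finally show "norm (gauss_combination N \<epsilon> C \<sigma> \<nu> y k)
        \<le> (\<Sum>c\<in>C. norm (\<sigma> c) * norm (of_int k * reg_gauss N \<epsilon> y (\<nu> c - 2 * of_int k)))" .
  qed
qed

theorem gauss_combination_poisson:
  assumes N: "N > 0" and y: "y > 0"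
  shows "(\<Sum>\<^sub>\<infinity>k. gauss_combination N \<epsilon> C \<sigma> \<nu> y k) = dual_sum N \<epsilon> C \<sigma> \<nu> y / of_real (2 * N * y
      * sqrt (2 * N * y))"
proof -
  define D where "D = complex_of_real (2 * N * y * sqrt (2 * N * y))"
  define t where "t c j = (of_real (N * y) * (of_real (\<nu> c) * cis (pi * \<nu> c * of_int j))
      - cis (pi * \<nu> c * of_int j) * mode N \<epsilon> j) * dual_gauss N \<epsilon> y j" for c j
  have ts: "(\<lambda>j. t c j) summable_on UNIV" for c
    unfolding t_def by (rule Infinite_Sum.abs_summable_summable, rule dual_summable[where M
        = "1 + \<bar>\<nu> c\<bar>"]) (use N y in \<open>auto simp: norm_mult\<close>)
  have gs: "(\<lambda>k. of_int k * reg_gauss N \<epsilon> y (\<nu> c - 2 * of_int k)) summable_on UNIV" for c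
    by (rule Infinite_Sum.abs_summable_summable, rule reg_gauss_moment_summable) (use N y in auto)
  have "(\<Sum>\<^sub>\<infinity>k. gauss_combination N \<epsilon> C \<sigma> \<nu> y k) = (\<Sum>\<^sub>\<infinity>k. \<Sum>c\<in>C. \<sigma> c
      * (of_int k * reg_gauss N \<epsilon> y (\<nu> c - 2 * of_int k)))"
    unfolding gauss_combination_def sum_distrib_left by (simp add: mult_ac)
  also have "\<dots> = (\<Sum>c\<in>C. \<Sum>\<^sub>\<infinity>k. \<sigma> c * (of_int k * reg_gauss N \<epsilon> y (\<nu> c - 2 * of_int k)))"
    by (intro infsum_finite_sum summable_on_cmult_right gs)
  also have "\<dots> = (\<Sum>c\<in>C. \<sigma> c * (infsum (t c) UNIV / D))"
    unfolding infsum_cmult_right' reg_gauss_moment_poisson[OF N y] t_def D_def ..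
  also have "\<dots> = (\<Sum>c\<in>C. \<Sum>\<^sub>\<infinity>j. \<sigma> c * t c j) / D"
    by (simp add: infsum_cmult_right' sum_divide_distrib)
  also have "(\<Sum>c\<in>C. \<Sum>\<^sub>\<infinity>j. \<sigma> c * t c j) = (\<Sum>\<^sub>\<infinity>j. \<Sum>c\<in>C. \<sigma> c * t c j)"
    by (intro infsum_finite_sum[symmetric] summable_on_cmult_right ts)
  also have "\<dots> = dual_sum N \<epsilon> C \<sigma> \<nu> y"
    unfolding dual_sum_def
    by (rule infsum_cong) (simp add: t_def phase_sum_def sum_distrib_left sum_distrib_right
        sum_subtractf[symmetric] algebra_simps)
  finally show ?thesis unfolding D_def .
qed

section \<open>Asymptotics by the dominant mode\<close>

text \<open>
  All modes with a non-zero coefficient other than \<open>J1\<close> lose against \<open>J1\<close> by a factor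
  \<open>exp (- c * (j - J0)\<^sup>2 / y)\<close> with \<open>(j - J0)\<^sup>2 \<ge> 1\<close>. The error is small even relative to \<open>y\<close>; this is needed
  when \<open>u J1 = 0\<close>, where the leading term itself is of order \<open>y\<close>. The centre \<open>J0\<close> may differ from \<open>J1\<close>:
  then the mode \<open>J0\<close>, which could be larger than \<open>J1\<close>, is required to have the coefficient 0.
\<close>

lemma dual_sum_dominated:
  fixes J0 J1 :: int
  assumes N: "N > 0" and \<delta>: "\<delta> > 0" and u: "\<And>j. norm (u j) \<le> M" and v: "\<And>j. norm (v j) \<le> M"
    and dom: "\<And>j. j \<noteq> J1 \<Longrightarrow> u j \<noteq> 0 \<or> v j \<noteq> 0 \<Longrightarrow> j \<noteq> J0 \<and>
      (of_int j - sqrt (2 * N) * Im \<epsilon>)\<^sup>2 - (of_int J1 - sqrt (2 * N) * Im \<epsilon>)\<^sup>2 \<ge> \<delta> * (of_int (j - J0))\<^sup>2"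
  shows "((\<lambda>y. (exp (- (of_real pi * (mode N \<epsilon> J1)\<^sup>2 / of_real (2 * N * y))) *
              (\<Sum>\<^sub>\<infinity>j. (of_real (N * y) * v j - u j * mode N \<epsilon> j) * dual_gauss N \<epsilon> y j)
            - (of_real (N * y) * v J1 - u J1 * mode N \<epsilon> J1)) / of_real y) \<longlongrightarrow> 0) (at_right 0)"
proof -
  define w where "w = sqrt (2 * N) * Im \<epsilon>"
  define c where "c = pi * \<delta> / (2 * N)"
  define K where "K = M * (N + 1 + norm (of_real (sqrt (2 * N)) * \<epsilon>))"
  define h where "h j = (1 + \<bar>of_int j\<bar>) * exp (- (c / 2) * (of_int (j - J0))\<^sup>2)" for j :: int
  define S where "S = infsum h UNIV"
  have c: "c > 0" using N \<delta> by (simp add: c_def)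
  have M: "M \<ge> 0" using u norm_ge_zero order_trans by blast
  have K: "K \<ge> 0" using M N by (simp add: K_def)
  have hsum: "h summable_on UNIV"
  proof -
    have eq: "h = (\<lambda>j. exp (- (c / 2) * (of_int J0)\<^sup>2) * ((1 + \<bar>of_int j\<bar>)
        * exp (- (c / 2) * (of_int j)\<^sup>2 + (c * of_int J0) * of_int j)))"
    proof
      fix j :: int
      have "- (c / 2) * (of_int (j - J0))\<^sup>2 = - (c / 2) * (of_int J0)\<^sup>2 + (- (c / 2) * (of_int j)\<^sup>2
          + (c * of_int J0) * of_int j)"
        by (simp add: power2_eq_square algebra_simps)
      then show "h j = exp (- (c / 2) * (of_int J0)\<^sup>2) * ((1 + \<bar>of_int j\<bar>)
          * exp (- (c / 2) * (of_int j)\<^sup>2 + (c * of_int J0) * of_int j))"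
        unfolding h_def by (simp only: exp_add mult_ac)
    qed
    show ?thesis unfolding eq by (intro summable_on_cmult_right summable_gauss_on_int) (use c in auto)
  qed
  have bound: "norm ((exp (- (of_real pi * (mode N \<epsilon> J1)\<^sup>2 / of_real (2 * N * y))) *
              (\<Sum>\<^sub>\<infinity>j. (of_real (N * y) * v j - u j * mode N \<epsilon> j) * dual_gauss N \<epsilon> y j)
            - (of_real (N * y) * v J1 - u J1 * mode N \<epsilon> J1)) / of_real y)
                \<le> K * S * (exp (- (c / (2 * y))) / y)"
    if y: "0 < y" "y \<le> 1" for y
  proof -
    define E where "E = exp (- (of_real pi * (mode N \<epsilon> J1)\<^sup>2 / of_real (2 * N * y)))"
    define t where "t j = (of_real (N * y) * v j - u j * mode N \<epsilon> j) * dual_gauss N \<epsilon> y j" for j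
    have ED: "E * dual_gauss N \<epsilon> y J1 = 1" by (simp add: E_def dual_gauss_def exp_minus)
    have nE: "norm E = inverse (norm (dual_gauss N \<epsilon> y J1))"
      using ED by (metis inverse_unique mult.commute norm_inverse)
    have tn: "(\<lambda>j. norm (t j)) summable_on UNIV"
      unfolding t_def by (rule dual_summable[OF N y(1) u v])
    then have ts: "t summable_on UNIV" by (rule Infinite_Sum.abs_summable_summable)
    have ts': "t summable_on (UNIV - {J1})" by (rule summable_on_subset_banach[OF ts]) auto
    have tn': "(\<lambda>j. norm (t j)) summable_on (UNIV - {J1})" by (rule summable_on_subset_banach[OF tn]) auto
    have split: "infsum t UNIV = t J1 + infsum t (UNIV - {J1})"
      using infsum_Un_disjoint[of t "{J1}" "UNIV - {J1}"] ts' by (simp add: insert_Diff_if)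
    have tb: "norm (E * t j) \<le> (K * exp (- (c / (2 * y)))) * h j" if j: "j \<noteq> J1" for j
    proof (cases "u j = 0 \<and> v j = 0")
      case True
      then show ?thesis using K by (simp add: t_def h_def)
    next
      case False
      with dom[OF j] have jJ: "j \<noteq> J0"
        and d: "(of_int j - w)\<^sup>2 - (of_int J1 - w)\<^sup>2 \<ge> \<delta> * (of_int (j - J0))\<^sup>2" unfolding w_def by auto
      have "norm (of_real (N * y) * v j - u j * mode N \<epsilon> j)
          \<le> M * (N * y + 1 + norm (of_real (sqrt (2 * N)) * \<epsilon>)) * (1 + \<bar>of_int j\<bar>)"
        by (rule dual_coeff_bound[OF N y(1) u v])
      also have "\<dots> \<le> K * (1 + \<bar>of_int j\<bar>)"
        unfolding K_def using M N y by (intro mult_right_mono mult_left_mono add_right_mono) auto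
      finally have n1: "norm (of_real (N * y) * v j - u j * mode N \<epsilon> j) \<le> K * (1 + \<bar>of_int j\<bar>)" .
      have "norm (E * dual_gauss N \<epsilon> y j) = exp (pi / (2 * N * y) * ((of_int J1 - w)\<^sup>2 - (of_int j - w)\<^sup>2))"
        unfolding norm_mult nE norm_dual_gauss[OF N y(1)] w_def[symmetric] exp_minus[symmetric]
            exp_add[symmetric]
        by (simp add: right_diff_distrib)
      also have "\<dots> \<le> exp (- (c / y) * (of_int (j - J0))\<^sup>2)"
      proof -
        have "pi / (2 * N * y) * (\<delta> * (of_int (j - J0))\<^sup>2)
            \<le> pi / (2 * N * y) * ((of_int j - w)\<^sup>2 - (of_int J1 - w)\<^sup>2)"
          using N y by (intro mult_left_mono d) auto
        then show ?thesis by (simp add: c_def right_diff_distrib mult.assoc)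
      qed
      also have "\<dots> \<le> exp (- (c / (2 * y)) + - (c / 2) * (of_int (j - J0))\<^sup>2)"
      proof -
        \<comment> \<open>With \<open>z = 1 / y \<ge> 1\<close> and \<open>q \<ge> 1\<close>, \<open>2 * z * q \<ge> z + q\<close>: one half of the exponent
            supplies smallness in \<open>y\<close>, the other half summability in \<open>j\<close>.\<close>
        define q where "q = (real_of_int (j - J0))\<^sup>2"
        have "1 \<le> \<bar>j - J0\<bar>" using jJ by simp
        then have "1 \<le> (j - J0)\<^sup>2" by (metis one_le_power power2_abs)
        then have q: "1 \<le> q" unfolding q_def by (metis of_int_le_iff of_int_1 of_int_power)
        define z where "z = 1 / y"
        have z: "1 \<le> z" using y by (simp add: z_def)
        have "0 \<le> z * (q - 1) + q * (z - 1)"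
          using q z by (intro add_nonneg_nonneg mult_nonneg_nonneg) auto
        then have "0 \<le> c / 2 * (z * (q - 1) + q * (z - 1))" using c by (intro mult_nonneg_nonneg) auto
        then have "- (c * z) * q \<le> - (c * z / 2) + - (c / 2) * q" by (simp add: algebra_simps)
        then show ?thesis by (simp add: q_def z_def)
      qed
      finally have n2: "norm (E * dual_gauss N \<epsilon> y j) \<le> exp (- (c / (2 * y)))
          * exp (- (c / 2) * (of_int (j - J0))\<^sup>2)"
        by (simp only: exp_add)
      have "norm (E * t j) = norm (of_real (N * y) * v j - u j * mode N \<epsilon> j)
          * norm (E * dual_gauss N \<epsilon> y j)"
        by (simp only: t_def norm_mult mult_ac)
      also have "\<dots> \<le> (K * (1 + \<bar>of_int j\<bar>)) * (exp (- (c / (2 * y)))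
          * exp (- (c / 2) * (of_int (j - J0))\<^sup>2))"
        by (intro mult_mono n1 n2) (use K in auto)
      finally show ?thesis by (simp only: h_def mult_ac)
    qed
    have "norm (E * infsum t (UNIV - {J1})) = norm (infsum (\<lambda>j. E * t j) (UNIV - {J1}))"
      by (simp add: infsum_cmult_right')
    also have "\<dots> \<le> infsum (\<lambda>j. (K * exp (- (c / (2 * y)))) * h j) (UNIV - {J1})"
    proof (rule norm_infsum_le)
      show "((\<lambda>j. E * t j) has_sum infsum (\<lambda>j. E * t j) (UNIV - {J1})) (UNIV - {J1})"
        by (intro has_sum_infsum summable_on_cmult_right ts')
      show "((\<lambda>j. (K * exp (- (c / (2 * y)))) * h j) has_sum
          infsum (\<lambda>j. (K * exp (- (c / (2 * y)))) * h j) (UNIV - {J1})) (UNIV - {J1})"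
        by (intro has_sum_infsum summable_on_cmult_right summable_on_subset_banach[OF hsum]) auto
    qed (use tb in auto)
    also have "\<dots> \<le> infsum (\<lambda>j. (K * exp (- (c / (2 * y)))) * h j) UNIV"
      by (intro infsum_mono2 summable_on_cmult_right summable_on_subset_banach[OF hsum]) (use K
          in \<open>auto simp: h_def\<close>)
    also have "\<dots> = K * S * exp (- (c / (2 * y)))"
      by (simp add: infsum_cmult_right' S_def)
    finally have R: "norm (E * infsum t (UNIV - {J1})) \<le> K * S * exp (- (c / (2 * y)))" .
    have "E * infsum t UNIV - (of_real (N * y) * v J1 - u J1 * mode N \<epsilon> J1) = E * infsum t (UNIV - {J1})"
    proof -
      have "E * t J1 = (of_real (N * y) * v J1 - u J1 * mode N \<epsilon> J1) * (E * dual_gauss N \<epsilon> y J1)"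
        by (simp only: t_def mult_ac)
      then show ?thesis unfolding split ED by (simp add: distrib_left)
    qed
    then show ?thesis
      using R y unfolding E_def[symmetric] t_def[symmetric] by (simp add: norm_divide divide_right_mono)
  qed
  show ?thesis
  proof (rule Lim_null_comparison)
    show "\<forall>\<^sub>F y in at_right 0. norm ((exp (- (of_real pi * (mode N \<epsilon> J1)\<^sup>2 / of_real (2 * N * y))) *
              (\<Sum>\<^sub>\<infinity>j. (of_real (N * y) * v j - u j * mode N \<epsilon> j) * dual_gauss N \<epsilon> y j)
            - (of_real (N * y) * v J1 - u J1 * mode N \<epsilon> J1)) / of_real y)
                \<le> K * S * (exp (- (c / (2 * y))) / y)"
      by (rule eventually_mono[OF eventually_at_right_real[of 0 1]]) (use bound in auto)
    have "((\<lambda>y. exp (- (c / (2 * y))) / y) \<longlongrightarrow> 0) (at_right 0)" using c by real_asymp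
    then show "((\<lambda>y. K * S * (exp (- (c / (2 * y))) / y)) \<longlongrightarrow> 0) (at_right 0)"
      using tendsto_mult_right_zero by blast
  qed
qed

text \<open>
  The reciprocal of the growth of the mode \<open>J\<close> and of the prefactor produced by Poisson summation.
\<close>

definition normaliser :: "real \<Rightarrow> complex \<Rightarrow> int \<Rightarrow> real \<Rightarrow> complex" where
  "normaliser N \<epsilon> J y = of_real (2 * N * y * sqrt (2 * N * y)) *
     exp (- (of_real pi * (mode N \<epsilon> J)\<^sup>2 / of_real (2 * N * y)))"

text \<open>
  Since the mode \<open>J1\<close> grows exponentially, an error of order \<open>1 / y\<close> in the function \<open>F\<close> is invisible
  after normalisation.
\<close>

theorem normalised_limit:
  fixes J0 J1 :: int
  assumes N: "N > 0" and \<delta>: "\<delta> > 0"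
    and dom: "\<And>j. j \<noteq> J1 \<Longrightarrow> phase_sum C \<sigma> \<nu> j \<noteq> 0 \<or> phase_sum C (\<lambda>c. \<sigma> c * of_real (\<nu> c)) \<nu> j \<noteq> 0 \<Longrightarrow> j \<noteq> J0 \<and>
      (of_int j - sqrt (2 * N) * Im \<epsilon>)\<^sup>2 - (of_int J1 - sqrt (2 * N) * Im \<epsilon>)\<^sup>2 \<ge> \<delta> * (of_int (j - J0))\<^sup>2"
    and growth: "(of_int J1 - sqrt (2 * N) * Im \<epsilon>)\<^sup>2 < (sqrt (2 * N) * Re \<epsilon>)\<^sup>2"
    and F: "\<And>y. 0 < y \<Longrightarrow> y \<le> 1 \<Longrightarrow> norm (F y - dual_sum N \<epsilon> C \<sigma> \<nu> y / of_real (2 * N * y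
        * sqrt (2 * N * y))) \<le> B / y"
  shows "((\<lambda>y. (normaliser N \<epsilon> J1 y * F y
            - (of_real (N * y) * phase_sum C (\<lambda>c. \<sigma> c * of_real (\<nu> c)) \<nu> J1 - phase_sum C \<sigma> \<nu> J1
                * mode N \<epsilon> J1)) / of_real y) \<longlongrightarrow> 0) (at_right 0)"
proof -
  define u where "u = phase_sum C \<sigma> \<nu>"
  define v where "v = phase_sum C (\<lambda>c. \<sigma> c * of_real (\<nu> c)) \<nu>"
  define \<rho> where "\<rho> = (sqrt (2 * N) * Re \<epsilon>)\<^sup>2 - (of_int J1 - sqrt (2 * N) * Im \<epsilon>)\<^sup>2"
  define E where "E y = exp (- (of_real pi * (mode N \<epsilon> J1)\<^sup>2 / of_real (2 * N * y)))" for y :: real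
  define D where "D y = 2 * N * y * sqrt (2 * N * y)" for y :: real
  define M where "M = (\<Sum>c\<in>C. norm (\<sigma> c)) + (\<Sum>c\<in>C. norm (\<sigma> c * of_real (\<nu> c)))"
  have \<rho>: "\<rho> > 0" using growth by (simp add: \<rho>_def)
  have u: "norm (u j) \<le> M" for j
    unfolding u_def M_def using norm_phase_sum_le[of C \<sigma> \<nu> j] sum_nonneg[of C "\<lambda>c. norm (\<sigma> c
        * of_real (\<nu> c))"] by simp
  have v: "norm (v j) \<le> M" for j
    unfolding v_def M_def using norm_phase_sum_le[of C "\<lambda>c. \<sigma> c * of_real (\<nu> c)" \<nu> j] sum_nonneg[of C
        "\<lambda>c. norm (\<sigma> c)"] by simp
  have 1: "((\<lambda>y. (E y * dual_sum N \<epsilon> C \<sigma> \<nu> y - (of_real (N * y) * v J1 - u J1 * mode N \<epsilon> J1))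
      / of_real y) \<longlongrightarrow> 0) (at_right 0)"
    using dual_sum_dominated[OF N \<delta> u v dom[folded u_def v_def]] unfolding E_def dual_sum_def u_def v_def .
  have 2: "((\<lambda>y. of_real (D y) * E y * (F y - dual_sum N \<epsilon> C \<sigma> \<nu> y / of_real (D y)) / of_real y)
      \<longlongrightarrow> 0) (at_right 0)"
  proof (rule Lim_null_comparison)
    show "\<forall>\<^sub>F y in at_right 0. norm (of_real (D y) * E y * (F y - dual_sum N \<epsilon> C \<sigma> \<nu> y / of_real (D y))
        / of_real y)
        \<le> B * (2 * N * y * sqrt (2 * N * y) * exp (- (pi * \<rho> / (2 * N * y))) / y / y)"
    proof (rule eventually_mono[OF eventually_at_right_real[of 0 1]])
      fix y :: real assume "y \<in> {0<..<1}"
      then have y: "0 < y" "y \<le> 1" by auto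
      have nE: "norm (E y) = exp (- (pi * \<rho> / (2 * N * y)))"
      proof -
        have "E y = inverse (dual_gauss N \<epsilon> y J1)" by (simp add: E_def dual_gauss_def exp_minus)
        then show ?thesis using norm_dual_gauss[OF N y(1), of \<epsilon> J1]
            by (simp add: norm_inverse exp_minus[symmetric] \<rho>_def)
      qed
      have "norm (of_real (D y) * E y * (F y - dual_sum N \<epsilon> C \<sigma> \<nu> y / of_real (D y)) / of_real y)
         = D y * exp (- (pi * \<rho> / (2 * N * y))) * norm (F y - dual_sum N \<epsilon> C \<sigma> \<nu> y / of_real (D y)) / y"
        using N y by (simp add: norm_mult norm_divide nE D_def)
      also have "\<dots> \<le> D y * exp (- (pi * \<rho> / (2 * N * y))) * (B / y) / y"
        using F[OF y] N y unfolding D_def by (intro divide_right_mono mult_left_mono) auto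
      also have "\<dots> = B * (D y * exp (- (pi * \<rho> / (2 * N * y))) / y / y)" by simp
      finally show "norm (of_real (D y) * E y * (F y - dual_sum N \<epsilon> C \<sigma> \<nu> y / of_real (D y)) / of_real y)
        \<le> B * (2 * N * y * sqrt (2 * N * y) * exp (- (pi * \<rho> / (2 * N * y))) / y / y)"
        by (simp only: D_def)
    qed simp
    have "((\<lambda>y. 2 * N * y * sqrt (2 * N * y) * exp (- (pi * \<rho> / (2 * N * y))) / y / y) \<longlongrightarrow> 0) (at_right 0)"
      using N \<rho> by real_asymp
    then show "((\<lambda>y. B * (2 * N * y * sqrt (2 * N * y) * exp (- (pi * \<rho> / (2 * N * y))) / y / y))
        \<longlongrightarrow> 0) (at_right 0)"
      using tendsto_mult_right_zero by blast
  qed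
  have "((\<lambda>y. (normaliser N \<epsilon> J1 y * F y - (of_real (N * y) * v J1 - u J1 * mode N \<epsilon> J1)) / of_real y)
      \<longlongrightarrow> 0 + 0) (at_right 0)"
  proof (rule Lim_transform_eventually[OF tendsto_add[OF 1 2]])
    show "\<forall>\<^sub>F y in at_right 0. (E y * dual_sum N \<epsilon> C \<sigma> \<nu> y - (of_real (N * y) * v J1 - u J1
        * mode N \<epsilon> J1)) / of_real y
       + of_real (D y) * E y * (F y - dual_sum N \<epsilon> C \<sigma> \<nu> y / of_real (D y)) / of_real y
       = (normaliser N \<epsilon> J1 y * F y - (of_real (N * y) * v J1 - u J1 * mode N \<epsilon> J1)) / of_real y"
      using eventually_at_right_less[of 0]
    proof eventually_elim
      case (elim y)
      then have "D y \<noteq> 0" using N by (simp add: D_def)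
      then have "of_real (D y) * E y * (F y - dual_sum N \<epsilon> C \<sigma> \<nu> y / of_real (D y))
          = normaliser N \<epsilon> J1 y * F y - E y * dual_sum N \<epsilon> C \<sigma> \<nu> y"
        unfolding normaliser_def E_def[symmetric] D_def[symmetric] by (simp add: field_simps)
      then show ?case by (simp add: add_divide_distrib diff_divide_distrib)
    qed
  qed
  then show ?thesis unfolding u_def v_def by simp
qed

text \<open>
  For \<open>Re \<epsilon> < 0\<close> the factor \<open>exp (\<pi> a \<epsilon> x)\<close> alone decays geometrically in the direction \<open>x \<rightarrow> \<infinity>\<close>
  of these terms, which outweighs the factor \<open>k\<close>, uniformly in \<open>y\<close>.
\<close>

lemma gauss_combination_tail_bounded:
  assumes N: "N > 0" and e: "Re \<epsilon> < 0"
  shows "\<exists>B. \<forall>y>0. norm (\<Sum>\<^sub>\<infinity>k\<in>{..0}. gauss_combination N \<epsilon> C \<sigma> \<nu> y k) \<le> B"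
proof -
  define q where "q = exp (2 * pi * sqrt (2 * N) * Re \<epsilon>)"
  have q: "0 < q" "q < 1" using N e by (auto simp: q_def mult_pos_neg)
  define h where "h l = (\<Sum>c\<in>C. norm (\<sigma> c) * exp (pi * sqrt (2 * N) * \<nu> c * Re \<epsilon>))
      * (real (Suc l) * q ^ l)" for l
  have bij: "bij_betw (\<lambda>l. - int l) UNIV {..0}"
    by (rule bij_betw_byWitness[where f' = "\<lambda>k. nat (- k)"]) auto
  have "summable (\<lambda>l. real (Suc l) * q ^ l)"
    using geometric_deriv_sums[of q] q sums_summable by fastforce
  then have "summable h" unfolding h_def by (rule summable_mult)
  then have hs: "h summable_on UNIV"
    using q by (subst summable_on_UNIV_nonneg_real_iff) (auto simp: h_def sum_nonneg)
  have "norm (\<Sum>\<^sub>\<infinity>k\<in>{..0}. gauss_combination N \<epsilon> C \<sigma> \<nu> y k) \<le> infsum h UNIV" if y: "y > 0" for y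
  proof -
    have s: "gauss_combination N \<epsilon> C \<sigma> \<nu> y summable_on {..0}"
      by (rule summable_on_subset_banach[OF Infinite_Sum.abs_summable_summable[OF
          gauss_combination_summable[OF N y]]]) auto
    then have s': "(\<lambda>l. gauss_combination N \<epsilon> C \<sigma> \<nu> y (- int l)) summable_on UNIV"
      using summable_on_reindex_bij_betw[OF bij] by blast
    have "(\<Sum>\<^sub>\<infinity>k\<in>{..0}. gauss_combination N \<epsilon> C \<sigma> \<nu> y k) = (\<Sum>\<^sub>\<infinity>l. gauss_combination N \<epsilon> C \<sigma> \<nu> y (- int l))"
      using infsum_reindex_bij_betw[OF bij, of "gauss_combination N \<epsilon> C \<sigma> \<nu> y"] by simp
    also have "norm \<dots> \<le> infsum h UNIV"
    proof (rule norm_infsum_le[OF has_sum_infsum[OF s'] has_sum_infsum[OF hs]])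
      fix l :: nat
      have "norm (gauss_combination N \<epsilon> C \<sigma> \<nu> y (- int l))
          = real l * norm (\<Sum>c\<in>C. \<sigma> c * reg_gauss N \<epsilon> y (\<nu> c + 2 * real l))"
        by (simp add: gauss_combination_def norm_mult)
      also have "\<dots> \<le> real (Suc l) * (\<Sum>c\<in>C. norm (\<sigma> c) * exp (pi * sqrt (2 * N) * \<nu> c * Re \<epsilon>) * q ^ l)"
      proof (rule mult_mono)
        have "norm (\<sigma> c * reg_gauss N \<epsilon> y (\<nu> c + 2 * real l))
            \<le> norm (\<sigma> c) * exp (pi * sqrt (2 * N) * \<nu> c * Re \<epsilon>) * q ^ l" for c
        proof -
          have "norm (reg_gauss N \<epsilon> y (\<nu> c + 2 * real l)) \<le> exp (pi * sqrt (2 * N) * (\<nu> c + 2 * real l)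
              * Re \<epsilon>)"
            unfolding norm_reg_gauss using N y by simp
          also have "\<dots> = exp (pi * sqrt (2 * N) * \<nu> c * Re \<epsilon>) * q ^ l"
            by (simp add: q_def exp_of_nat_mult[symmetric] exp_add[symmetric] algebra_simps)
          finally show ?thesis by (simp add: norm_mult mult_left_mono mult.assoc)
        qed
        then show "norm (\<Sum>c\<in>C. \<sigma> c * reg_gauss N \<epsilon> y (\<nu> c + 2 * real l))
            \<le> (\<Sum>c\<in>C. norm (\<sigma> c) * exp (pi * sqrt (2 * N) * \<nu> c * Re \<epsilon>) * q ^ l)"
          by (intro order_trans[OF norm_sum] sum_mono)
      qed auto
      also have "\<dots> = h l" by (simp add: h_def sum_distrib_left sum_distrib_right mult_ac)
      finally show "norm (gauss_combination N \<epsilon> C \<sigma> \<nu> y (- int l)) \<le> h l" .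
    qed
    finally show ?thesis .
  qed
  then show ?thesis by blast
qed

theorem half_lattice_sum_vs_dual:
  assumes N: "N > 0" and e: "Re \<epsilon> < 0"
  shows "\<exists>B. \<forall>y>0. norm ((\<Sum>k. gauss_combination N \<epsilon> C \<sigma> \<nu> y (int k + 1))
            - dual_sum N \<epsilon> C \<sigma> \<nu> y / of_real (2 * N * y * sqrt (2 * N * y))) \<le> B"
proof -
  obtain B where B: "\<And>y. y > 0 \<Longrightarrow> norm (\<Sum>\<^sub>\<infinity>k\<in>{..0}. gauss_combination N \<epsilon> C \<sigma> \<nu> y k) \<le> B"
    using gauss_combination_tail_bounded[OF N e] by blast
  have bij: "bij_betw (\<lambda>k. int k + 1) UNIV {1..}"
    by (rule bij_betw_byWitness[where f' = "\<lambda>k. nat (k - 1)"]) auto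
  have "norm ((\<Sum>k. gauss_combination N \<epsilon> C \<sigma> \<nu> y (int k + 1))
            - dual_sum N \<epsilon> C \<sigma> \<nu> y / of_real (2 * N * y * sqrt (2 * N * y))) \<le> B" if y: "y > 0" for y
  proof -
    let ?g = "gauss_combination N \<epsilon> C \<sigma> \<nu> y"
    have s: "?g summable_on A" for A
      by (rule summable_on_subset_banach[OF Infinite_Sum.abs_summable_summable[OF
          gauss_combination_summable[OF N y]]]) auto
    have "(\<lambda>k. ?g (int k + 1)) summable_on UNIV"
      using summable_on_reindex_bij_betw[OF bij] s by blast
    from has_sum_imp_sums[OF has_sum_infsum[OF this]]
    have "(\<Sum>k. ?g (int k + 1)) = (\<Sum>\<^sub>\<infinity>k. ?g (int k + 1))" by (rule sums_unique[symmetric])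
    also have "\<dots> = infsum ?g {1..}" by (rule infsum_reindex_bij_betw[OF bij])
    finally have 1: "(\<Sum>k. ?g (int k + 1)) = infsum ?g {1..}" .
    have "infsum ?g ({1..} \<union> {..0}) = infsum ?g {1..} + infsum ?g {..0}"
      by (intro infsum_Un_disjoint s) auto
    also have "{1..} \<union> {..0} = (UNIV :: int set)" by auto
    finally have "(\<Sum>k. ?g (int k + 1)) - infsum ?g UNIV = - infsum ?g {..0}" using 1 by simp
    then show ?thesis using B[OF y] unfolding gauss_combination_poisson[OF N y] by simp
  qed
  then show ?thesis by blast
qed

section \<open>The characters on the imaginary axis\<close>

lemma qpow_imaginary: "qpow (\<i> * of_real y) (of_real x) = of_real (exp (- 2 * pi * y * x))"
proof -
  have "2 * of_real pi * \<i> * (\<i> * of_real y) * of_real x = complex_of_real (- 2 * pi * y * x)"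
    by (simp add: complex_eq_iff)
  then show ?thesis by (simp only: qpow_def exp_of_real)
qed

lemma dedekind_eta_nonzero:
  assumes "y > 0"
  shows "dedekind_eta (\<i> * of_real y) \<noteq> 0"
proof -
  define x where "x = exp (- 2 * pi * y)"
  have x: "0 < x" "x < 1" using assms by (auto simp: x_def)
  have q: "qpow (\<i> * of_real y) (of_nat n) = of_real (x ^ n)" for n
    using qpow_imaginary[of y "real n"] by (simp add: x_def exp_of_nat_mult[symmetric] mult_ac)
  have "(\<Prod>k. 1 - qpow (\<i> * of_real y) (of_nat (Suc k))) \<noteq> 0"
  proof (rule prodinf_nonzero)
    show "convergent_prod (\<lambda>k. 1 - qpow (\<i> * of_real y) (of_nat (Suc k)))"
    proof (rule abs_convergent_prod_imp_convergent_prod, rule summable_imp_abs_convergent_prod)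
      show "summable (\<lambda>k. norm (1 - qpow (\<i> * of_real y) (of_nat (Suc k)) - 1))"
      proof -
        have "norm (1 - qpow (\<i> * of_real y) (of_nat (Suc k)) - 1) = x * x ^ k" for k
          unfolding q using x by (simp add: norm_mult norm_power)
        then show ?thesis using x by (simp add: summable_mult summable_geometric)
      qed
    qed
    fix k
    have "x ^ Suc k < 1" using x by (intro power_Suc_less_one) auto
    then show "1 - qpow (\<i> * of_real y) (of_nat (Suc k)) \<noteq> 0"
      unfolding q by (metis eq_iff_diff_eq_0 less_irrefl of_real_1 of_real_eq_iff)
  qed
  then show ?thesis by (simp add: dedekind_eta_def qpow_def)
qed

text \<open>
  The elementary bounds \<open>exp (- x) \<le> 1 / (1 + x)\<close> and \<open>1 + y t \<ge> y (1 + t)\<close> for \<open>y \<le> 1\<close> suffice, since only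
  slower than exponential growth in \<open>1 / y\<close> matters.
\<close>

lemma theta_bound:
  assumes a: "a > 0"
  shows "\<exists>K\<ge>0. \<forall>y. 0 < y \<and> y \<le> 1 \<longrightarrow> norm (theta a b (\<i> * of_real y)) \<le> K / y"
proof -
  define \<beta> where "\<beta> = real_of_int b / (2 * of_int a)"
  define c where "c = 2 * pi * real_of_int a"
  \<comment> \<open>Chosen such that \<open>1 + k\<^sup>2 \<le> K * (1 + c * (k + \<beta>)\<^sup>2)\<close>, which removes the offset \<open>\<beta>\<close>.\<close>
  define K where "K = 1 + 2 * \<beta>\<^sup>2 + 2 / c"
  define h where "h k = K * (1 / (1 + (real_of_int k)\<^sup>2))" for k :: int
  have c: "c > 0" using a by (simp add: c_def)
  have K: "K > 0" using c by (simp add: K_def add_pos_nonneg add_pos_pos)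
  have hs: "h summable_on UNIV" unfolding h_def by (intro summable_on_cmult_right
      inverse_square_summable_on_int)
  have "norm (theta a b (\<i> * of_real y)) \<le> infsum h UNIV / y" if y: "0 < y" "y \<le> 1" for y
  proof -
    define t where "t k = qpow (\<i> * of_real y) (of_int a * (of_int k + of_int b / (2 * of_int a))\<^sup>2)" for k
    have nt: "norm (t k) \<le> (1 / y) * h k" for k
    proof -
      define s where "s = (of_int k + \<beta>)\<^sup>2"
      have "t k = qpow (\<i> * of_real y) (of_real (of_int a * s))"
        by (simp add: t_def s_def \<beta>_def)
      then have "t k = of_real (exp (- 2 * pi * y * (of_int a * s)))" by (simp only: qpow_imaginary)
      then have "norm (t k) = exp (- (c * y * s))" by (simp add: c_def mult_ac)
      also have "\<dots> \<le> 1 / (1 + c * y * s)"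
      proof -
        have "0 \<le> c * y * s" using c y by (simp add: s_def)
        then have "0 < 1 + c * y * s" by linarith
        moreover have "1 + c * y * s \<le> exp (c * y * s)" by (rule exp_ge_add_one_self)
        ultimately show ?thesis by (simp add: exp_minus field_simps)
      qed
      also have "\<dots> \<le> 1 / (y * (1 + c * s))"
        using c y by (intro divide_left_mono) (auto simp: s_def algebra_simps
            intro!: mult_pos_pos add_pos_nonneg)
      also have "\<dots> \<le> (1 / y) * h k"
      proof -
        have "1 + (real_of_int k)\<^sup>2 \<le> 1 + 2 * s + 2 * \<beta>\<^sup>2"
          using zero_le_power2[of "of_int k + 2 * \<beta>"] by (simp add: s_def power2_eq_square algebra_simps)
        also have "\<dots> \<le> K * (1 + c * s)"
        proof -
          have "K * (1 + c * s) = K + (1 + 2 * \<beta>\<^sup>2) * (c * s) + 2 * s" using c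
              by (simp add: K_def field_simps)
          moreover have "0 \<le> (1 + 2 * \<beta>\<^sup>2) * (c * s)" using c by (simp add: s_def)
          moreover have "1 + 2 * \<beta>\<^sup>2 \<le> K" using c by (simp add: K_def)
          ultimately show ?thesis by linarith
        qed
        finally have "1 + (real_of_int k)\<^sup>2 \<le> K * (1 + c * s)" .
        moreover have "0 < 1 + (real_of_int k)\<^sup>2" by (simp add: add_pos_nonneg)
        moreover have "0 < 1 + c * s" using c by (simp add: s_def add_pos_nonneg)
        ultimately have "1 / (1 + c * s) \<le> h k" by (simp add: h_def field_simps)
        then show ?thesis using y mult_left_mono[of "1 / (1 + c * s)" "h k" "1 / y"] by simp
      qed
      finally show ?thesis .
    qed
    have hs': "(\<lambda>k. (1 / y) * h k) summable_on UNIV" by (intro summable_on_cmult_right hs)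
    have ts: "t summable_on UNIV"
      by (rule Infinite_Sum.abs_summable_summable, rule Infinite_Sum.abs_summable_on_comparison_test'[OF
          hs']) (rule nt)
    have "norm (infsum t UNIV) \<le> (\<Sum>\<^sub>\<infinity>k. (1 / y) * h k)"
      by (rule norm_infsum_le[OF has_sum_infsum[OF ts] has_sum_infsum[OF hs'] nt])
    also have "\<dots> = infsum h UNIV / y" unfolding infsum_cmult_right' by simp
    finally show ?thesis unfolding theta_def t_def[abs_def] .
  qed
  moreover have "0 \<le> infsum h UNIV" using K by (intro infsum_nonneg) (auto simp: h_def)
  ultimately show ?thesis by blast
qed

text \<open>
  The four Fock characters in each term of \<open>ch_I\<close> are indexed by pairs of signs, entering through the
  points \<open>n \<plusminus> A \<plusminus> B\<close>; the product of the two signs is the sign of the character.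
\<close>

definition signs :: "(int \<times> int) set" where "signs = {(1, 1), (1, - 1), (- 1, 1), (- 1, - 1)}"

definition sign_prod :: "int \<times> int \<Rightarrow> complex" where "sign_prod c = of_int (fst c * snd c)"

definition shift :: "int \<Rightarrow> real \<Rightarrow> real \<Rightarrow> int \<times> int \<Rightarrow> real" where
  "shift n A B c = of_int n + of_int (fst c) * A + of_int (snd c) * B"

definition half_sum :: "real \<Rightarrow> complex \<Rightarrow> int \<Rightarrow> real \<Rightarrow> real \<Rightarrow> real \<Rightarrow> complex" where
  "half_sum N \<epsilon> n A B y = (\<Sum>k. gauss_combination N \<epsilon> signs sign_prod (shift n A B) y (int k + 1))"

lemma gauss_combination_signs:
  "gauss_combination N \<epsilon> signs sign_prod (shift n A B) y (int k + 1) =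
     (of_nat k + 1) * (reg_gauss N \<epsilon> y (of_int n - 2 * real k - 2 + A + B) + reg_gauss N \<epsilon> y (of_int n
         - 2 * real k - 2 - A - B)
       - reg_gauss N \<epsilon> y (of_int n - 2 * real k - 2 - A + B) - reg_gauss N \<epsilon> y (of_int n - 2 * real k
           - 2 + A - B))"
  by (simp add: gauss_combination_def signs_def sign_prod_def shift_def algebra_simps)

lemma half_sum_swap: "half_sum N \<epsilon> n A B y = half_sum N \<epsilon> n B A y"
  unfolding half_sum_def gauss_combination_signs by (simp add: algebra_simps)

text \<open>
  Summation by parts, the reason why the border characters fit into the generic formula.
\<close>

lemma weighted_telescoping_sums:
  fixes h :: "nat \<Rightarrow> 'a :: real_normed_field"
  assumes "summable h" "(\<lambda>k. of_nat k * h k) \<longlonglongrightarrow> 0"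
  shows "(\<lambda>k. (of_nat k + 1) * (h k - h (Suc k))) sums suminf h"
proof -
  have "(\<Sum>k<n. (of_nat k + 1) * (h k - h (Suc k))) = (\<Sum>k<n. h k) - of_nat n * h n" for n
    by (induction n) (auto simp: algebra_simps)
  moreover have "(\<lambda>n. (\<Sum>k<n. h k) - of_nat n * h n) \<longlonglongrightarrow> suminf h - 0"
    by (intro tendsto_diff assms summable_LIMSEQ)
  ultimately show ?thesis by (simp add: sums_def)
qed

lemma reg_gauss_nat:
  assumes N: "N > 0" and y: "y > 0"
  shows "summable (\<lambda>k. reg_gauss N \<epsilon> y (\<nu> - 2 * real k))"
    and "(\<lambda>k. of_nat k * reg_gauss N \<epsilon> y (\<nu> - 2 * real k)) \<longlonglongrightarrow> 0"
proof -
  have "bij_betw int UNIV {0..}" by (auto simp: bij_betw_def inj_on_def image_iff intro: zero_le_imp_eq_int)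
  from summable_on_reindex_bij_betw[OF this, of "\<lambda>k. norm (of_int k * reg_gauss N \<epsilon> y (\<nu> - 2 * of_int k))"]
  have "(\<lambda>k. norm (of_int (int k) * reg_gauss N \<epsilon> y (\<nu> - 2 * of_int (int k)))) summable_on UNIV"
    using summable_on_subset_banach[OF reg_gauss_moment_summable[OF N y, of \<epsilon> \<nu>], of "{0..}"] by simp
  then have s: "summable (\<lambda>k. norm (of_nat k * reg_gauss N \<epsilon> y (\<nu> - 2 * real k)))"
    by (subst (asm) summable_on_UNIV_nonneg_real_iff) auto
  show "(\<lambda>k. of_nat k * reg_gauss N \<epsilon> y (\<nu> - 2 * real k)) \<longlonglongrightarrow> 0"
    by (rule tendsto_norm_zero_cancel, rule summable_LIMSEQ_zero[OF s])
  show "summable (\<lambda>k. reg_gauss N \<epsilon> y (\<nu> - 2 * real k))"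
  proof (rule summable_comparison_test'[OF s, of 1])
    fix k :: nat assume "1 \<le> k"
    then show "norm (reg_gauss N \<epsilon> y (\<nu> - 2 * real k)) \<le> norm (of_nat k * reg_gauss N \<epsilon> y (\<nu> - 2 * real k))"
      using mult_right_mono[of 1 "real k" "norm (reg_gauss N \<epsilon> y (\<nu> - 2 * real k))"]
          by (simp add: norm_mult)
  qed
qed

lemma half_sum_edge:
  assumes N: "N > 0" and y: "y > 0"
  shows "half_sum N \<epsilon> n A 1 y =
    (\<Sum>k. reg_gauss N \<epsilon> y (of_int n - 2 * real k - 1 + A) - reg_gauss N \<epsilon> y (of_int n - 2 * real k - 1 - A))"
proof -
  define h where "h k = reg_gauss N \<epsilon> y ((of_int n - 1 + A) - 2 * real k)
      - reg_gauss N \<epsilon> y ((of_int n - 1 - A) - 2 * real k)" for k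
  have "summable h" unfolding h_def by (intro summable_diff reg_gauss_nat N y)
  moreover have "(\<lambda>k. of_nat k * h k) \<longlonglongrightarrow> 0 - 0"
    unfolding h_def right_diff_distrib by (intro tendsto_diff reg_gauss_nat N y)
  ultimately have "(\<lambda>k. (of_nat k + 1) * (h k - h (Suc k))) sums suminf h"
    by (intro weighted_telescoping_sums) auto
  moreover have "gauss_combination N \<epsilon> signs sign_prod (shift n A 1) y (int k + 1)
      = (of_nat k + 1) * (h k - h (Suc k))" for k
    unfolding gauss_combination_signs h_def by (simp add: algebra_simps)
  ultimately have "half_sum N \<epsilon> n A 1 y = suminf h" by (simp add: half_sum_def sums_iff)
  also have "h = (\<lambda>k. reg_gauss N \<epsilon> y (of_int n - 2 * real k - 1 + A) - reg_gauss N \<epsilon> y (of_int n - 2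
      * real k - 1 - A))"
    by (simp add: h_def fun_eq_iff algebra_simps)
  finally show ?thesis .
qed

lemma half_sum_corner:
  assumes N: "N > 0" and y: "y > 0"
  shows "half_sum N \<epsilon> n 1 1 y = reg_gauss N \<epsilon> y (of_int n)"
proof -
  define g where "g k = reg_gauss N \<epsilon> y (of_int n - 2 * real k)" for k
  have "g \<longlonglongrightarrow> 0" unfolding g_def by (intro summable_LIMSEQ_zero reg_gauss_nat N y)
  then have "(\<lambda>k. g k - g (Suc k)) sums (g 0 - 0)" by (rule telescope_sums')
  moreover have "g k - g (Suc k) = reg_gauss N \<epsilon> y (of_int n - 2 * real k - 1 + 1)
      - reg_gauss N \<epsilon> y (of_int n - 2 * real k - 1 - 1)" for k
    by (simp add: g_def algebra_simps)
  ultimately show ?thesis using half_sum_edge[OF N y, of \<epsilon> n 1] by (simp add: sums_iff g_def)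
qed

context
  fixes pp pm :: int and N :: real
  assumes pp: "pp \<ge> 2" and pm: "pm \<ge> 2" and N_def: "N = of_int pp * of_int pm"
begin

lemma N_pos: "N > 0" using pp pm by (simp add: N_def)

lemma ch_F_reg_gauss:
  "ch_F pp pm \<epsilon> r s n (\<i> * of_real y) =
     reg_gauss N \<epsilon> y (of_int n - of_int r / of_int pp + of_int s / of_int pm) / dedekind_eta (\<i>
         * of_real y)"
proof -
  define a where "a = sqrt (2 * N)"
  define x where "x = of_int n - of_int r / of_int pp + real_of_int s / of_int pm"
  define l where "l = a / 2 * x"
  have a2: "a\<^sup>2 = 2 * N" using N_pos by (simp add: a_def)
  have ap: "alpha_plus pp pm = a / of_int pp"
    unfolding alpha_plus_def a_def N_def using pp pm
    by (intro real_sqrt_unique) (auto simp: power_divide power2_eq_square field_simps)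
  have am: "alpha_minus pp pm = - (a / of_int pm)"
    unfolding alpha_minus_def a_def N_def using pp pm
    by (intro arg_cong[of _ _ uminus] real_sqrt_unique) (auto simp: power_divide power2_eq_square
        field_simps)
  have al: "alpha pp pm = a" by (simp add: alpha_def a_def N_def mult.assoc)
  have l: "weight pp pm r s n - alpha_zero pp pm / 2 = l"
  proof -
    define u v where "u = a / of_int pp" and "v = a / of_int pm"
    have "l = a * of_int n / 2 - of_int r * u / 2 + of_int s * v / 2"
      by (simp add: l_def x_def u_def v_def algebra_simps)
    then show ?thesis
      unfolding weight_def alpha_zero_def ap am al u_def[symmetric] v_def[symmetric]
      by (simp add: algebra_simps diff_divide_distrib add_divide_distrib)
  qed
  then have l': "of_real (weight pp pm r s n) - of_real (alpha_zero pp pm) / 2 = complex_of_real l"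
    by (metis of_real_diff of_real_divide of_real_numeral)
  have q: "qpow (\<i> * of_real y) ((of_real l)\<^sup>2 / 2) = exp (of_real (- (pi * N * y * x\<^sup>2 / 2)))"
  proof -
    have "(complex_of_real l)\<^sup>2 / 2 = of_real (l\<^sup>2 / 2)" by simp
    moreover have "- 2 * pi * y * (l\<^sup>2 / 2) = - (pi * N * y * x\<^sup>2 / 2)"
      by (simp add: l_def power_mult_distrib power_divide a2)
    ultimately show ?thesis by (simp only: qpow_imaginary exp_of_real)
  qed
  have "exp (2 * of_real pi * \<epsilon> * of_real l) * qpow (\<i> * of_real y) ((of_real l)\<^sup>2 / 2) = reg_gauss N \<epsilon> y x"
    unfolding q reg_gauss_def exp_add[symmetric] by (simp add: l_def a_def algebra_simps)
  then show ?thesis unfolding ch_F_def ch_Fock_def l' by (simp add: x_def)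
qed

lemma ch_I_bulk:
  assumes y: "y > 0"
  shows "(\<Sum>k. (of_nat k + 1) *
             (ch_F pp pm \<epsilon> (pp - r) s (n - 2 * int k - 1) (\<i> * of_real y)
              + ch_F pp pm \<epsilon> r (pm - s) (n - 2 * int k - 3) (\<i> * of_real y)
              - ch_F pp pm \<epsilon> r s (n - 2 * int k - 2) (\<i> * of_real y)
              - ch_F pp pm \<epsilon> (pp - r) (pm - s) (n - 2 * int k - 2) (\<i> * of_real y))) * dedekind_eta (\<i>
                  * of_real y)
      = half_sum N \<epsilon> n (of_int r / of_int pp) (of_int s / of_int pm) y"
proof -
  have s: "summable (\<lambda>k. gauss_combination N \<epsilon> signs sign_prod (shift n (of_int r / of_int pp) (of_int s
      / of_int pm)) y (int k + 1))"
  proof -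
    have bij: "bij_betw (\<lambda>k. int k + 1) UNIV {1..}"
      by (rule bij_betw_byWitness[where f' = "\<lambda>k. nat (k - 1)"]) auto
    have "gauss_combination N \<epsilon> signs sign_prod (shift n (of_int r / of_int pp) (of_int s / of_int pm))
        y summable_on {1..}"
      by (rule summable_on_subset_banach[OF Infinite_Sum.abs_summable_summable[OF
          gauss_combination_summable[OF N_pos y]]]) auto
    then have "(\<lambda>k. gauss_combination N \<epsilon> signs sign_prod (shift n (of_int r / of_int pp) (of_int s
        / of_int pm)) y (int k + 1)) summable_on UNIV"
      using summable_on_reindex_bij_betw[OF bij] by blast
    from has_sum_imp_sums[OF has_sum_infsum[OF this]] show ?thesis by (rule sums_summable)
  qed
  have eq: "(of_nat k + 1) *
             (ch_F pp pm \<epsilon> (pp - r) s (n - 2 * int k - 1) (\<i> * of_real y)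
              + ch_F pp pm \<epsilon> r (pm - s) (n - 2 * int k - 3) (\<i> * of_real y)
              - ch_F pp pm \<epsilon> r s (n - 2 * int k - 2) (\<i> * of_real y)
              - ch_F pp pm \<epsilon> (pp - r) (pm - s) (n - 2 * int k - 2) (\<i> * of_real y)) =
    gauss_combination N \<epsilon> signs sign_prod (shift n (of_int r / of_int pp) (of_int s / of_int pm)) y
        (int k + 1) / dedekind_eta (\<i> * of_real y)" for k
    unfolding ch_F_reg_gauss gauss_combination_signs using pp pm
    by (simp add: add_divide_distrib[symmetric] diff_divide_distrib[symmetric])
       (simp add: algebra_simps add_divide_distrib diff_divide_distrib)
  show ?thesis unfolding eq half_sum_def suminf_divide[OF s] using dedekind_eta_nonzero[OF y] by simp
qed

text \<open>
  The uniform description of all four branches of \<open>ch_I\<close>. At a border one of the arguments of \<open>half_sum\<close>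
  is 1, where the weighted sum over four Gaussians collapses.
\<close>

lemma ch_I_half_sum:
  assumes r: "1 \<le> r" "r \<le> pp" and s: "1 \<le> s" "s \<le> pm" and y: "y > 0"
  shows "ch_I pp pm \<epsilon> r s n (\<i> * of_real y) * dedekind_eta (\<i> * of_real y) =
    (if r < pp \<and> s < pm then of_int n * of_bool (n \<ge> 0)
            * (of_bool (even n) * ch_L pp pm r s (\<i> * of_real y) - of_bool (odd n) * ch_L pp pm r (pm
                - s) (\<i> * of_real y))
         * dedekind_eta (\<i> * of_real y) else 0)
    + half_sum N \<epsilon> n (of_int r / of_int pp) (of_int s / of_int pm) y"
proof -
  let ?\<eta> = "dedekind_eta (\<i> * of_real y)"
  have eta: "?\<eta> \<noteq> 0" by (rule dedekind_eta_nonzero[OF y])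
  have nz: "real_of_int pp \<noteq> 0" "real_of_int pm \<noteq> 0" using pp pm by auto
  have edge_summable: "summable (\<lambda>k. reg_gauss N \<epsilon> y (of_int n - 2 * real k - 1 + A)
      - reg_gauss N \<epsilon> y (of_int n - 2 * real k - 1 - A))" for A
  proof -
    have "summable (\<lambda>k. reg_gauss N \<epsilon> y ((of_int n - 1 + A) - 2 * real k)
        - reg_gauss N \<epsilon> y ((of_int n - 1 - A) - 2 * real k))"
      by (intro summable_diff reg_gauss_nat N_pos y)
    then show ?thesis by (simp add: algebra_simps)
  qed
  consider "r < pp" "s < pm" | "r < pp" "s = pm" | "r = pp" "s < pm" | "r = pp" "s = pm" using r s
      by linarith
  then show ?thesis
  proof cases
    case 1
    then show ?thesis using ch_I_bulk[OF y, of \<epsilon> r s n] by (simp add: ch_I_def distrib_right)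
  next
    case 2
    have eq: "ch_F pp pm \<epsilon> (pp - r) pm (n - 2 * int k - 1) (\<i> * of_real y) - ch_F pp pm \<epsilon> r pm (n - 2 *
        int k - 2) (\<i> * of_real y) =
      (reg_gauss N \<epsilon> y (of_int n - 2 * real k - 1 + of_int r / of_int pp) - reg_gauss N \<epsilon> y (of_int n
          - 2 * real k - 1 - of_int r / of_int pp)) / ?\<eta>" for k
      unfolding ch_F_reg_gauss diff_divide_distrib[symmetric] using nz
      by (intro arg_cong2[of _ _ _ _ "(/)"] arg_cong2[of _ _ _ _ "(-)"] arg_cong[of _ _
          "reg_gauss N \<epsilon> y"] refl) (simp_all add: diff_divide_distrib)
    show ?thesis using 2 eta nz by (simp add: ch_I_def eq suminf_divide[OF edge_summable]
        half_sum_edge[OF N_pos y])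
  next
    case 3
    have eq: "ch_F pp pm \<epsilon> pp s (n - 2 * int k) (\<i> * of_real y) - ch_F pp pm \<epsilon> pp (pm - s) (n - 2 *
        int k - 1) (\<i> * of_real y) =
      (reg_gauss N \<epsilon> y (of_int n - 2 * real k - 1 + of_int s / of_int pm) - reg_gauss N \<epsilon> y (of_int n
          - 2 * real k - 1 - of_int s / of_int pm)) / ?\<eta>" for k
      unfolding ch_F_reg_gauss diff_divide_distrib[symmetric] using nz
      by (intro arg_cong2[of _ _ _ _ "(/)"] arg_cong2[of _ _ _ _ "(-)"] arg_cong[of _ _
          "reg_gauss N \<epsilon> y"] refl) (simp_all add: diff_divide_distrib)
    show ?thesis using 3 eta nz by (simp add: ch_I_def eq suminf_divide[OF edge_summable]
        half_sum_swap[of N \<epsilon> n 1] half_sum_edge[OF N_pos y])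
  next
    case 4
    then show ?thesis using eta nz by (simp add: ch_I_def ch_F_reg_gauss half_sum_corner[OF N_pos y])
  qed
qed

lemma ch_L_bound:
  shows "\<exists>K\<ge>0. \<forall>y. 0 < y \<and> y \<le> 1 \<longrightarrow> norm (ch_L pp pm r s (\<i> * of_real y) * dedekind_eta (\<i> * of_real y))
      \<le> K / y"
proof -
  have "pp * pm > 0" using pp pm by simp
  from theta_bound[OF this] obtain K1 K2 where
    K1: "K1 \<ge> 0" "\<And>y. 0 < y \<and> y \<le> 1 \<Longrightarrow> norm (theta (pp * pm) (r * pm - s * pp) (\<i> * of_real y)) \<le> K1 / y" and
    K2: "K2 \<ge> 0" "\<And>y. 0 < y \<and> y \<le> 1 \<Longrightarrow> norm (theta (pp * pm) (r * pm + s * pp) (\<i> * of_real y)) \<le> K2 / y"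
    by metis
  have "norm (ch_L pp pm r s (\<i> * of_real y) * dedekind_eta (\<i> * of_real y)) \<le> (K1 + K2) / y"
      if y: "0 < y \<and> y \<le> 1" for y
  proof -
    have "ch_L pp pm r s (\<i> * of_real y) * dedekind_eta (\<i> * of_real y) =
      theta (pp * pm) (r * pm - s * pp) (\<i> * of_real y) - theta (pp * pm) (r * pm + s * pp) (\<i> * of_real y)"
      using dedekind_eta_nonzero[of y] y by (simp add: ch_L_def)
    then show ?thesis
      using norm_triangle_ineq4[of "theta (pp * pm) (r * pm - s * pp) (\<i> * of_real y)"
          "theta (pp * pm) (r * pm + s * pp) (\<i> * of_real y)"] K1(2)[OF y] K2(2)[OF y]
      by (simp add: add_divide_distrib)
  qed
  then show ?thesis using K1(1) K2(1) by (intro exI[of _ "K1 + K2"]) auto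
qed

lemma near_dual_sum:
  assumes e: "Re \<epsilon> < 0" and r: "1 \<le> r" "r \<le> pp" and s: "1 \<le> s" "s \<le> pm"
    and L: "\<And>y. 0 < y \<and> y \<le> 1 \<Longrightarrow> norm (L y) \<le> K / y"
    and F: "\<And>y. 0 < y \<Longrightarrow> F y = L y + half_sum N \<epsilon> n (of_int r / of_int pp) (of_int s / of_int pm) y"
  shows "\<exists>B. \<forall>y. 0 < y \<longrightarrow> y \<le> 1 \<longrightarrow> norm (F y - dual_sum N \<epsilon> signs sign_prod (shift n (of_int r
      / of_int pp) (of_int s / of_int pm)) y / of_real (2 * N * y * sqrt (2 * N * y))) \<le> B / y"
proof -
  let ?d = "\<lambda>y. dual_sum N \<epsilon> signs sign_prod (shift n (of_int r / of_int pp) (of_int s / of_int pm)) y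
      / of_real (2 * N * y * sqrt (2 * N * y))"
  obtain B where B: "\<And>y. y > 0 \<Longrightarrow> norm (half_sum N \<epsilon> n (of_int r / of_int pp) (of_int s / of_int pm) y
      - ?d y) \<le> B"
    using half_lattice_sum_vs_dual[OF N_pos e] unfolding half_sum_def by blast
  have "norm (F y - ?d y) \<le> (K + B) / y" if y: "0 < y" "y \<le> 1" for y
  proof -
    have "0 \<le> B" using B[OF y(1)] norm_ge_zero order_trans by blast
    then have "B \<le> B / y" using y by (simp add: pos_le_divide_eq mult_left_le)
    moreover have "norm (F y - ?d y) \<le> norm (L y) + norm (half_sum N \<epsilon> n (of_int r
        / of_int pp) (of_int s / of_int pm) y - ?d y)"
      unfolding F[OF y(1)] using norm_triangle_ineq[of "L y" "half_sum N \<epsilon> n (of_int r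
          / of_int pp) (of_int s / of_int pm) y - ?d y"] by (simp add: algebra_simps)
    ultimately show ?thesis using L[of y] B[OF y(1)] y by (simp add: add_divide_distrib)
  qed
  then show ?thesis by blast
qed

lemma ch_I_near_dual_sum:
  assumes e: "Re \<epsilon> < 0" and r: "1 \<le> r" "r \<le> pp" and s: "1 \<le> s" "s \<le> pm"
  shows "\<exists>B. \<forall>y. 0 < y \<longrightarrow> y \<le> 1 \<longrightarrow> norm (ch_I pp pm \<epsilon> r s n (\<i> * of_real y) * dedekind_eta (\<i> * of_real y)
      - dual_sum N \<epsilon> signs sign_prod (shift n (of_int r / of_int pp) (of_int s / of_int pm)) y
      / of_real (2 * N * y * sqrt (2 * N * y))) \<le> B / y"
proof -
  obtain K1 where K1: "K1 \<ge> 0" "\<And>y. 0 < y \<and> y \<le> 1 \<Longrightarrow> norm (ch_L pp pm r s (\<i> * of_real y)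
      * dedekind_eta (\<i> * of_real y)) \<le> K1 / y"
    using ch_L_bound by blast
  obtain K2 where K2: "K2 \<ge> 0" "\<And>y. 0 < y \<and> y \<le> 1 \<Longrightarrow> norm (ch_L pp pm r (pm - s) (\<i> * of_real y)
      * dedekind_eta (\<i> * of_real y)) \<le> K2 / y"
    using ch_L_bound by blast
  show ?thesis
  proof (rule near_dual_sum[OF e r s])
    fix y :: real assume y: "0 < y \<and> y \<le> 1"
    let ?X = "of_bool (even n) * ch_L pp pm r s (\<i> * of_real y) - of_bool (odd n) * ch_L pp pm r (pm
        - s) (\<i> * of_real y)"
    have X: "norm (?X * dedekind_eta (\<i> * of_real y)) \<le> (K1 + K2) / y"
      using K1(2)[OF y] K2(2)[OF y] K1(1) K2(1) y by (cases "even n") (auto simp: add_divide_distrib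
          norm_minus_cancel intro: add_increasing add_increasing2)
    have "norm (of_int n * of_bool (n \<ge> 0) * ?X * dedekind_eta (\<i> * of_real y))
        \<le> \<bar>of_int n\<bar> * ((K1 + K2) / y)"
    proof -
      have "norm (of_int n * of_bool (n \<ge> 0) * ?X * dedekind_eta (\<i> * of_real y)) =
         norm (of_int n * of_bool (n \<ge> 0) :: complex) * norm (?X * dedekind_eta (\<i> * of_real y))"
             by (simp only: norm_mult mult.assoc)
      also have "\<dots> \<le> \<bar>of_int n\<bar> * ((K1 + K2) / y)"
        by (intro mult_mono X) (auto simp: norm_mult)
      finally show ?thesis .
    qed
    then show "norm (if r < pp \<and> s < pm then of_int n * of_bool (n \<ge> 0) * ?X * dedekind_eta (\<i>
        * of_real y) else 0) \<le> (\<bar>of_int n\<bar> * (K1 + K2)) / y"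
      using K1(1) K2(1) y by simp
  next
    fix y :: real assume "0 < y"
    then show "ch_I pp pm \<epsilon> r s n (\<i> * of_real y) * dedekind_eta (\<i> * of_real y)
        = (if r < pp \<and> s < pm then of_int n * of_bool (n \<ge> 0) * 
        (of_bool (even n) * ch_L pp pm r s (\<i> * of_real y) - of_bool (odd n) * ch_L pp pm r (pm - s) (\<i>
            * of_real y)) * dedekind_eta (\<i> * of_real y) else 0)
        + half_sum N \<epsilon> n (of_int r / of_int pp) (of_int s / of_int pm) y"
      by (rule ch_I_half_sum[OF r s])
  qed
qed

lemma ch_K_near_dual_sum:
  assumes e: "Re \<epsilon> < 0"
  shows "\<exists>B. \<forall>y. 0 < y \<longrightarrow> y \<le> 1 \<longrightarrow> norm (ch_K pp pm \<epsilon> (\<i> * of_real y) * dedekind_eta (\<i> * of_real y)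
      - dual_sum N \<epsilon> signs sign_prod (shift 0 (1 / of_int pp) (1 / of_int pm)) y / of_real (2 * N * y
      * sqrt (2 * N * y))) \<le> B / y"
proof -
  obtain K where K: "K \<ge> 0" "\<And>y. 0 < y \<and> y \<le> 1 \<Longrightarrow> norm (ch_L pp pm 1 1 (\<i> * of_real y) * dedekind_eta (\<i>
      * of_real y)) \<le> K / y"
    using ch_L_bound by blast
  have "\<exists>B. \<forall>y. 0 < y \<longrightarrow> y \<le> 1 \<longrightarrow> norm (ch_K pp pm \<epsilon> (\<i> * of_real y) * dedekind_eta (\<i> * of_real y)
      - dual_sum N \<epsilon> signs sign_prod (shift 0 (of_int 1 / of_int pp) (of_int 1 / of_int pm)) y
      / of_real (2 * N * y * sqrt (2 * N * y))) \<le> B / y"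
  proof (rule near_dual_sum[OF e])
    show "ch_K pp pm \<epsilon> (\<i> * of_real y) * dedekind_eta (\<i> * of_real y) = ch_L pp pm 1 1 (\<i> * of_real y)
        * dedekind_eta (\<i> * of_real y)
       + half_sum N \<epsilon> 0 (of_int 1 / of_int pp) (of_int 1 / of_int pm) y" if "0 < y" for y
      using ch_I_half_sum[of 1 1 y \<epsilon> 0] that pp pm by (simp add: ch_K_def distrib_right)
  qed (use K pp pm in auto)
  then show ?thesis by simp
qed

end

section \<open>Phases of the four-term combinations\<close>

definition parity_sign :: "int \<Rightarrow> real" where "parity_sign k = (if even k then 1 else - 1)"

lemma powi_minus_one: "(- 1 :: real) powi k = parity_sign k"
  by (simp add: parity_sign_def power_int_minus_left)

lemma cis_pi_int: "cis (pi * of_int k) = of_real (parity_sign k)"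
  by (simp add: parity_sign_def complex_eq_iff cos_npi_int sin_npi_int)

lemma parity_sign_mult: "parity_sign a * parity_sign b = parity_sign (a + b)"
  by (simp add: parity_sign_def)

lemma parity_sign_cong: "even (a - b) \<Longrightarrow> parity_sign a = parity_sign b"
  by (auto simp: parity_sign_def)

lemma sin_add_int_pi: "sin (x + pi * of_int k) = parity_sign k * sin x"
  by (simp add: sin_add sin_npi_int cos_npi_int parity_sign_def)

text \<open>
  The part of the coefficient of the mode \<open>j\<close> that dominates for small \<open>y\<close>. Its factorisation into two
  sines is the origin of the product form of the quantum dimensions.
\<close>

lemma phase_sum_signs:
  "phase_sum signs sign_prod (shift n A B) j =
     of_real (- 4 * parity_sign (n * j) * sin (pi * A * of_int j) * sin (pi * B * of_int j))"
proof -
  define a b where "a = pi * A * of_int j" and "b = pi * B * of_int j"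
  have p: "pi * shift n A B c * of_int j = pi * of_int (n * j) + (of_int (fst c) * a + of_int (snd c)
      * b)" for c
    by (simp add: shift_def a_def b_def algebra_simps)
  have "phase_sum signs sign_prod (shift n A B) j = of_real (parity_sign (n * j))
      * (cis (a + b) - cis (a - b) - cis (b - a) + cis (- a - b))"
    unfolding phase_sum_def p cis_mult[symmetric] cis_pi_int
    by (simp add: signs_def sign_prod_def cis_mult algebra_simps)
  also have "cis (a + b) - cis (a - b) - cis (b - a) + cis (- a - b) = of_real (- 4 * sin a * sin b)"
    by (simp add: complex_eq_iff cos_add cos_diff sin_add sin_diff)
  finally show ?thesis by (simp add: a_def b_def)
qed

text \<open>
  The subleading part of the coefficient, the derivative of the leading one with respect to the phases.
  It survives when exactly one of the two sines vanishes.
\<close>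

lemma phase_sum_signs_moment:
  "phase_sum signs (\<lambda>c. sign_prod c * of_real (shift n A B c)) (shift n A B) j =
     4 * of_real (parity_sign (n * j)) *
       (of_real (- of_int n * sin (pi * A * of_int j) * sin (pi * B * of_int j))
        + \<i> * of_real (A * cos (pi * A * of_int j) * sin (pi * B * of_int j) + B
            * sin (pi * A * of_int j) * cos (pi * B * of_int j)))"
proof -
  define a b where "a = pi * A * of_int j" and "b = pi * B * of_int j"
  have p: "pi * shift n A B c * of_int j = pi * of_int (n * j) + (of_int (fst c) * a + of_int (snd c)
      * b)" for c
    by (simp add: shift_def a_def b_def algebra_simps)
  have "phase_sum signs (\<lambda>c. sign_prod c * of_real (shift n A B c)) (shift n A B) j
      = of_real (parity_sign (n * j)) *
      (of_real (of_int n + A + B) * cis (a + b) - of_real (of_int n + A - B) * cis (a - b)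
          - of_real (of_int n - A + B) * cis (b - a) + of_real (of_int n - A - B) * cis (- a - b))"
    unfolding phase_sum_def p cis_mult[symmetric] cis_pi_int
    by (simp add: signs_def sign_prod_def shift_def cis_mult algebra_simps)
  also have "of_real (of_int n + A + B) * cis (a + b) - of_real (of_int n + A - B) * cis (a - b)
      - of_real (of_int n - A + B) * cis (b - a) + of_real (of_int n - A - B) * cis (- a - b)
    = 4 * (of_real (- of_int n * sin a * sin b) + \<i> * of_real (A * cos a * sin b + B * sin a * cos b))"
    by (simp add: complex_eq_iff cos_add cos_diff sin_add sin_diff algebra_simps)
  finally show ?thesis by (simp add: a_def b_def mult_ac)
qed

lemma ratio_of_leading_terms:
  fixes X Y :: "real \<Rightarrow> complex"
  assumes X: "((\<lambda>y. (X y - (of_real (N * y) * v1 - u1 * \<mu>)) / of_real y) \<longlongrightarrow> 0) (at_right 0)"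
    and Y: "((\<lambda>y. (Y y - (of_real (N * y) * v2 - u2 * \<mu>)) / of_real y) \<longlongrightarrow> 0) (at_right 0)"
    and "N \<noteq> 0" "\<mu> \<noteq> 0"
  shows "u2 \<noteq> 0 \<Longrightarrow> ((\<lambda>y. X y / Y y) \<longlongrightarrow> u1 / u2) (at_right 0)"
    and "u1 = 0 \<Longrightarrow> u2 = 0 \<Longrightarrow> v2 \<noteq> 0 \<Longrightarrow> ((\<lambda>y. X y / Y y) \<longlongrightarrow> v1 / v2) (at_right 0)"
proof -
  have ofr: "((\<lambda>y. complex_of_real y) \<longlongrightarrow> of_real 0) (at_right (0::real))"
    by (intro tendsto_of_real tendsto_ident_at)
  have lead: "(W \<longlongrightarrow> - u * \<mu>) (at_right 0)"
    if "((\<lambda>y. (W y - (of_real (N * y) * v - u * \<mu>)) / of_real y) \<longlongrightarrow> 0) (at_right 0)"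
        for W :: "real \<Rightarrow> complex" and u v
  proof -
    have "((\<lambda>y. of_real y * ((W y - (of_real (N * y) * v - u * \<mu>)) / of_real y) + (of_real N * of_real y
        * v - u * \<mu>)) \<longlongrightarrow>
        of_real 0 * 0 + (of_real N * of_real 0 * v - u * \<mu>)) (at_right 0)"
      by (intro tendsto_intros that ofr)
    moreover have "\<forall>\<^sub>F y in at_right 0. of_real y * ((W y - (of_real (N * y) * v - u * \<mu>)) / of_real y)
        + (of_real N * of_real y * v - u * \<mu>) = W y"
      using eventually_at_right_less[of 0] by eventually_elim auto
    ultimately show ?thesis using Lim_transform_eventually by fastforce
  qed
  have sub: "((\<lambda>y. W y / of_real y) \<longlongrightarrow> of_real N * v) (at_right 0)"
    if "((\<lambda>y. (W y - (of_real (N * y) * v - 0 * \<mu>)) / of_real y) \<longlongrightarrow> 0) (at_right 0)"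
        for W :: "real \<Rightarrow> complex" and v
  proof -
    have "((\<lambda>y. (W y - (of_real (N * y) * v - 0 * \<mu>)) / of_real y + of_real N * v)
        \<longlongrightarrow> 0 + of_real N * v) (at_right 0)"
      by (intro tendsto_intros that)
    moreover have "\<forall>\<^sub>F y in at_right 0. (W y - (of_real (N * y) * v - 0 * \<mu>)) / of_real y + of_real N
        * v = W y / of_real y"
      using eventually_at_right_less[of 0] by eventually_elim (auto simp: field_simps)
    ultimately show ?thesis using Lim_transform_eventually by fastforce
  qed
  show "((\<lambda>y. X y / Y y) \<longlongrightarrow> u1 / u2) (at_right 0)" if "u2 \<noteq> 0"
    using tendsto_divide[OF lead[OF X] lead[OF Y]] that assms by simp
  show "((\<lambda>y. X y / Y y) \<longlongrightarrow> v1 / v2) (at_right 0)" if "u1 = 0" "u2 = 0" "v2 \<noteq> 0"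
  proof -
    have "((\<lambda>y. (X y / of_real y) / (Y y / of_real y)) \<longlongrightarrow> (of_real N * v1) / (of_real N * v2)) (at_right 0)"
      using X Y that assms by (intro tendsto_divide sub) auto
    moreover have "\<forall>\<^sub>F y in at_right 0. (X y / of_real y) / (Y y / of_real y) = X y / Y y"
      using eventually_at_right_less[of 0] by eventually_elim auto
    ultimately show ?thesis using assms Lim_transform_eventually by fastforce
  qed
qed

lemma sin_int_ratio_zero:
  assumes "q \<noteq> 0" "q dvd j"
  shows "sin (pi * (of_int r / of_int q) * of_int j) = 0"
proof -
  obtain i where "j = q * i" using assms(2) by (elim dvdE)
  then have "pi * (of_int r / of_int q) * of_int j = pi * of_int (r * i)" using assms(1) by simp
  then show ?thesis by (simp only: sin_npi_int)
qed

lemma sin_int_ratio_nonzero: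
  assumes "q \<noteq> 0" "\<not> q dvd j"
  shows "sin (pi * (1 / of_int q) * of_int j) \<noteq> 0"
proof
  assume "sin (pi * (1 / of_int q) * of_int j) = 0"
  then obtain i :: int where "pi * (1 / of_int q) * of_int j = of_int i * pi"
      by (auto simp: sin_zero_iff_int2)
  then have "real_of_int j = of_int (i * q)" using assms by (simp add: field_simps)
  then have "j = i * q" by (simp only: of_int_eq_iff)
  then show False using assms by simp
qed

context
  fixes pp pm :: int and N :: real
  assumes pp: "pp \<ge> 2" and pm: "pm \<ge> 2" and N_def: "N = of_int pp * of_int pm"
begin

text \<open>
  The mode \<open>J1\<close> dominates the module and the vacuum alike, so only its two coefficients remain in the
  limit: the leading ones if they do not vanish, otherwise the subleading ones. A closer mode \<open>J0\<close> is
  harmless if it is divisible by \<open>p\<^sub>+\<close> and \<open>p\<^sub>-\<close>, as then both of its coefficients are 0.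
\<close>

lemma has_qdim_of_dominant_mode:
  fixes J0 J1 :: int
  assumes e: "Re \<epsilon> < 0" and r: "1 \<le> r" "r \<le> pp" and s: "1 \<le> s" "s \<le> pm" and \<delta>: "\<delta> > 0"
    and vanish: "J0 \<noteq> J1 \<Longrightarrow> pp dvd J0 \<and> pm dvd J0"
    and dom: "\<And>j. j \<noteq> J1 \<Longrightarrow> j \<noteq> J0 \<Longrightarrow>
      (of_int j - sqrt (2 * N) * Im \<epsilon>)\<^sup>2 - (of_int J1 - sqrt (2 * N) * Im \<epsilon>)\<^sup>2 \<ge> \<delta> * (of_int (j - J0))\<^sup>2"
    and growth: "(of_int J1 - sqrt (2 * N) * Im \<epsilon>)\<^sup>2 < (sqrt (2 * N) * Re \<epsilon>)\<^sup>2"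
  shows "\<not> pp dvd J1 \<Longrightarrow> \<not> pm dvd J1 \<Longrightarrow> has_qdim pp pm \<epsilon> (ch_I pp pm \<epsilon> r s n)
      (phase_sum signs sign_prod (shift n (of_int r / of_int pp) (of_int s / of_int pm)) J1 /
       phase_sum signs sign_prod (shift 0 (1 / of_int pp) (1 / of_int pm)) J1)"
    and "pp dvd J1 \<longleftrightarrow> \<not> pm dvd J1 \<Longrightarrow> has_qdim pp pm \<epsilon> (ch_I pp pm \<epsilon> r s n)
      (phase_sum signs (\<lambda>c. sign_prod c * of_real (shift n (of_int r / of_int pp) (of_int s
          / of_int pm) c)) (shift n (of_int r / of_int pp) (of_int s / of_int pm)) J1 /
       phase_sum signs (\<lambda>c. sign_prod c * of_real (shift 0 (1 / of_int pp) (1 / of_int pm) c))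
           (shift 0 (1 / of_int pp) (1 / of_int pm)) J1)"
proof -
  note ctx = pp pm N_def
  have N: "N > 0" using N_pos[OF ctx] .
  have p0: "pp \<noteq> 0" "pm \<noteq> 0" using pp pm by auto
  define \<mu> where "\<mu> = mode N \<epsilon> J1"
  have "Re \<mu> = sqrt (2 * N) * Re \<epsilon>" by (simp add: \<mu>_def mode_def)
  then have \<mu>: "\<mu> \<noteq> 0" using e N by auto
  define \<nu> where "\<nu> n r s = shift n (of_int r / of_int pp) (of_int s / of_int pm)" for n r s
  have dom': "j \<noteq> J0 \<and> (of_int j - sqrt (2 * N) * Im \<epsilon>)\<^sup>2 - (of_int J1 - sqrt (2 * N) * Im \<epsilon>)\<^sup>2
      \<ge> \<delta> * (of_int (j - J0))\<^sup>2"
    if j: "j \<noteq> J1" and nz: "phase_sum signs sign_prod (\<nu> n r s) j \<noteq> 0 \<or> phase_sum signs (\<lambda>c. sign_prod c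
        * of_real (\<nu> n r s c)) (\<nu> n r s) j \<noteq> 0" for n r s j
  proof -
    have "j \<noteq> J0"
    proof
      assume "j = J0"
      then have "pp dvd j" "pm dvd j" using vanish j by auto
      then have "sin (pi * (of_int r / of_int pp) * of_int j)
          = 0" "sin (pi * (of_int s / of_int pm) * of_int j) = 0"
        using sin_int_ratio_zero p0 by blast+
      then show False using nz unfolding \<nu>_def phase_sum_signs phase_sum_signs_moment by (simp only:) simp
    qed
    then show ?thesis using dom[OF j] by blast
  qed
  have lim: "((\<lambda>y. (normaliser N \<epsilon> J1 y * F y
            - (of_real (N * y) * phase_sum signs (\<lambda>c. sign_prod c * of_real (\<nu> n r s c)) (\<nu> n r s) J1
                - phase_sum signs sign_prod (\<nu> n r s) J1 * \<mu>)) / of_real y) \<longlongrightarrow> 0) (at_right 0)"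
    if near: "\<exists>B. \<forall>y. 0 < y \<longrightarrow> y \<le> 1 \<longrightarrow> norm (F y - dual_sum N \<epsilon> signs sign_prod (\<nu> n r s) y
        / of_real (2 * N * y * sqrt (2 * N * y))) \<le> B / y" for n r s F
  proof -
    obtain B where B: "\<And>y. 0 < y \<Longrightarrow> y \<le> 1 \<Longrightarrow> norm (F y - dual_sum N \<epsilon> signs sign_prod (\<nu> n r s) y
        / of_real (2 * N * y * sqrt (2 * N * y))) \<le> B / y"
      using near by blast
    show ?thesis unfolding \<mu>_def by (rule normalised_limit[OF N \<delta> dom' growth B])
  qed
  have X: "((\<lambda>y. (normaliser N \<epsilon> J1 y * (ch_I pp pm \<epsilon> r s n (\<i> * of_real y) * dedekind_eta (\<i> * of_real y))
            - (of_real (N * y) * phase_sum signs (\<lambda>c. sign_prod c * of_real (\<nu> n r s c)) (\<nu> n r s) J1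
                - phase_sum signs sign_prod (\<nu> n r s) J1 * \<mu>)) / of_real y) \<longlongrightarrow> 0) (at_right 0)"
    by (rule lim, unfold \<nu>_def, rule ch_I_near_dual_sum[OF ctx e r s])
  have "\<exists>B. \<forall>y. 0 < y \<longrightarrow> y \<le> 1 \<longrightarrow> norm (ch_K pp pm \<epsilon> (\<i> * of_real y) * dedekind_eta (\<i> * of_real y)
      - dual_sum N \<epsilon> signs sign_prod (\<nu> 0 1 1) y / of_real (2 * N * y * sqrt (2 * N * y))) \<le> B / y"
    using ch_K_near_dual_sum[OF ctx e] unfolding \<nu>_def of_int_1 .
  note Y = lim[OF this]
  have \<nu>1: "shift 0 (1 / of_int pp) (1 / of_int pm) = \<nu> 0 1 1" by (simp add: \<nu>_def)
  have ev: "\<forall>\<^sub>F y in at_right 0. normaliser N \<epsilon> J1 y * (ch_I pp pm \<epsilon> r s n (\<i> * of_real y)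
      * dedekind_eta (\<i> * of_real y)) /
      (normaliser N \<epsilon> J1 y * (ch_K pp pm \<epsilon> (\<i> * of_real y) * dedekind_eta (\<i> * of_real y)))
          = ch_I pp pm \<epsilon> r s n (\<i> * of_real y) / ch_K pp pm \<epsilon> (\<i> * of_real y)"
    using eventually_at_right_less[of 0]
  proof eventually_elim
    case (elim y)
    then have "normaliser N \<epsilon> J1 y \<noteq> 0" using N by (simp add: normaliser_def)
    then show ?case using dedekind_eta_nonzero[OF elim] by simp
  qed
  show "has_qdim pp pm \<epsilon> (ch_I pp pm \<epsilon> r s n)
      (phase_sum signs sign_prod (shift n (of_int r / of_int pp) (of_int s / of_int pm)) J1 /
       phase_sum signs sign_prod (shift 0 (1 / of_int pp) (1 / of_int pm)) J1)"
           if "\<not> pp dvd J1" "\<not> pm dvd J1"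
  proof -
    have "phase_sum signs sign_prod (\<nu> 0 1 1) J1 \<noteq> 0"
      unfolding \<nu>1[symmetric] phase_sum_signs using sin_int_ratio_nonzero that p0
          by (simp add: parity_sign_def)
    from ratio_of_leading_terms(1)[OF X Y _ \<mu> this] N Lim_transform_eventually[OF _ ev]
    show ?thesis unfolding has_qdim_def \<nu>1 \<nu>_def[symmetric] by blast
  qed
  show "has_qdim pp pm \<epsilon> (ch_I pp pm \<epsilon> r s n)
      (phase_sum signs (\<lambda>c. sign_prod c * of_real (shift n (of_int r / of_int pp) (of_int s
          / of_int pm) c)) (shift n (of_int r / of_int pp) (of_int s / of_int pm)) J1 /
       phase_sum signs (\<lambda>c. sign_prod c * of_real (shift 0 (1 / of_int pp) (1 / of_int pm) c))
           (shift 0 (1 / of_int pp) (1 / of_int pm)) J1)"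
    if "pp dvd J1 \<longleftrightarrow> \<not> pm dvd J1"
  proof -
    have u0: "phase_sum signs sign_prod (\<nu> n r s) J1 = 0" for n r s
      unfolding \<nu>_def phase_sum_signs using that sin_int_ratio_zero p0 by (cases "pp dvd J1") auto
    have sz: "sin (pi * (1 / of_int q) * of_int J1) = 0" if "q \<noteq> 0" "q dvd J1" for q
      using sin_int_ratio_zero[OF that, of 1] by simp
    have cnz: "cos x \<noteq> 0" if "sin x = 0" for x :: real
      using that sin_cos_squared_add[of x] by auto
    have v: "phase_sum signs (\<lambda>c. sign_prod c * of_real (\<nu> 0 1 1 c)) (\<nu> 0 1 1) J1 \<noteq> 0"
      unfolding \<nu>1[symmetric] phase_sum_signs_moment
      using that sz[of pp] sz[of pm] sin_int_ratio_nonzero[of pp J1] sin_int_ratio_nonzero[of pm J1] cnz p0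
      by (cases "pp dvd J1") (auto simp: parity_sign_def)
    from ratio_of_leading_terms(2)[OF X Y _ \<mu> u0 u0 v] N Lim_transform_eventually[OF _ ev]
    show ?thesis unfolding has_qdim_def \<nu>1 \<nu>_def[symmetric] by blast
  qed
qed

end

section \<open>The modes closest to the regulator\<close>

text \<open>
  With \<open>d = j - J\<close> the difference is \<open>d\<^sup>2 - 2 d (w - J)\<close>, and \<open>\<bar>d\<bar> \<le> d\<^sup>2\<close>.
\<close>

lemma nearest_integer_gap:
  fixes w :: real and J j :: int
  assumes "\<bar>w - of_int J\<bar> < 1 / 2" "j \<noteq> J"
  shows "(of_int j - w)\<^sup>2 - (of_int J - w)\<^sup>2 \<ge> (1 - 2 * \<bar>w - of_int J\<bar>) * (of_int (j - J))\<^sup>2"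
proof -
  define d x where "d = real_of_int (j - J)" and "x = w - of_int J"
  have "1 \<le> \<bar>j - J\<bar>" using assms by simp
  then have "1 \<le> \<bar>d\<bar>" by (simp add: d_def flip: of_int_abs of_int_diff)
  have eq: "(of_int j - w)\<^sup>2 - (of_int J - w)\<^sup>2 = d\<^sup>2 - 2 * d * x"
    by (simp add: d_def x_def power2_eq_square algebra_simps)
  have "2 * d * x \<le> 2 * (\<bar>d\<bar> * \<bar>x\<bar>)" using abs_ge_self[of "d * x"] by (simp add: abs_mult)
  also have "\<dots> \<le> 2 * (d\<^sup>2 * \<bar>x\<bar>)"
  proof -
    have "\<bar>d\<bar> * 1 \<le> \<bar>d\<bar> * \<bar>d\<bar>" using \<open>1 \<le> \<bar>d\<bar>\<close> by (intro mult_left_mono) auto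
    then have "\<bar>d\<bar> \<le> d\<^sup>2" by (simp add: power2_eq_square)
    then show ?thesis by (simp add: mult_right_mono)
  qed
  finally show ?thesis unfolding eq d_def[symmetric] x_def[symmetric] by (simp add: algebra_simps)
qed

text \<open>
  After a reflection that makes \<open>w - J\<close> non-negative, and with \<open>e\<close> the reflected \<open>j - J\<close> and
  \<open>x = \<bar>w - J\<bar>\<close>, the difference factors as \<open>(e - 1) * (e + 1 - 2 x)\<close>. It is bounded separately for
  \<open>e \<ge> 2\<close> and for \<open>e \<le> - 1\<close>; the latter case degenerates at \<open>x = 0\<close>, where \<open>J + 1\<close> and \<open>J - 1\<close>
  are equally close.
\<close>

lemma second_nearest_integer_gap:
  fixes w :: real and J j \<sigma> :: int
  assumes w: "\<bar>w - of_int J\<bar> < 1 / 2" and \<sigma>: "\<sigma> = (if w > of_int J then 1 else - 1)"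
    and j: "j \<noteq> J" "j \<noteq> J + \<sigma>"
  shows "(of_int j - w)\<^sup>2 - (of_int (J + \<sigma>) - w)\<^sup>2 \<ge> min (1 / 2) (2 * \<bar>w - of_int J\<bar>) * (of_int (j - J))\<^sup>2"
proof -
  define e x where "e = real_of_int (\<sigma> * (j - J))" and "x = \<bar>w - of_int J\<bar>"
  have \<sigma>1: "\<sigma> = 1 \<or> \<sigma> = - 1" by (simp add: \<sigma>)
  have xs: "w - of_int J = of_int \<sigma> * x" unfolding x_def \<sigma> by auto
  have x: "0 \<le> x" "x < 1 / 2" using w by (auto simp: x_def)
  have ws: "w = of_int J + of_int \<sigma> * x" using xs by simp
  have sq: "(of_int (j - J))\<^sup>2 = e\<^sup>2" using \<sigma>1 by (auto simp: e_def power2_eq_square)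
  have eq: "(of_int j - w)\<^sup>2 - (of_int (J + \<sigma>) - w)\<^sup>2 = (e - 1) * (e + 1 - 2 * x)"
    unfolding ws e_def using \<sigma>1 by (auto simp: power2_eq_square algebra_simps)
  have "\<sigma> * (j - J) \<noteq> 0" "\<sigma> * (j - J) \<noteq> 1" using j \<sigma>1 by auto
  then consider "2 \<le> \<sigma> * (j - J)" | "\<sigma> * (j - J) \<le> - 1" by linarith
  then show ?thesis
  proof cases
    case 1
    then have e2: "2 \<le> e" unfolding e_def by (metis of_int_le_iff of_int_numeral)
    have "min (1 / 2) (2 * x) * e\<^sup>2 \<le> 1 / 2 * e\<^sup>2" by (intro mult_right_mono) auto
    also have "\<dots> \<le> (e - 1) * e"
    proof -
      have "0 \<le> e * (e - 2)" using e2 by simp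
      then show ?thesis by (simp add: power2_eq_square algebra_simps)
    qed
    also have "\<dots> \<le> (e - 1) * (e + 1 - 2 * x)" using e2 x by (intro mult_left_mono) auto
    finally show ?thesis unfolding eq sq x_def .
  next
    case 2
    then have e1: "e \<le> - 1" unfolding e_def by (metis of_int_le_iff of_int_1 of_int_minus)
    have "min (1 / 2) (2 * x) * e\<^sup>2 \<le> 2 * x * e\<^sup>2" by (intro mult_right_mono) auto
    also have "\<dots> = (- e) * (2 * x * (- e))" by (simp add: power2_eq_square)
    also have "\<dots> \<le> (1 - e) * (2 * x - 1 - e)"
    proof (intro mult_mono)
      have "0 \<le> (- e - 1) * (1 - 2 * x)" using e1 x by (intro mult_nonneg_nonneg) auto
      then show "2 * x * (- e) \<le> 2 * x - 1 - e" by (simp add: algebra_simps)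
      show "0 \<le> 2 * x * (- e)" using e1 x by (intro mult_nonneg_nonneg) auto
    qed (use e1 in auto)
    also have "\<dots> = (e - 1) * (e + 1 - 2 * x)" by (simp add: algebra_simps)
    finally show ?thesis unfolding eq sq x_def .
  qed
qed

text \<open>
  The infimum in \<open>reg_bound\<close> is at least the distance from \<open>Im \<epsilon>\<close> to \<open>J1 / a\<close>, so the condition on \<open>Re \<epsilon>\<close>
  says that the mode \<open>J1\<close> grows exponentially.
\<close>

lemma growth_of_reg_bound:
  fixes pp pm J1 :: int
  assumes pp: "pp \<ge> 2" and pm: "pm \<ge> 2" and N_def: "N = of_int pp * of_int pm"
    and bound: "Re \<epsilon> < reg_bound pp pm \<epsilon>"
    and min: "\<And>j. \<not> pp * pm dvd j \<Longrightarrow> (of_int J1 - sqrt (2 * N) * Im \<epsilon>)\<^sup>2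
        \<le> (of_int j - sqrt (2 * N) * Im \<epsilon>)\<^sup>2"
  shows "Re \<epsilon> < 0" and "(of_int J1 - sqrt (2 * N) * Im \<epsilon>)\<^sup>2 < (sqrt (2 * N) * Re \<epsilon>)\<^sup>2"
proof -
  define a where "a = sqrt (2 * N)"
  have a: "a > 0" using pp pm by (simp add: a_def N_def)
  have aa: "sqrt (2 * of_int pp * of_int pm) = a" by (simp add: a_def N_def mult.assoc)
  define d where "d = \<bar>of_int J1 - a * Im \<epsilon>\<bar>"
  define S where "S = {\<bar>of_int m / a - Im \<epsilon>\<bar> | m::int. \<not> pp * pm dvd m}"
  have "\<not> pp * pm dvd 1"
  proof
    assume "pp * pm dvd 1"
    then have "pp dvd 1" by (rule dvd_mult_left)
    then show False using pp by simp
  qed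
  then have "\<bar>of_int 1 / a - Im \<epsilon>\<bar> \<in> S" unfolding S_def by blast
  then have "S \<noteq> {}" by blast
  moreover have "d / a \<le> x" if x: "x \<in> S" for x
  proof -
    obtain j where j: "\<not> pp * pm dvd j" "x = \<bar>of_int j / a - Im \<epsilon>\<bar>" using x by (auto simp: S_def)
    have "d \<le> \<bar>of_int j - a * Im \<epsilon>\<bar>" using min[OF j(1)] by (simp add: d_def a_def abs_le_square_iff)
    also have "of_int j - a * Im \<epsilon> = a * (of_int j / a - Im \<epsilon>)" using a by (simp add: field_simps)
    finally have "d \<le> a * x" using a by (simp add: j(2) abs_mult)
    then show ?thesis using a by (simp add: field_simps)
  qed
  ultimately have "d / a \<le> Inf S" by (rule cInf_greatest)
  then have lt: "d / a < - Re \<epsilon>" using bound unfolding reg_bound_def aa S_def by linarith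
  moreover have "0 \<le> d / a" using a by (simp add: d_def)
  ultimately show "Re \<epsilon> < 0" by linarith
  have "d < a * (- Re \<epsilon>)" using lt a by (simp add: field_simps)
  then have "d\<^sup>2 < (a * (- Re \<epsilon>))\<^sup>2" by (intro power_strict_mono) (auto simp: d_def)
  then show "(of_int J1 - sqrt (2 * N) * Im \<epsilon>)\<^sup>2 < (sqrt (2 * N) * Re \<epsilon>)\<^sup>2"
      by (simp add: d_def a_def power_mult_distrib)
qed

section \<open>Quantum dimensions\<close>

lemma sin_ratio_periodic:
  assumes "q \<noteq> 0" "j = m + 2 * q * i"
  shows "sin (pi * (of_int r / of_int q) * of_int j) = sin (pi * of_int m / of_int q * of_int r)"
proof -
  have "pi * (of_int r / of_int q) * of_int j = pi * of_int m / of_int q * of_int r + pi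
      * of_int (2 * (r * i))"
    using assms by (simp add: field_simps)
  then show ?thesis by (simp only: sin_add_int_pi) (simp add: parity_sign_def)
qed

lemma cos_ratio_multiple:
  assumes "q \<noteq> 0" "j = q * i"
  shows "cos (pi * (of_int r / of_int q) * of_int j) = parity_sign (r * i)"
proof -
  have "pi * (of_int r / of_int q) * of_int j = pi * of_int (r * i)" using assms by simp
  then show ?thesis by (simp only: cos_npi_int parity_sign_def)
qed

lemma sin_ratio_next_to_multiple:
  assumes "q \<noteq> 0" "j = q * i + \<sigma>" "\<sigma> = 1 \<or> \<sigma> = - 1"
  shows "sin (pi * (of_int r / of_int q) * of_int j)
      = parity_sign (r * i) * (of_int \<sigma> * sin (pi * of_int r / of_int q))"
proof -
  have "pi * (of_int r / of_int q) * of_int j = of_int \<sigma> * (pi * of_int r / of_int q) + pi * of_int (r * i)"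
    using assms by (simp add: field_simps)
  then show ?thesis using assms(3) by (auto simp only: sin_add_int_pi)
      (auto simp del: times_divide_eq_right times_divide_eq_left)
qed

lemma parity_sign_0: "parity_sign 0 = 1"
  by (simp add: parity_sign_def)

lemma imaginary_ratio:
  "(4 * of_real x * (\<i> * of_real u)) / (4 * of_real y * (\<i> * of_real v))
      = complex_of_real (x * u / (y * v))"
  by simp

theorem proposition18:
  fixes pp pm k m r s n :: int and \<epsilon> :: complex
  assumes "pp \<ge> 2" and "pm \<ge> 2" and "coprime pp pm"
    and "m \<in> {0..2 * pp * pm - 1}"
    and "Re \<epsilon> < reg_bound pp pm \<epsilon>"
    and "\<epsilon> \<in> strip pp pm k m"
    and not_centre: "pp * pm dvd m \<Longrightarrow>
      Im \<epsilon> / sqrt (2 * of_int pp * of_int pm) \<noteq> of_int k + of_int m / (2 * of_int pp * of_int pm)"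
    and "1 \<le> r" and "r \<le> pp" and "1 \<le> s" and "s \<le> pm"
  shows "has_qdim pp pm \<epsilon> (ch_I pp pm \<epsilon> r s n) (complex_of_real (
    if \<not> pp dvd m \<and> \<not> pm dvd m then
      (-1) powi (m * n)
        * (sin (pi * of_int m / of_int pp * of_int r) * sin (pi * of_int m / of_int pm * of_int s))
        / (sin (pi * of_int m / of_int pp) * sin (pi * of_int m / of_int pm))
    else if \<not> pp dvd m then
      (let t = m div pm in
        of_int s * (-1) powi (t * (pm * n + 1 + s))
          * sin (pi * of_int t * of_int pm / of_int pp * of_int r)
          / sin (pi * of_int t * of_int pm / of_int pp))
    else if \<not> pm dvd m then
      (let t = m div pp in
        of_int r * (-1) powi (t * (pp * n + 1 + r))
          * sin (pi * of_int t * of_int pp / of_int pm * of_int s)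
          / sin (pi * of_int t * of_int pp / of_int pm))
    else
      (let t = m div (pp * pm) in
        (-1) powi (n + t * (pp * pm * n + pm * (r + 1) + pp * (s + 1)))
          * (sin (pi * of_int r / of_int pp) * sin (pi * of_int s / of_int pm))
          / (sin (pi / of_int pp) * sin (pi / of_int pm)))))"
proof -
  define N where "N = real_of_int pp * real_of_int pm"
  note pp = assms(1) and pm = assms(2)
  note ctx = pp pm N_def
  note r = assms(8,9) and s = assms(10,11)
  define a where "a = sqrt (2 * N)"
  define w where "w = a * Im \<epsilon>"
  define J where "J = m + 2 * pp * pm * k"
  have N: "N > 0" by (rule N_pos[OF ctx])
  have p0: "pp \<noteq> 0" "pm \<noteq> 0" using pp pm by auto
  have a: "a > 0" "a * a = 2 * N" using N by (auto simp: a_def)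
  have aa: "sqrt (2 * of_int pp * of_int pm) = a" by (simp add: a_def N_def mult.assoc)
  have N2: "2 * of_int pp * of_int pm = 2 * N" and N4: "4 * of_int pp * of_int pm = 4 * N"
    by (simp_all add: N_def)
  have w_scaled: "w = 2 * N * (Im \<epsilon> / a)" using a by (simp add: w_def field_simps)
  have J_scaled: "real_of_int J = 2 * N * (of_int k + of_int m / (2 * N))"
    using p0 by (simp add: J_def N_def field_simps)
  have near: "\<bar>w - of_int J\<bar> < 1 / 2"
  proof -
    have b: "of_int k + (2 * of_int m - 1) / (4 * N) < Im \<epsilon> / a" "Im \<epsilon> / a < of_int k
        + (2 * of_int m + 1) / (4 * N)"
      using assms(6) unfolding strip_def mem_Collect_eq aa N4 by blast+
    have "2 * N * (of_int k + (2 * of_int m - 1) / (4 * N)) < w" "w < 2 * N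
        * (of_int k + (2 * of_int m + 1) / (4 * N))"
      unfolding w_scaled using mult_strict_left_mono[OF b(1), of "2
          * N"] mult_strict_left_mono[OF b(2), of "2 * N"] N
      by (simp_all only: zero_less_mult_iff zero_less_numeral simp_thms)
    moreover have "2 * N * (of_int k + (2 * of_int m - 1) / (4 * N)) = of_int J - 1 / 2"
      "2 * N * (of_int k + (2 * of_int m + 1) / (4 * N)) = of_int J + 1 / 2"
      unfolding J_scaled using N by (simp_all add: field_simps)
    ultimately show ?thesis by linarith
  qed
  have dvdJ: "pp dvd J \<longleftrightarrow> pp dvd m" "pm dvd J \<longleftrightarrow> pm dvd m"
    by (simp_all add: J_def dvd_add_left_iff)
  have gap: "(of_int j - w)\<^sup>2 - (of_int J - w)\<^sup>2 \<ge> (1 - 2 * \<bar>w - of_int J\<bar>) * (of_int (j - J))\<^sup>2"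
      if "j \<noteq> J" for j
    by (rule nearest_integer_gap[OF near that])
  have nearest: "(of_int J - w)\<^sup>2 \<le> (of_int j - w)\<^sup>2" for j
  proof (cases "j = J")
    case False
    have "0 \<le> (1 - 2 * \<bar>w - of_int J\<bar>) * (of_int (j - J))\<^sup>2" using near by (intro mult_nonneg_nonneg) auto
    then show ?thesis using gap[OF False] by linarith
  qed simp
  have sinr: "sin (pi * (of_int r / of_int pp) * of_int J) = sin (pi * of_int m / of_int pp * of_int r)"
      for r
    by (rule sin_ratio_periodic[OF p0(1), of _ _ "pm * k"]) (simp add: J_def)
  have sins: "sin (pi * (of_int s / of_int pm) * of_int J) = sin (pi * of_int m / of_int pm * of_int s)"
      for s
    by (rule sin_ratio_periodic[OF p0(2), of _ _ "pp * k"]) (simp add: J_def)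
  have sinr1: "sin (pi * (1 / of_int pp) * of_int J) = sin (pi * of_int m / of_int pp)"
    and sins1: "sin (pi * (1 / of_int pm) * of_int J) = sin (pi * of_int m / of_int pm)"
    using sinr[of 1] sins[of 1] by (simp_all only: of_int_1 mult_1_right)
  show ?thesis
  proof (cases "pp dvd m \<and> pm dvd m")
    case False
    have e: "Re \<epsilon> < 0" and growth: "(of_int J - sqrt (2 * N) * Im \<epsilon>)\<^sup>2 < (sqrt (2 * N) * Re \<epsilon>)\<^sup>2"
      using growth_of_reg_bound[OF ctx assms(5), of J] nearest unfolding w_def a_def by auto
    \<comment> \<open>The mode \<open>J\<close> has a non-zero coefficient in the vacuum, so it is itself the dominant one.\<close>
    define \<delta> where "\<delta> = 1 - 2 * \<bar>w - of_int J\<bar>"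
    have \<delta>: "\<delta> > 0" using near by (simp add: \<delta>_def)
    have dom: "(of_int j - sqrt (2 * N) * Im \<epsilon>)\<^sup>2 - (of_int J - sqrt (2 * N) * Im \<epsilon>)\<^sup>2
        \<ge> \<delta> * (of_int (j - J))\<^sup>2"
      if "j \<noteq> J" for j
      using gap[OF that] unfolding \<delta>_def w_def a_def .
    have centre: "J \<noteq> J \<Longrightarrow> pp dvd J \<and> pm dvd J" by simp
    note Q = has_qdim_of_dominant_mode[OF ctx e r s \<delta> centre dom growth, of n]
    show ?thesis
    proof (cases "pp dvd m \<or> pm dvd m")
      case nodvd: False
      then have c: "\<not> pp dvd m \<and> \<not> pm dvd m" by simp
      have "parity_sign (n * J) = parity_sign (m * n)"
          by (rule parity_sign_cong) (simp add: J_def algebra_simps)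
      then have "phase_sum signs sign_prod (shift n (of_int r / of_int pp) (of_int s / of_int pm)) J /
          phase_sum signs sign_prod (shift 0 (1 / of_int pp) (1 / of_int pm)) J =
        complex_of_real (parity_sign (m * n)
        * (sin (pi * of_int m / of_int pp * of_int r) * sin (pi * of_int m / of_int pm * of_int s))
        / (sin (pi * of_int m / of_int pp) * sin (pi * of_int m / of_int pm)))"
        unfolding phase_sum_signs sinr sins sinr1 sins1 by (simp add: parity_sign_def[of 0])
      then show ?thesis
        using Q(1) c unfolding if_P[OF c] powi_minus_one by (simp only: dvdJ not_False_eq_True simp_thms)
    next
      case dvd: True
      show ?thesis
      proof (cases "pp dvd m")
        case ppm: False
        then have pmm: "pm dvd m" using dvd by simp
        \<comment> \<open>The leading coefficients vanish because of the factor \<open>sin (\<pi> J s / p\<^sub>-)\<close>; the subleading ones decide.\<close>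
        define t where "t = m div pm"
        define i where "i = t + 2 * pp * k"
        have mt: "m = pm * t" using pmm by (simp add: t_def)
        have Ji: "J = pm * i" by (simp add: J_def i_def mt algebra_simps)
        have z: "sin (pi * (of_int s / of_int pm) * of_int J)
            = 0" "sin (pi * (1 / of_int pm) * of_int J) = 0"
          using sin_int_ratio_zero[OF p0(2), of J s] sin_int_ratio_zero[OF p0(2), of J 1] Ji by auto
        have c: "cos (pi * (of_int s / of_int pm) * of_int J)
            = parity_sign (s * i)" "cos (pi * (1 / of_int pm) * of_int J) = parity_sign i"
          using cos_ratio_multiple[OF p0(2) Ji, of s] cos_ratio_multiple[OF p0(2) Ji, of 1] by auto
        have mr: "pi * of_int t * of_int pm = pi * of_int m" by (simp add: mt)
        have "sin (pi * of_int m / of_int pp) \<noteq> 0"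
          using sin_int_ratio_nonzero[OF p0(1), of J] ppm unfolding sinr1 dvdJ by blast
        then have "(parity_sign (n * J) * (of_int s / of_int pm * sin (pi * of_int m / of_int pp
            * of_int r) * parity_sign (s * i)))
            / (1 / of_int pm * sin (pi * of_int m / of_int pp) * parity_sign i)
          = of_int s * (parity_sign (n * J) * parity_sign (s * i) * parity_sign i) * sin (pi * of_int m
              / of_int pp * of_int r) / sin (pi * of_int m / of_int pp)"
          using p0 by (simp add: parity_sign_def[of i])
        also have "parity_sign (n * J) * parity_sign (s * i) * parity_sign i
            = parity_sign (t * (pm * n + 1 + s))"
          unfolding parity_sign_mult by (rule parity_sign_cong) (simp add: Ji i_def algebra_simps)
        finally have "phase_sum signs (\<lambda>c. sign_prod c
            * of_real (shift n (of_int r / of_int pp) (of_int s / of_int pm) c)) (shift n (of_int r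
            / of_int pp) (of_int s / of_int pm)) J /
           phase_sum signs (\<lambda>c. sign_prod c * of_real (shift 0 (1 / of_int pp) (1 / of_int pm) c))
               (shift 0 (1 / of_int pp) (1 / of_int pm)) J
           = complex_of_real (of_int s * parity_sign (t * (pm * n + 1 + s)) * sin (pi * of_int m
               / of_int pp * of_int r) / sin (pi * of_int m / of_int pp))"
          unfolding phase_sum_signs_moment z c sinr sinr1 imaginary_ratio mult_zero_right mult_zero_left
              add_0_left of_real_0
          by (simp only: mult_1 parity_sign_0)
        then show ?thesis
          using Q(2) ppm pmm unfolding Let_def t_def[symmetric] powi_minus_one mr
          by (simp only: dvdJ not_False_eq_True simp_thms if_True if_False)
      next
        case ppm: True
        then have pmm: "\<not> pm dvd m" using False by simp
        define t where "t = m div pp"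
        define i where "i = t + 2 * pm * k"
        have mt: "m = pp * t" using ppm by (simp add: t_def)
        have Ji: "J = pp * i" by (simp add: J_def i_def mt algebra_simps)
        have z: "sin (pi * (of_int r / of_int pp) * of_int J)
            = 0" "sin (pi * (1 / of_int pp) * of_int J) = 0"
          using sin_int_ratio_zero[OF p0(1), of J r] sin_int_ratio_zero[OF p0(1), of J 1] Ji by auto
        have c: "cos (pi * (of_int r / of_int pp) * of_int J)
            = parity_sign (r * i)" "cos (pi * (1 / of_int pp) * of_int J) = parity_sign i"
          using cos_ratio_multiple[OF p0(1) Ji, of r] cos_ratio_multiple[OF p0(1) Ji, of 1] by auto
        have mr: "pi * of_int t * of_int pp = pi * of_int m" by (simp add: mt)
        have "sin (pi * of_int m / of_int pm) \<noteq> 0"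
          using sin_int_ratio_nonzero[OF p0(2), of J] pmm unfolding sins1 dvdJ by blast
        then have "(parity_sign (n * J) * (of_int r / of_int pp * parity_sign (r * i)
            * sin (pi * of_int m / of_int pm * of_int s)))
            / (1 / of_int pp * parity_sign i * sin (pi * of_int m / of_int pm))
          = of_int r * (parity_sign (n * J) * parity_sign (r * i) * parity_sign i) * sin (pi * of_int m
              / of_int pm * of_int s) / sin (pi * of_int m / of_int pm)"
          using p0 by (simp add: parity_sign_def[of i])
        also have "parity_sign (n * J) * parity_sign (r * i) * parity_sign i
            = parity_sign (t * (pp * n + 1 + r))"
          unfolding parity_sign_mult by (rule parity_sign_cong) (simp add: Ji i_def algebra_simps)
        finally have "phase_sum signs (\<lambda>c. sign_prod c
            * of_real (shift n (of_int r / of_int pp) (of_int s / of_int pm) c)) (shift n (of_int r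
            / of_int pp) (of_int s / of_int pm)) J /
           phase_sum signs (\<lambda>c. sign_prod c * of_real (shift 0 (1 / of_int pp) (1 / of_int pm) c))
               (shift 0 (1 / of_int pp) (1 / of_int pm)) J
           = complex_of_real (of_int r * parity_sign (t * (pp * n + 1 + r)) * sin (pi * of_int m
               / of_int pm * of_int s) / sin (pi * of_int m / of_int pm))"
          unfolding phase_sum_signs_moment z c sins sins1 imaginary_ratio mult_zero_right mult_zero_left
              add_0_left add_0_right of_real_0
          by (simp only: mult_1 parity_sign_0)
        then show ?thesis
          using Q(2) ppm pmm unfolding Let_def t_def[symmetric] powi_minus_one mr
          by (simp only: dvdJ not_False_eq_True not_True_eq_False simp_thms if_True if_False)
      qed
    qed
  next
    case True
    then have Nm: "pp * pm dvd m" using assms(3) by (simp add: divides_mult)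
    define t where "t = m div (pp * pm)"
    have mt: "m = pp * pm * t" using Nm by (simp add: t_def)
    have Jdvd: "pp dvd J" "pm dvd J" using True dvdJ by auto
    \<comment> \<open>At the centre of the strip \<open>J + 1\<close> and \<open>J - 1\<close> would be equally strong, so neither would dominate.\<close>
    have off: "w \<noteq> of_int J"
    proof
      assume "w = of_int J"
      then have "2 * N * (Im \<epsilon> / a) = 2 * N * (of_int k + of_int m / (2 * N))" unfolding w_scaled J_scaled .
      then have "Im \<epsilon> / a = of_int k + of_int m / (2 * N)" using N by (simp only: mult_cancel_left) auto
      then show False using not_centre[OF Nm] unfolding N2 a_def by blast
    qed
    define \<sigma> where "\<sigma> = (if w > of_int J then 1 else - 1 :: int)"
    define J1 where "J1 = J + \<sigma>"
    have \<sigma>: "\<sigma> = 1 \<or> \<sigma> = - 1" by (simp add: \<sigma>_def)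
    define \<delta> where "\<delta> = min (1 / 2) (2 * \<bar>w - of_int J\<bar>)"
    have \<delta>: "\<delta> > 0" using off by (simp add: \<delta>_def)
    have gap2: "(of_int j - w)\<^sup>2 - (of_int J1 - w)\<^sup>2 \<ge> \<delta> * (of_int (j - J))\<^sup>2" if "j \<noteq> J1" "j \<noteq> J" for j
      using second_nearest_integer_gap[OF near \<sigma>_def] that unfolding J1_def \<delta>_def by blast
    have "(of_int J1 - w)\<^sup>2 \<le> (of_int j - w)\<^sup>2" if "\<not> pp * pm dvd j" for j
    proof (cases "j = J1")
      case False
      have "pp * pm dvd J" using Nm by (simp add: J_def dvd_add_left_iff mult.assoc)
      then have "j \<noteq> J" using that by blast
      moreover have "0 \<le> \<delta> * (of_int (j - J))\<^sup>2" using \<delta> by simp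
      ultimately show ?thesis using gap2[OF False] by linarith
    qed simp
    then have e: "Re \<epsilon> < 0" and growth: "(of_int J1 - sqrt (2 * N) * Im \<epsilon>)\<^sup>2 < (sqrt (2 * N) * Re \<epsilon>)\<^sup>2"
      using growth_of_reg_bound[OF ctx assms(5), of J1] unfolding w_def a_def by auto
    have nd: "\<not> q dvd J1" if "q dvd J" "q \<ge> 2" for q
    proof
      assume "q dvd J1"
      then have "q dvd \<sigma>" using that by (simp add: J1_def dvd_add_right_iff)
      then have "q dvd 1" using \<sigma> by auto
      then show False using that by simp
    qed
    have Q: "has_qdim pp pm \<epsilon> (ch_I pp pm \<epsilon> r s n)
      (phase_sum signs sign_prod (shift n (of_int r / of_int pp) (of_int s / of_int pm)) J1 /
       phase_sum signs sign_prod (shift 0 (1 / of_int pp) (1 / of_int pm)) J1)"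
      by (rule has_qdim_of_dominant_mode(1)[OF ctx e r s \<delta> _ gap2[unfolded w_def a_def] growth])
         (use Jdvd nd pp pm in auto)
    \<comment> \<open>The quotients of \<open>J\<close> by \<open>p\<^sub>+\<close> and by \<open>p\<^sub>-\<close>: at \<open>J1 = J + \<sigma>\<close> the sines are those at \<open>\<sigma>\<close>, up to parity signs.\<close>
    define q1 q2 where "q1 = pm * (t + 2 * k)" and "q2 = pp * (t + 2 * k)"
    have J1: "J1 = pp * q1 + \<sigma>" "J1 = pm * q2 + \<sigma>"
      by (simp_all add: J1_def J_def mt q1_def q2_def algebra_simps)
    have sr: "sin (pi * (of_int r / of_int pp) * of_int J1)
        = parity_sign (r * q1) * (of_int \<sigma> * sin (pi * of_int r / of_int pp))"
      "sin (pi * (1 / of_int pp) * of_int J1) = parity_sign q1 * (of_int \<sigma> * sin (pi / of_int pp))"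
      using sin_ratio_next_to_multiple[OF p0(1) J1(1) \<sigma>, of r] sin_ratio_next_to_multiple[OF p0(1) J1(1)
          \<sigma>, of 1] by (simp_all only: of_int_1 mult_1 mult_1_right)
    have ss: "sin (pi * (of_int s / of_int pm) * of_int J1)
        = parity_sign (s * q2) * (of_int \<sigma> * sin (pi * of_int s / of_int pm))"
      "sin (pi * (1 / of_int pm) * of_int J1) = parity_sign q2 * (of_int \<sigma> * sin (pi / of_int pm))"
      using sin_ratio_next_to_multiple[OF p0(2) J1(2) \<sigma>, of s] sin_ratio_next_to_multiple[OF p0(2) J1(2)
          \<sigma>, of 1] by (simp_all only: of_int_1 mult_1 mult_1_right)
    define E where "E = n + t * (pp * pm * n + pm * (r + 1) + pp * (s + 1))"
    have "even (\<sigma> - 1)" using \<sigma> by auto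
    then have "even (n * (\<sigma> - 1) + 2 * (n * pp * pm * k + k * pm * (r + 1) + k * pp * (s + 1)))" by simp
    also have "n * (\<sigma> - 1) + 2 * (n * pp * pm * k + k * pm * (r + 1) + k * pp * (s + 1))
        = (n * J1 + r * q1 + s * q2 + q1 + q2) - E"
      by (simp add: E_def J1_def J_def mt q1_def q2_def algebra_simps)
    finally have "parity_sign (n * J1 + r * q1 + s * q2 + q1 + q2) = parity_sign E"
        by (rule parity_sign_cong)
    then have P: "parity_sign (n * J1) * parity_sign (r * q1) * parity_sign (s * q2) * parity_sign q1
        * parity_sign q2 = parity_sign E"
      by (simp only: parity_sign_mult)
    have "(- 4 * parity_sign (n * J1) * (parity_sign (r * q1)
        * (of_int \<sigma> * sin (pi * of_int r / of_int pp))) * (parity_sign (s * q2)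
        * (of_int \<sigma> * sin (pi * of_int s / of_int pm))))
       / (- 4 * parity_sign (0 * J1) * (parity_sign q1 * (of_int \<sigma> * sin (pi / of_int pp)))
           * (parity_sign q2 * (of_int \<sigma> * sin (pi / of_int pm))))
       = (parity_sign (n * J1) * parity_sign (r * q1) * parity_sign (s * q2) * parity_sign q1
           * parity_sign q2) *
        (sin (pi * of_int r / of_int pp) * sin (pi * of_int s / of_int pm)) / (sin (pi / of_int pp)
            * sin (pi / of_int pm))"
      using \<sigma> by (auto simp: parity_sign_def[of q1] parity_sign_def[of q2] parity_sign_def[of 0])
    then have "phase_sum signs sign_prod (shift n (of_int r / of_int pp) (of_int s / of_int pm)) J1 /
       phase_sum signs sign_prod (shift 0 (1 / of_int pp) (1 / of_int pm)) J1 =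
       complex_of_real (parity_sign E * (sin (pi * of_int r / of_int pp) * sin (pi * of_int s
           / of_int pm)) / (sin (pi / of_int pp) * sin (pi / of_int pm)))"
      unfolding phase_sum_signs sr ss P of_real_divide[symmetric] by (simp only:)
    then show ?thesis
      using Q True unfolding Let_def t_def[symmetric] powi_minus_one E_def[symmetric]
      by (simp only: not_True_eq_False simp_thms if_True if_False)
  qed
qed

end
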